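(* Fix finite signatures $\Sigma,\Pi$. Given an automaton formula $V$, variables $\overline y$, a goal formula $G$ and an automaton formula $U$, it is decidable whether $V,\overline y\vdash G\rhd^* U$. Hence, for an existential-free $\mathsf{MSL}(\omega)$ definite formula $D$, the canonical solved form $\mathcal V(D)$ is computable.
   Context: **Existential-free $\mathsf{MSL}(\omega)$.** Constructor types: $\gamma ::= \iota \mid \gamma \to \gamma$. $\Sigma$ is a finite set of function symbols of constructor types, $\Pi$ a finite set of predicate symbols of type $\iota\to o$. Terms are simply typed applicative terms over variables of constructor types and $\Sigma$. Goal formulas: $G ::= P\,s \mid G\wedge G \mid \mathsf{true}$ ($s:\iota$ a term). Definite formulas are finite sets (conjunctions) of clauses $\forall\overline{y{:}\gamma}.\,G\Rightarrow P\,(c\,\overline y)$ with $\overline y$ distinct variables, $c\in\Sigma$, $c\,\overline y:\iota$. Formulas are taken up to renaming of bound variables and associativity, commutativity and idempotence of $\wedge$ with unit $\mathsf{true}$. **Automaton formulas.** $U ::= \mathsf{true}\mid U\wedge U\mid P\,x\mid P\,c\mid \forall\overline{y{:}\gamma}.\,U\Rightarrow P\,(f\,\overline y)\mid \forall\overline{y{:}\gamma}.\,U\Rightarrow P\,(x\,\overline y)$ ($x$ a variable, $c,f\in\Sigma$, $\overline y$ distinct), required to be derivable by the typing judgement $\Delta\vdash U:o$ with rules: $\vdash P\,c:o$ if $c:\iota\in\Sigma$; $x{:}\iota\vdash P\,x:o$; if $\overline{y{:}\gamma}\vdash U:o$ and $f:\overline\gamma\to\iota\in\Sigma$ then $\vdash\forall\overline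 y.\,U\Rightarrow P\,(f\,\overline y):o$; if $\overline{y{:}\gamma}\vdash U:o$ then $x{:}\overline\gamma\to\iota\vdash\forall\overline y.\,U\Rightarrow P\,(x\,\overline y):o$; $\Delta\vdash\mathsf{true}:o$ for every $\Delta$; if $\Delta_1\vdash U:o$, $\Delta_2\vdash V:o$ and ($\Delta_1=\emptyset$ iff $\Delta_2=\emptyset$) then $\Delta_1\cup\Delta_2\vdash U\wedge V:o$. An automaton clause is a non-conjunctive automaton formula other than $\mathsf{true}$; each concerns exactly one free variable or one symbol of $\Sigma$ at top level. $P\,c$ is read also as the clause with empty $\overline y$ and body $\mathsf{true}$. $U$ is automaton with respect to $\overline y$ if $\overline{y{:}\gamma}\vdash U:o$; for such $U$ and a sublist $\overline z$ of its variables, $U_{|\overline z}$ is the conjunction of the clauses of $U$ whose free variable is in $\overline z$. **Rewriting.** The goal formulas being rewritten extend the goal formulas above by nested implications $\forall\overline z.\,U\Rightarrow G$ with $U$ automaton with respect to $\overline z$. For a finite set $V$ of automaton clauses and variables $\overline y$, the one-step relation $V,\overline y\vdash G\rhd H$ is given by: (Refl) $V,\overline y\vdash P\,x\rhd\mathsf{true}$ if $P\,x\in V$. (Step) $V,\overline y\vdash P\,(f\,\overline s)\rhd U[\overline s/\overline x]$ if $(\forall\overline x.\,U\Rightarrow P\,(f\,\overline x))\in V$ (here $f$ is the head symbol of the clause: a function symbol, or a variable concerned by a clause of $V$). (Assm) $V,\overline y\vdash P\,(y\,\overline s)\rhd U_{|\overline z}[\overline s/\overline z]\wedge(\forall\overline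 z.\,U_{|\overline z}\Rightarrow P\,(y\,\overline z))$ if $y\in\overline y$ and $(\forall\overline x\,\overline z.\,U\Rightarrow P\,(f\,\overline x\,\overline z))\in V$, with $\overline z$ and $\overline s$ of the same length and matching types. (AndL)/(AndR) closure under rewriting the left/right conjunct. (Imp) $V,\overline y\vdash(\forall\overline z.\,U\Rightarrow G)\rhd(\forall\overline z.\,U\Rightarrow G')$ if $U\wedge V,\overline y\vdash G\rhd G'$ and $G$ is not of the form $P\,(y\,\overline z)$ with $y\in\overline y$. (Scope) $V,\overline y\vdash(\forall\overline z.\,U\Rightarrow G)\rhd G$ if no variable of $\overline z$ is free in $G$. (ImpAnd) $V,\overline y\vdash(\forall\overline z.\,G_1\Rightarrow G_2\wedge G_3)\rhd(\forall\overline z.\,G_1\Rightarrow G_2)\wedge(\forall\overline z.\,G_1\Rightarrow G_3)$. $\rhd^*$ is the reflexive-transitive closure. **Canonical solved form.** $\mathcal V(D)$ is the least set of automaton clauses such that: whenever $(\forall\overline y.\,G\Rightarrow A)\in D$, $V\subseteq\mathcal V(D)$ is finite, and $V,\overline y\vdash G\rhd^*U$ with $U$ an automaton formula with respect to $\overline y$, then $(\forall\overline y.\,U\Rightarrow A)\in\mathcal V(D)$. *)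

theory Defs
  imports Main "HOL-Library.FSet" "HOL-Library.Nat_Bijection"
begin

section \<open>Types, terms and formulas\<close>

datatype ty = Iota | Fun ty ty

text \<open>Variables are de Bruijn indices, so formulas are syntactically equal up to renaming of bound
  variables.  Function and predicate symbols are natural numbers.\<close>

datatype tm = Var nat | Sym nat | App tm tm

text \<open>A formula is the finite set of its non-conjunctive conjuncts: the empty set is \<open>true\<close>
  and union is conjunction.  This makes conjunction associative, commutative and idempotent with
  unit \<open>true\<close>, also below implications.

  \<open>Imp zs U G\<close> is \<open>\<forall>z\<^sub>0:zs!0 \<dots> z\<^sub>n\<^sub>-\<^sub>1:zs!(n-1). U \<Rightarrow> G\<close> with \<open>n = length zs\<close>.
  In \<open>U\<close> and \<open>G\<close> the index \<open>i < n\<close> denotes \<open>z\<^sub>i\<close>, and the index \<open>n + j\<close> denotes the variable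
  that is called \<open>j\<close> outside.\<close>

datatype fm = Atom nat tm | Imp "ty list" "fm fset" "fm fset"

type_synonym formula = "fm fset"

text \<open>A variable context lists the types of the variables \<open>0, 1, \<dots>\<close>; a signature of function
  symbols is a partial function assigning types.\<close>

type_synonym ctxt = "ty list"
type_synonym sig = "nat \<Rightarrow> ty option"

definition fun_ty :: "ty list \<Rightarrow> ty" where
  "fun_ty ts = foldr Fun ts Iota"

definition apps :: "tm \<Rightarrow> tm list \<Rightarrow> tm" where
  "apps h ss = foldl App h ss"

definition bvars :: "ty list \<Rightarrow> tm list" where
  "bvars zs = map Var [0..<length zs]"

inductive has_ty :: "sig \<Rightarrow> ctxt \<Rightarrow> tm \<Rightarrow> ty \<Rightarrow> bool" for S :: sig and \<Gamma> :: ctxt where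
  "i < length \<Gamma> \<Longrightarrow> has_ty S \<Gamma> (Var i) (\<Gamma> ! i)"
| "S c = Some t \<Longrightarrow> has_ty S \<Gamma> (Sym c) t"
| "has_ty S \<Gamma> u (Fun a b) \<Longrightarrow> has_ty S \<Gamma> v a \<Longrightarrow> has_ty S \<Gamma> (App u v) b"


section \<open>Substitution\<close>

primrec subst_tm :: "(nat \<Rightarrow> tm) \<Rightarrow> tm \<Rightarrow> tm" where
  "subst_tm \<sigma> (Var i) = \<sigma> i"
| "subst_tm \<sigma> (Sym c) = Sym c"
| "subst_tm \<sigma> (App u v) = App (subst_tm \<sigma> u) (subst_tm \<sigma> v)"

definition lift_tm :: "nat \<Rightarrow> tm \<Rightarrow> tm" where
  "lift_tm n = subst_tm (\<lambda>i. Var (i + n))"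

definition under :: "nat \<Rightarrow> (nat \<Rightarrow> tm) \<Rightarrow> nat \<Rightarrow> tm" where
  "under n \<sigma> i = (if i < n then Var i else lift_tm n (\<sigma> (i - n)))"

primrec subst_fm :: "fm \<Rightarrow> (nat \<Rightarrow> tm) \<Rightarrow> fm" where
  "subst_fm (Atom P t) = (\<lambda>\<sigma>. Atom P (subst_tm \<sigma> t))"
| "subst_fm (Imp zs U G) = (\<lambda>\<sigma>.
     Imp zs ((\<lambda>s. s (under (length zs) \<sigma>)) |`| (subst_fm |`| U))
            ((\<lambda>s. s (under (length zs) \<sigma>)) |`| (subst_fm |`| G)))"

definition subst :: "(nat \<Rightarrow> tm) \<Rightarrow> formula \<Rightarrow> formula" where
  "subst \<sigma> G = (\<lambda>C. subst_fm C \<sigma>) |`| G"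

definition lift :: "nat \<Rightarrow> formula \<Rightarrow> formula" where
  "lift n = subst (\<lambda>i. Var (i + n))"

text \<open>\<open>subst (inst ss) U\<close> is \<open>U[ss/xs]\<close> for \<open>U\<close> below the binder of \<open>xs\<close>.\<close>

definition inst :: "tm list \<Rightarrow> nat \<Rightarrow> tm" where
  "inst ss i = (if i < length ss then ss ! i else Var (i - length ss))"

primrec fv_tm :: "tm \<Rightarrow> nat set" where
  "fv_tm (Var i) = {i}"
| "fv_tm (Sym c) = {}"
| "fv_tm (App u v) = fv_tm u \<union> fv_tm v"

primrec fv_fm :: "fm \<Rightarrow> nat set" where
  "fv_fm (Atom P t) = fv_tm t"
| "fv_fm (Imp zs U G) =
     {i. i + length zs \<in> \<Union> (fset (fv_fm |`| U)) \<union> \<Union> (fset (fv_fm |`| G))}"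


section \<open>Automaton formulas\<close>

text \<open>The clause \<open>\<forall>ys:ts. U \<Rightarrow> P (h ys)\<close>, where the head \<open>h\<close> is a symbol or a variable
  living outside the binder.  For empty \<open>ys\<close> and \<open>U = true\<close> it is identified with the atom \<open>P h\<close>.\<close>

definition clause :: "ty list \<Rightarrow> formula \<Rightarrow> nat \<Rightarrow> tm \<Rightarrow> fm" where
  "clause ts U P h =
     (let A = Atom P (apps (lift_tm (length ts) h) (bvars ts))
      in if ts = [] \<and> U = {||} then A else Imp ts U {|A|})"

text \<open>Type environments as sets of typed variables; \<open>env ts\<close> declares the variables
  \<open>0, \<dots>, length ts - 1\<close>.\<close>

definition env :: "ty list \<Rightarrow> (nat \<times> ty) set" where
  "env ts = {(i, ts ! i) | i. i < length ts}"

text \<open>\<open>automaton S Pr \<Delta> U\<close> is the judgement \<open>\<Delta> \<turnstile> U : o\<close> over function symbols \<open>S\<close> and predicate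
  symbols \<open>Pr\<close>.  Quantifier prefixes are nonempty: the clauses with an empty prefix are the atoms
  \<open>P c\<close> and \<open>P x\<close>.\<close>

inductive automaton :: "sig \<Rightarrow> nat set \<Rightarrow> (nat \<times> ty) set \<Rightarrow> formula \<Rightarrow> bool"
  for S :: sig and Pr :: "nat set" where
  aut_const: "P \<in> Pr \<Longrightarrow> S c = Some Iota \<Longrightarrow> automaton S Pr {} {|Atom P (Sym c)|}"
| aut_var: "P \<in> Pr \<Longrightarrow> automaton S Pr {(x, Iota)} {|Atom P (Var x)|}"
| aut_fun: "P \<in> Pr \<Longrightarrow> ts \<noteq> [] \<Longrightarrow> automaton S Pr (env ts) U \<Longrightarrow> S f = Some (fun_ty ts) \<Longrightarrow>
    automaton S Pr {} {|clause ts U P (Sym f)|}"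
| aut_app: "P \<in> Pr \<Longrightarrow> ts \<noteq> [] \<Longrightarrow> automaton S Pr (env ts) U \<Longrightarrow>
    automaton S Pr {(x, fun_ty ts)} {|clause ts U P (Var x)|}"
| aut_true: "automaton S Pr \<Delta> {||}"
| aut_and: "automaton S Pr \<Delta>1 U \<Longrightarrow> automaton S Pr \<Delta>2 V \<Longrightarrow> (\<Delta>1 = {} \<longleftrightarrow> \<Delta>2 = {}) \<Longrightarrow>
    automaton S Pr (\<Delta>1 \<union> \<Delta>2) (U |\<union>| V)"

definition automaton_formula :: "sig \<Rightarrow> nat set \<Rightarrow> ctxt \<Rightarrow> formula \<Rightarrow> bool" where
  "automaton_formula S Pr \<Gamma> U \<longleftrightarrow> (\<exists>\<Delta> \<subseteq> env \<Gamma>. automaton S Pr \<Delta> U)"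

text \<open>For \<open>U\<close> below the binder of \<open>xs @ zs\<close>, \<open>restrict xs zs U\<close> is \<open>U\<close> restricted to \<open>zs\<close>,
  renumbered so as to live below a binder of \<open>zs\<close> alone.  (Each clause of such an automaton
  formula has exactly one free variable.)\<close>

definition restrict :: "ty list \<Rightarrow> ty list \<Rightarrow> formula \<Rightarrow> formula" where
  "restrict xs zs U = subst (\<lambda>i. Var (i - length xs))
     (ffilter (\<lambda>C. fv_fm C \<inter> {length xs ..< length xs + length zs} \<noteq> {}) U)"


section \<open>Goal formulas and definite formulas\<close>

text \<open>Goal formulas, with the nested implications needed for rewriting.\<close>

inductive goal_fm :: "sig \<Rightarrow> nat set \<Rightarrow> ctxt \<Rightarrow> fm \<Rightarrow> bool"
  for S :: sig and Pr :: "nat set" where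
  "P \<in> Pr \<Longrightarrow> has_ty S \<Gamma> t Iota \<Longrightarrow> goal_fm S Pr \<Gamma> (Atom P t)"
| "automaton S Pr (env zs) U \<Longrightarrow> (\<forall>C \<in> fset G. goal_fm S Pr (zs @ \<Gamma>) C) \<Longrightarrow>
    goal_fm S Pr \<Gamma> (Imp zs U G)"

definition goal :: "sig \<Rightarrow> nat set \<Rightarrow> ctxt \<Rightarrow> formula \<Rightarrow> bool" where
  "goal S Pr \<Gamma> G \<longleftrightarrow> (\<forall>C \<in> fset G. goal_fm S Pr \<Gamma> C)"

text \<open>Goal formulas of existential-free MSL(\<open>\<omega>\<close>), i.e. conjunctions of atoms.\<close>

definition basic_goal :: "sig \<Rightarrow> nat set \<Rightarrow> ctxt \<Rightarrow> formula \<Rightarrow> bool" where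
  "basic_goal S Pr \<Gamma> G \<longleftrightarrow>
     (\<forall>C \<in> fset G. \<exists>P t. C = Atom P t \<and> P \<in> Pr \<and> has_ty S \<Gamma> t Iota)"

definition definite :: "sig \<Rightarrow> nat set \<Rightarrow> formula \<Rightarrow> bool" where
  "definite S Pr D \<longleftrightarrow>
     (\<forall>C \<in> fset D. \<exists>ts G P c. C = clause ts G P (Sym c) \<and> P \<in> Pr \<and>
        S c = Some (fun_ty ts) \<and> basic_goal S Pr ts G)"


section \<open>Rewriting\<close>

definition is_head :: "tm \<Rightarrow> bool" where
  "is_head h \<longleftrightarrow> (\<exists>c. h = Sym c) \<or> (\<exists>x. h = Var x)"

text \<open>\<open>rew S \<Gamma> V ys G H\<close> is \<open>V, ys \<turnstile> G \<rhd> H\<close>, where \<open>\<Gamma>\<close> types the free variables.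
  Union being commutative, \<open>rew_and\<close> is both (AndL) and (AndR).  In \<open>rew_imp\<close>, passing below the
  binder of \<open>zs\<close> renumbers \<open>V\<close> and \<open>ys\<close>.  In \<open>rew_scope\<close>, \<open>lift (length zs) G\<close> is an
  arbitrary formula below the binder in which no variable of \<open>zs\<close> is free.\<close>

inductive rew :: "sig \<Rightarrow> ctxt \<Rightarrow> formula \<Rightarrow> nat list \<Rightarrow> formula \<Rightarrow> formula \<Rightarrow> bool"
  for S :: sig where
  rew_refl:
    "Atom P (Var x) |\<in>| V \<Longrightarrow> rew S \<Gamma> V ys {|Atom P (Var x)|} {||}"
| rew_step:
    "clause xs U P f |\<in>| V \<Longrightarrow> is_head f \<Longrightarrow> length ss = length xs \<Longrightarrow>
     rew S \<Gamma> V ys {|Atom P (apps f ss)|} (subst (inst ss) U)"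
| rew_assm:
    "y \<in> set ys \<Longrightarrow> clause (xs @ zs) U P f |\<in>| V \<Longrightarrow> is_head f \<Longrightarrow>
     list_all2 (has_ty S \<Gamma>) ss zs \<Longrightarrow>
     rew S \<Gamma> V ys {|Atom P (apps (Var y) ss)|}
       (subst (inst ss) (restrict xs zs U) |\<union>| {|clause zs (restrict xs zs U) P (Var y)|})"
| rew_and:
    "rew S \<Gamma> V ys G G' \<Longrightarrow> rew S \<Gamma> V ys (G |\<union>| H) (G' |\<union>| H)"
| rew_imp:
    "rew S (zs @ \<Gamma>) (U |\<union>| lift (length zs) V) (map (\<lambda>y. y + length zs) ys) G G' \<Longrightarrow>
     \<not> (\<exists>P. \<exists>y \<in> set ys. G = {|Atom P (apps (Var (y + length zs)) (bvars zs))|}) \<Longrightarrow>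
     rew S \<Gamma> V ys {|Imp zs U G|} {|Imp zs U G'|}"
| rew_scope:
    "rew S \<Gamma> V ys {|Imp zs U (lift (length zs) G)|} G"
| rew_imp_and:
    "rew S \<Gamma> V ys {|Imp zs U (G |\<union>| H)|} {|Imp zs U G, Imp zs U H|}"

abbreviation rews :: "sig \<Rightarrow> ctxt \<Rightarrow> formula \<Rightarrow> nat list \<Rightarrow> formula \<Rightarrow> formula \<Rightarrow> bool" where
  "rews S \<Gamma> V ys \<equiv> (rew S \<Gamma> V ys)\<^sup>*\<^sup>*"

text \<open>The canonical solved form.  The last premise says that the new element is an automaton clause;
  it only matters for empty \<open>ts\<close>, where it forces \<open>U = true\<close>.\<close>

inductive_set canonical :: "sig \<Rightarrow> nat set \<Rightarrow> formula \<Rightarrow> fm set"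
  for S :: sig and Pr :: "nat set" and D :: formula where
  "clause ts G P (Sym c) |\<in>| D \<Longrightarrow> (\<forall>C \<in> fset V. C \<in> canonical S Pr D) \<Longrightarrow>
   rews S ts V [0..<length ts] G U \<Longrightarrow> automaton S Pr (env ts) U \<Longrightarrow>
   automaton S Pr {} {|clause ts U P (Sym c)|} \<Longrightarrow>
   clause ts U P (Sym c) \<in> canonical S Pr D"


section \<open>Computability\<close>

text \<open>\<open>recfn n f\<close>: on argument lists of length \<open>n\<close>, \<open>f\<close> is a (total) general recursive function.
  Minimisation is applied to regular functions only; by Kleene's normal form theorem this
  yields exactly the total functions among the partial recursive ones.\<close>

inductive recfn :: "nat \<Rightarrow> (nat list \<Rightarrow> nat) \<Rightarrow> bool" where
  rec_zero: "recfn n (\<lambda>xs. 0)"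
| rec_succ: "recfn 1 (\<lambda>xs. Suc (xs ! 0))"
| rec_proj: "i < n \<Longrightarrow> recfn n (\<lambda>xs. xs ! i)"
| rec_comp: "recfn (length gs) f \<Longrightarrow> (\<forall>g \<in> set gs. recfn n g) \<Longrightarrow>
    recfn n (\<lambda>xs. f (map (\<lambda>g. g xs) gs))"
| rec_prim: "recfn n f \<Longrightarrow> recfn (Suc (Suc n)) g \<Longrightarrow>
    recfn (Suc n) (\<lambda>xs. rec_nat (f (tl xs)) (\<lambda>k r. g (k # r # tl xs)) (hd xs))"
| rec_mu: "recfn (Suc n) f \<Longrightarrow> (\<forall>xs. length xs = n \<longrightarrow> (\<exists>k. f (k # xs) = 0)) \<Longrightarrow>
    recfn n (\<lambda>xs. LEAST k. f (k # xs) = 0)"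

definition computable :: "(nat \<Rightarrow> nat) \<Rightarrow> bool" where
  "computable f \<longleftrightarrow> (\<exists>F. recfn 1 F \<and> (\<forall>x. f x = F [x]))"

text \<open>Computability of a function, and decidability of a property, on the inputs in \<open>I\<close>, relative
  to codings by natural numbers.\<close>

definition computable_on :: "'a set \<Rightarrow> ('a \<Rightarrow> nat) \<Rightarrow> ('b \<Rightarrow> nat) \<Rightarrow> ('a \<Rightarrow> 'b) \<Rightarrow> bool" where
  "computable_on I cd cd' F \<longleftrightarrow> (\<exists>f. computable f \<and> (\<forall>x \<in> I. f (cd x) = cd' (F x)))"

definition decidable_on :: "'a set \<Rightarrow> ('a \<Rightarrow> nat) \<Rightarrow> ('a \<Rightarrow> bool) \<Rightarrow> bool" where
  "decidable_on I cd Q \<longleftrightarrow> computable_on I cd of_bool Q"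

primrec code_ty :: "ty \<Rightarrow> nat" where
  "code_ty Iota = 0"
| "code_ty (Fun a b) = Suc (prod_encode (code_ty a, code_ty b))"

primrec code_tm :: "tm \<Rightarrow> nat" where
  "code_tm (Var i) = prod_encode (0, i)"
| "code_tm (Sym c) = prod_encode (1, c)"
| "code_tm (App u v) = prod_encode (2, prod_encode (code_tm u, code_tm v))"

definition code_ctxt :: "ctxt \<Rightarrow> nat" where
  "code_ctxt \<Gamma> = list_encode (map code_ty \<Gamma>)"

primrec code_fm :: "fm \<Rightarrow> nat" where
  "code_fm (Atom P t) = prod_encode (0, prod_encode (P, code_tm t))"
| "code_fm (Imp zs U G) = prod_encode (1, prod_encode (code_ctxt zs,
     prod_encode (set_encode (fset (code_fm |`| U)), set_encode (fset (code_fm |`| G)))))"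

text \<open>\<open>set_encode\<close> is a faithful coding of finite sets only.\<close>

definition code_clauses :: "fm set \<Rightarrow> nat" where
  "code_clauses X = set_encode (code_fm ` X)"

definition code_formula :: "formula \<Rightarrow> nat" where
  "code_formula G = code_clauses (fset G)"

fun code_input :: "ctxt \<times> formula \<times> nat list \<times> formula \<times> formula \<Rightarrow> nat" where
  "code_input (\<Gamma>, V, ys, G, U) = list_encode
     [code_ctxt \<Gamma>, code_formula V, list_encode ys, code_formula G, code_formula U]"

end

theory Submission
  imports Defs
begin

text \<open>A conjunct is rewritten independently of the others, so it suffices that each conjunct lies in
  a finite set of conjuncts closed under rewriting.  For an atom \<open>P s\<close> this follows by induction on a
  rank of \<open>s\<close>: instantiating a clause produces atoms about arguments of \<open>s\<close>, possibly applied to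
  fresh variables whose types are smaller than the type of that argument.  For an implication the
  closed set is built from one for its conclusion, because rewritings commute with renaming, so that
  whatever (Scope) releases can still be followed below the binder.  The reachable formulas are
  therefore finitely many, and they are found by iterating the computable successor function until
  nothing new appears.  Well-typedness is decidable, and the search only starts on well-typed inputs,
  which makes the procedure total.

  The automaton clauses over the finite signatures are finite in number because binders only
  introduce variables of smaller types; hence the stages of the canonical solved form are stable
  after a number of steps that does not depend on the definite formula.\<close>


section \<open>Computable functions between coded types\<close>

text \<open>Termination fails: conjunction is idempotent, so (AndL) and (AndR) may keep the conjunct
  that they rewrite, and (ImpAnd) may reproduce its implication. Only finiteness of the set of
  reachable formulas can hold, which is why closed sets replace a decreasing measure. The dangerous
  rule is (Assm): its new implication ends in an atom with the same head \<open>y\<close>, which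
  (Assm) could rewrite again one binder deeper, without end. The side condition of (Imp) forbids
  exactly this. The rank descends only because the bodies of clauses are headed by variables: an
  instance is then headed by an argument of the rewritten term, whereas a symbol would bring in a
  type unrelated to that term. On the computational side the obstacles are that formulas are nested
  finite sets, that substitutions are functions and have no codes, and that minimisation must
  succeed on every number. Hence a calculus \<open>cmp\<close> of functions tracked on codes, a
  recursion principle for recursive calls on the elements of a finite set, substitutions given by
  finite data, and decoders that are total.\<close>

definition rf :: "nat \<Rightarrow> (nat list \<Rightarrow> nat) \<Rightarrow> bool" where
  "rf n f \<longleftrightarrow> (\<exists>F. recfn n F \<and> (\<forall>xs. length xs = n \<longrightarrow> F xs = f xs))"

lemma rfE:
  assumes "rf n f"
  obtains F where "recfn n F" "\<And>xs. length xs = n \<Longrightarrow> F xs = f xs"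
  using assms unfolding rf_def by blast

text \<open>The reason for using \<open>rf\<close> in place of \<open>recfn\<close>: the latter also
  fixes the values on lists of other lengths, where two descriptions of the same function may
  differ.\<close>

lemma rf_cong: "rf n f \<Longrightarrow> (\<And>xs. length xs = n \<Longrightarrow> f xs = g xs) \<Longrightarrow> rf n g"
  unfolding rf_def by metis

lemma rf_proj: "i < n \<Longrightarrow> rf n (\<lambda>xs. xs ! i)"
  unfolding rf_def using rec_proj by blast

lemma rf_comp1:
  assumes "rf 1 f" "rf n g"
  shows "rf n (\<lambda>xs. f [g xs])"
proof -
  obtain F where F: "recfn 1 F" "\<And>xs. length xs = 1 \<Longrightarrow> F xs = f xs" using assms(1) by (rule rfE) blast
  obtain G where G: "recfn n G" "\<And>xs. length xs = n \<Longrightarrow> G xs = g xs" using assms(2) by (rule rfE) blast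
  have "recfn n (\<lambda>xs. F (map (\<lambda>g. g xs) [G]))"
    using F(1) G(1) by (intro rec_comp) auto
  then show ?thesis unfolding rf_def using F(2) G(2) by (intro exI conjI) auto
qed

lemma rf_comp2:
  assumes "rf 2 f" "rf n g" "rf n h"
  shows "rf n (\<lambda>xs. f [g xs, h xs])"
proof -
  obtain F where F: "recfn 2 F" "\<And>xs. length xs = 2 \<Longrightarrow> F xs = f xs" using assms(1) by (rule rfE) blast
  obtain G where G: "recfn n G" "\<And>xs. length xs = n \<Longrightarrow> G xs = g xs" using assms(2) by (rule rfE) blast
  obtain H where H: "recfn n H" "\<And>xs. length xs = n \<Longrightarrow> H xs = h xs" using assms(3) by (rule rfE) blast
  have "recfn n (\<lambda>xs. F (map (\<lambda>g. g xs) [G, H]))"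
    using F(1) G(1) H(1) by (intro rec_comp) (auto simp: numeral_2_eq_2)
  then show ?thesis unfolding rf_def using F(2) G(2) H(2) by (intro exI conjI) auto
qed

lemma rf_prim:
  assumes "rf n f" "rf (Suc (Suc n)) g"
  shows "rf (Suc n) (\<lambda>xs. rec_nat (f (tl xs)) (\<lambda>k r. g (k # r # tl xs)) (hd xs))"
proof -
  obtain F where F: "recfn n F" "\<And>xs. length xs = n \<Longrightarrow> F xs = f xs" using assms(1) by (rule rfE) blast
  obtain G where G: "recfn (Suc (Suc n)) G" "\<And>xs. length xs = Suc (Suc n) \<Longrightarrow> G xs = g xs"
    using assms(2) by (rule rfE) blast
  show ?thesis unfolding rf_def
  proof (intro exI conjI allI impI)
    show "recfn (Suc n) (\<lambda>xs. rec_nat (F (tl xs)) (\<lambda>k r. G (k # r # tl xs)) (hd xs))"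
      using F(1) G(1) by (rule rec_prim)
    fix xs :: "nat list" assume "length xs = Suc n"
    then have "F (tl xs) = f (tl xs)" "\<And>k r. G (k # r # tl xs) = g (k # r # tl xs)"
      using F(2) G(2) by auto
    then show "rec_nat (F (tl xs)) (\<lambda>k r. G (k # r # tl xs)) (hd xs) =
      rec_nat (f (tl xs)) (\<lambda>k r. g (k # r # tl xs)) (hd xs)" by simp
  qed
qed

lemma rf_mu:
  assumes "rf (Suc n) f" "\<And>xs. length xs = n \<Longrightarrow> \<exists>k. f (k # xs) = 0"
  shows "rf n (\<lambda>xs. LEAST k. f (k # xs) = 0)"
proof -
  obtain F where F: "recfn (Suc n) F" "\<And>xs. length xs = Suc n \<Longrightarrow> F xs = f xs"
    using assms(1) by (rule rfE) blast
  have "recfn n (\<lambda>xs. LEAST k. F (k # xs) = 0)"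
    using F assms(2) by (intro rec_mu) auto
  then show ?thesis unfolding rf_def using F(2) by (intro exI conjI) auto
qed

lemma rf_Suc: "rf n f \<Longrightarrow> rf n (\<lambda>xs. Suc (f xs))"
proof -
  have "rf 1 (\<lambda>xs. Suc (xs ! 0))" unfolding rf_def using rec_succ by blast
  then show "rf n f \<Longrightarrow> rf n (\<lambda>xs. Suc (f xs))" using rf_comp1 by fastforce
qed

lemma rf_const: "rf n (\<lambda>xs. c)"
proof (induction c)
  case 0
  then show ?case unfolding rf_def using rec_zero by blast
qed (rule rf_Suc)

lemma length_1E: "length xs = Suc 0 \<Longrightarrow> (\<And>x. xs = [x] \<Longrightarrow> P) \<Longrightarrow> P"
  by (auto simp: length_Suc_conv)

lemma length_2E: "length xs = 2 \<Longrightarrow> (\<And>x y. xs = [x, y] \<Longrightarrow> P) \<Longrightarrow> P"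
  by (auto simp: numeral_2_eq_2 length_Suc_conv)

lemma rf_rec1:
  assumes "rf 2 g"
  shows "rf 1 (\<lambda>xs. rec_nat c (\<lambda>k r. g [k, r]) (xs ! 0))"
proof -
  have "rf (Suc 0) (\<lambda>xs. rec_nat ((\<lambda>_. c) (tl xs)) (\<lambda>k r. g (k # r # tl xs)) (hd xs))"
    by (rule rf_prim) (use assms rf_const in \<open>auto simp: numeral_2_eq_2\<close>)
  then show ?thesis unfolding One_nat_def by (rule rf_cong) (auto elim!: length_1E)
qed

lemma rf_rec2:
  assumes "rf 1 f" "rf 3 g"
  shows "rf 2 (\<lambda>xs. rec_nat (f [xs ! 1]) (\<lambda>k r. g [k, r, xs ! 1]) (xs ! 0))"
proof -
  have "rf (Suc 1) (\<lambda>xs. rec_nat (f (tl xs)) (\<lambda>k r. g (k # r # tl xs)) (hd xs))"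
    by (rule rf_prim) (use assms in \<open>auto simp: numeral_3_eq_3\<close>)
  then have "rf 2 (\<lambda>xs. rec_nat (f (tl xs)) (\<lambda>k r. g (k # r # tl xs)) (hd xs))"
    by (simp add: numeral_2_eq_2)
  then show ?thesis by (rule rf_cong) (auto elim!: length_2E)
qed

lemma rf_add: "rf n f \<Longrightarrow> rf n g \<Longrightarrow> rf n (\<lambda>xs. f xs + g xs)"
proof -
  have "rf 2 (\<lambda>xs. rec_nat ((\<lambda>ys. ys ! 0) [xs ! 1]) (\<lambda>k r. (\<lambda>ys. Suc (ys ! 1)) [k, r, xs ! 1]) (xs ! 0))"
    by (intro rf_rec2 rf_Suc rf_proj) auto
  moreover have "rec_nat b (\<lambda>k r. Suc r) a = a + b" for a b :: nat by (induction a) auto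
  ultimately have "rf 2 (\<lambda>xs. xs ! 0 + xs ! 1)" by simp
  then show "rf n f \<Longrightarrow> rf n g \<Longrightarrow> rf n (\<lambda>xs. f xs + g xs)" using rf_comp2 by fastforce
qed

lemma rf_pred: "rf n f \<Longrightarrow> rf n (\<lambda>xs. f xs - 1)"
proof -
  have "rf 1 (\<lambda>xs. rec_nat 0 (\<lambda>k r. (\<lambda>ys. ys ! 0) [k, r]) (xs ! 0))"
    by (intro rf_rec1 rf_proj) auto
  moreover have "rec_nat 0 (\<lambda>k r. k) a = a - 1" for a :: nat by (induction a) auto
  ultimately have "rf 1 (\<lambda>xs. xs ! 0 - 1)" by simp
  then show "rf n f \<Longrightarrow> rf n (\<lambda>xs. f xs - 1)" using rf_comp1 by fastforce
qed

lemma rf_diff: "rf n f \<Longrightarrow> rf n g \<Longrightarrow> rf n (\<lambda>xs. f xs - g xs)"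
proof -
  have "rf 2 (\<lambda>xs. rec_nat ((\<lambda>ys. ys ! 0) [xs ! 1]) (\<lambda>k r. (\<lambda>ys. ys ! 1 - 1) [k, r, xs ! 1]) (xs ! 0))"
    by (intro rf_rec2 rf_pred rf_proj) auto
  moreover have "rec_nat b (\<lambda>k r. r - 1) a = b - a" for a b :: nat by (induction a) auto
  ultimately have "rf 2 (\<lambda>xs. xs ! 1 - xs ! 0)" by simp
  then show "rf n f \<Longrightarrow> rf n g \<Longrightarrow> rf n (\<lambda>xs. f xs - g xs)" using rf_comp2[of _ n g f] by fastforce
qed

lemma rf_triangle: "rf n f \<Longrightarrow> rf n (\<lambda>xs. triangle (f xs))"
proof -
  have "rf 1 (\<lambda>xs. rec_nat 0 (\<lambda>k r. (\<lambda>ys. ys ! 1 + Suc (ys ! 0)) [k, r]) (xs ! 0))"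
    by (intro rf_rec1 rf_proj rf_add rf_Suc) auto
  moreover have "rec_nat 0 (\<lambda>k r. r + Suc k) a = triangle a" for a :: nat by (induction a) auto
  ultimately have "rf 1 (\<lambda>xs. triangle (xs ! 0))" by simp
  then show "rf n f \<Longrightarrow> rf n (\<lambda>xs. triangle (f xs))" using rf_comp1 by fastforce
qed

lemma rf_pair: "rf n f \<Longrightarrow> rf n g \<Longrightarrow> rf n (\<lambda>xs. prod_encode (f xs, g xs))"
  unfolding prod_encode_def prod.case by (intro rf_add rf_triangle)

lemma triangle_prod_decode:
  "triangle (fst (prod_decode z) + snd (prod_decode z)) + fst (prod_decode z) = z"
proof -
  have "z = prod_encode (prod_decode z)" by simp
  also have "\<dots> = triangle (fst (prod_decode z) + snd (prod_decode z)) + fst (prod_decode z)"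
    by (simp only: prod_encode_def case_prod_beta)
  finally show ?thesis by simp
qed

lemma triangle_mono: "a \<le> b \<Longrightarrow> triangle a \<le> triangle b"
  by (induction b) (auto simp: le_Suc_eq)

text \<open>Unpairing by minimisation: \<open>prod_encode\<close> lists the pairs diagonal by
  diagonal, and the diagonal containing \<open>a\<close> is the least \<open>k\<close> with
  \<open>a < triangle (Suc k)\<close>. Both components follow by subtraction.\<close>

lemma rf_diag: "rf n f \<Longrightarrow> rf n (\<lambda>xs. fst (prod_decode (f xs)) + snd (prod_decode (f xs)))"
proof -
  have "rf 1 (\<lambda>xs. LEAST k. (\<lambda>ys. Suc (ys ! 1) - triangle (Suc (ys ! 0))) (k # xs) = 0)"
  proof (intro rf_mu rf_diff rf_triangle rf_Suc rf_proj)
    fix xs :: "nat list" assume "length xs = 1"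
    have "\<exists>k. Suc a \<le> triangle (Suc k)" for a by (rule exI[of _ a]) simp
    then show "\<exists>k. Suc ((k # xs) ! 1) - triangle (Suc ((k # xs) ! 0)) = 0" by simp
  qed auto
  moreover have "(LEAST k. Suc a - (triangle k + Suc k) = 0) = fst (prod_decode a) + snd (prod_decode a)" for a
  proof -
    obtain m n where mn: "prod_decode a = (m, n)" by fastforce
    then have a: "a = triangle (m + n) + m" using triangle_prod_decode[of a] by simp
    have "m + n \<le> k" if "Suc a - (triangle k + Suc k) = 0" for k
    proof (rule ccontr)
      assume "\<not> m + n \<le> k"
      then have "triangle (Suc k) \<le> triangle (m + n)" by (intro triangle_mono) auto
      then show False using that a by simp
    qed
    moreover have "Suc a - (triangle (m + n) + Suc (m + n)) = 0" using a by simp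
    ultimately show ?thesis using mn by (intro Least_equality) auto
  qed
  ultimately have "rf 1 (\<lambda>xs. fst (prod_decode (xs ! 0)) + snd (prod_decode (xs ! 0)))"
    by simp
  then show "rf n f \<Longrightarrow> rf n (\<lambda>xs. fst (prod_decode (f xs)) + snd (prod_decode (f xs)))"
    using rf_comp1 by fastforce
qed

lemma rf_fst: "rf n f \<Longrightarrow> rf n (\<lambda>xs. fst (prod_decode (f xs)))"
proof -
  assume f: "rf n f"
  have "a - triangle (fst (prod_decode a) + snd (prod_decode a)) = fst (prod_decode a)" for a
    using triangle_prod_decode[of a] by (metis add_diff_cancel_left')
  moreover have "rf n (\<lambda>xs. f xs - triangle (fst (prod_decode (f xs)) + snd (prod_decode (f xs))))"
    using f by (intro rf_diff rf_triangle rf_diag)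
  ultimately show ?thesis by simp
qed

lemma rf_snd: "rf n f \<Longrightarrow> rf n (\<lambda>xs. snd (prod_decode (f xs)))"
proof -
  assume f: "rf n f"
  then have "rf n (\<lambda>xs. fst (prod_decode (f xs)) + snd (prod_decode (f xs)) - fst (prod_decode (f xs)))"
    by (intro rf_diff rf_diag rf_fst)
  then show ?thesis by simp
qed

lemma computable_rf: "computable f \<longleftrightarrow> rf 1 (\<lambda>xs. f (xs ! 0))"
  unfolding computable_def rf_def
  by (rule ex_cong1) (auto elim!: length_1E)

lemma computable_id: "computable (\<lambda>x. x)"
  unfolding computable_rf by (intro rf_proj) auto

lemma computable_const: "computable (\<lambda>x. c)"
  unfolding computable_rf by (rule rf_const)

lemma rf_computable: "computable f \<Longrightarrow> rf n g \<Longrightarrow> rf n (\<lambda>xs. f (g xs))"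
  using rf_comp1[of "\<lambda>xs. f (xs ! 0)" n g] by (simp add: computable_rf)

lemma computable_comp: "computable f \<Longrightarrow> computable g \<Longrightarrow> computable (\<lambda>x. f (g x))"
  unfolding computable_rf[of g] computable_rf[of "\<lambda>x. f (g x)"] by (rule rf_computable)

lemma computable_Suc: "computable Suc"
  unfolding computable_rf by (intro rf_Suc rf_proj) auto

lemma computable_pair:
  "computable f \<Longrightarrow> computable g \<Longrightarrow> computable (\<lambda>x. prod_encode (f x, g x))"
  unfolding computable_rf by (rule rf_pair)

lemma computable_fst: "computable (\<lambda>x. fst (prod_decode x))"
  unfolding computable_rf by (intro rf_fst rf_proj) auto

lemma computable_snd: "computable (\<lambda>x. snd (prod_decode x))"
  unfolding computable_rf by (intro rf_snd rf_proj) auto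

lemma computable_rec:
  assumes "computable f" "computable g" "computable n"
  shows "computable (\<lambda>x. rec_nat (f x) (\<lambda>k r. g (prod_encode (x, prod_encode (k, r)))) (n x))"
proof -
  have "rf 2 (\<lambda>xs. rec_nat ((\<lambda>ys. f (ys ! 0)) [xs ! 1]) (\<lambda>k r. (\<lambda>ys. g (prod_encode (ys ! 2, prod_encode (ys ! 0, ys ! 1)))) [k, r, xs ! 1]) (xs ! 0))"
    by (intro rf_rec2 rf_computable[OF assms(2)] rf_computable[OF assms(1)] rf_pair rf_proj) auto
  from rf_comp2[OF this, of 1 "\<lambda>xs. n (xs ! 0)" "\<lambda>xs. xs ! 0"] show ?thesis
    using assms(3) unfolding computable_rf by (simp add: rf_proj)
qed

lemma computable_mu:
  assumes "computable f" "\<And>x. \<exists>k. f (prod_encode (x, k)) = 0"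
  shows "computable (\<lambda>x. LEAST k. f (prod_encode (x, k)) = 0)"
proof -
  have "rf 1 (\<lambda>xs. LEAST k. (\<lambda>ys. f (prod_encode (ys ! 1, ys ! 0))) (k # xs) = 0)"
    using assms by (intro rf_mu rf_computable[OF assms(1)] rf_pair rf_proj) auto
  then show ?thesis unfolding computable_rf by simp
qed


section \<open>Encodable types and computable functions between them\<close>

class enc =
  fixes enc :: "'a \<Rightarrow> nat"
  assumes inj_enc: "inj enc"

lemma enc_eq [simp]: "enc x = enc y \<longleftrightarrow> x = y"
  using inj_enc by (auto dest: injD)

instantiation nat :: enc
begin
definition enc_nat [simp]: "enc (n::nat) = n"
instance by standard (auto intro: injI)
end

instantiation bool :: enc
begin
definition enc_bool: "enc (b::bool) = of_bool b"
instance by standard (auto intro!: injI simp: enc_bool of_bool_def split: if_splits)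
end

lemma enc_bool_simps [simp]: "enc True = 1" "enc False = 0"
  by (auto simp: enc_bool)

instantiation prod :: (enc, enc) enc
begin
definition enc_prod: "enc p = prod_encode (enc (fst p), enc (snd p))"
instance by standard (auto intro!: injI simp: enc_prod prod_eq_iff)
end

lemma enc_pair [simp]: "enc (x, y) = prod_encode (enc x, enc y)"
  by (simp add: enc_prod)

instantiation list :: (enc) enc
begin
definition enc_list: "enc xs = list_encode (map enc xs)"
instance by standard (auto intro!: injI simp: enc_list list_encode_eq inj_map_eq_map[OF inj_enc])
end

instantiation fset :: (enc) enc
begin
definition enc_fset: "enc X = set_encode (enc ` fset X)"
instance by standard
  (auto intro!: injI simp: enc_fset set_encode_eq inj_image_eq_iff[OF inj_enc] fset_inject)
end

text \<open>The function \<open>f\<close> tracks \<open>F\<close> on codes and is free elsewhere, so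
  a type needs neither a decoder nor a decidable set of codes.\<close>

definition cmp :: "('a::enc \<Rightarrow> 'b::enc) \<Rightarrow> bool" where
  "cmp F \<longleftrightarrow> (\<exists>f. computable f \<and> (\<forall>x. f (enc x) = enc (F x)))"

lemma cmpE:
  assumes "cmp F"
  obtains f where "computable f" "\<And>x. f (enc x) = enc (F x)"
  using assms unfolding cmp_def by blast

lemma cmpI: "computable f \<Longrightarrow> (\<And>x. f (enc x) = enc (F x)) \<Longrightarrow> cmp F"
  unfolding cmp_def by blast

lemma cmp_nat_iff: "cmp (f :: nat \<Rightarrow> nat) \<longleftrightarrow> computable f"
  unfolding cmp_def by (auto simp flip: fun_eq_iff)

text \<open>Computability sees nothing but codes, so a function may be exchanged for one of another
  result type with the same codes. Constructors, truth values and decoders are obtained from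
  functions on numbers in this way.\<close>

lemma cmp_code: "cmp G \<Longrightarrow> (\<And>x. enc (F x) = enc (G x)) \<Longrightarrow> cmp F"
  unfolding cmp_def by simp

named_theorems cmp_intros

lemma cmp_id [cmp_intros]: "cmp (\<lambda>x. x)"
  using computable_id by (rule cmpI) simp

lemma cmp_const [cmp_intros]: "cmp (\<lambda>x. c)"
  using computable_const[of "enc c"] by (rule cmpI) simp

lemma cmp_comp: "cmp f \<Longrightarrow> cmp g \<Longrightarrow> cmp (\<lambda>x. f (g x))"
  unfolding cmp_def by (auto dest: computable_comp)

lemma cmp_pair [cmp_intros]: "cmp f \<Longrightarrow> cmp g \<Longrightarrow> cmp (\<lambda>x. (f x, g x))"
  unfolding cmp_def by (auto dest: computable_pair)

lemma cmp_comp2: "cmp (\<lambda>p. f (fst p) (snd p)) \<Longrightarrow> cmp g \<Longrightarrow> cmp h \<Longrightarrow> cmp (\<lambda>x. f (g x) (h x))"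
  using cmp_comp[OF _ cmp_pair, of "\<lambda>p. f (fst p) (snd p)" g h] by simp

lemma cmp_fst [cmp_intros]:
  fixes f :: "'c::enc \<Rightarrow> 'a::enc \<times> 'b::enc"
  shows "cmp f \<Longrightarrow> cmp (\<lambda>x. fst (f x))"
proof -
  have "cmp (fst :: 'a \<times> 'b \<Rightarrow> 'a)" using computable_fst by (rule cmpI) (simp add: enc_prod)
  then show "cmp f \<Longrightarrow> cmp (\<lambda>x. fst (f x))" by (rule cmp_comp)
qed

lemma cmp_snd [cmp_intros]:
  fixes f :: "'c::enc \<Rightarrow> 'a::enc \<times> 'b::enc"
  shows "cmp f \<Longrightarrow> cmp (\<lambda>x. snd (f x))"
proof -
  have "cmp (snd :: 'a \<times> 'b \<Rightarrow> 'b)" using computable_snd by (rule cmpI) (simp add: enc_prod)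
  then show "cmp f \<Longrightarrow> cmp (\<lambda>x. snd (f x))" by (rule cmp_comp)
qed

lemma cmp_case_prod [cmp_intros]:
  assumes "cmp f" "cmp (\<lambda>p. g (fst p) (fst (snd p)) (snd (snd p)))"
  shows "cmp (\<lambda>x. case f x of (a, b) \<Rightarrow> g x a b)"
  using cmp_comp[OF assms(2) cmp_pair[OF cmp_id assms(1)]] by (simp add: case_prod_beta)

lemma cmp_enc [cmp_intros]: "cmp f \<Longrightarrow> cmp (\<lambda>x. enc (f x))"
  by (rule cmp_code) auto

lemma cmp_Suc [cmp_intros]: "cmp f \<Longrightarrow> cmp (\<lambda>x. Suc (f x))"
  by (rule cmp_comp[of Suc]) (auto simp: cmp_nat_iff computable_Suc)

lemma cmp_rec_nat [cmp_intros]: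
  assumes "cmp f" "cmp n" "cmp (\<lambda>p. g (fst p) (fst (snd p)) (snd (snd p)))"
  shows "cmp (\<lambda>x. rec_nat (f x) (g x) (n x))"
proof -
  obtain f' where f': "computable f'" "\<And>x. f' (enc x) = enc (f x)" using assms(1) by (rule cmpE) blast
  obtain n' where n': "computable n'" "\<And>x. n' (enc x) = n x" using assms(2) by (rule cmpE) auto
  obtain g' where g': "computable g'" "\<And>p. g' (enc p) = enc (g (fst p) (fst (snd p)) (snd (snd p)))"
    using assms(3) by (rule cmpE) blast
  have g'': "g' (prod_encode (enc x, prod_encode (k, enc r))) = enc (g x k r)" for x k r
    using g'(2)[of "(x, k, r)"] by simp
  have "rec_nat (f' (enc x)) (\<lambda>k r. g' (prod_encode (enc x, prod_encode (k, r)))) m = enc (rec_nat (f x) (g x) m)" for x m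
    by (induction m) (auto simp: f' g'')
  then show ?thesis by (intro cmpI[OF computable_rec[OF f'(1) g'(1) n'(1)]]) (simp add: n')
qed

text \<open>A recursion of length \<open>enc (b x)\<close>, which is 0 or 1, keeps the start value
  or replaces it once.\<close>

lemma cmp_if [cmp_intros]:
  assumes "cmp b" "cmp f" "cmp g"
  shows "cmp (\<lambda>x. if b x then f x else g x)"
proof -
  have "cmp (\<lambda>x. rec_nat (g x) (\<lambda>_ _. f x) (enc (b x)))" by (intro cmp_intros assms cmp_comp[OF assms(2)])
  moreover have "rec_nat (g x) (\<lambda>_ _. f x) (enc (b x)) = (if b x then f x else g x)" for x
    by (cases "b x") auto
  ultimately show ?thesis by simp
qed

lemma cmp_not [cmp_intros]: "cmp b \<Longrightarrow> cmp (\<lambda>x. \<not> b x)"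
proof -
  assume "cmp b"
  then have "cmp (\<lambda>x. if b x then False else True)" by (intro cmp_intros)
  then show ?thesis by (rule cmp_code) simp
qed

lemma cmp_conj [cmp_intros]: "cmp a \<Longrightarrow> cmp b \<Longrightarrow> cmp (\<lambda>x. a x \<and> b x)"
proof -
  assume "cmp a" "cmp b"
  then have "cmp (\<lambda>x. if a x then b x else False)" by (intro cmp_intros)
  then show ?thesis by (rule cmp_code) auto
qed

lemma cmp_disj [cmp_intros]: "cmp a \<Longrightarrow> cmp b \<Longrightarrow> cmp (\<lambda>x. a x \<or> b x)"
proof -
  assume "cmp a" "cmp b"
  then have "cmp (\<lambda>x. if a x then True else b x)" by (intro cmp_intros)
  then show ?thesis by (rule cmp_code) auto
qed

lemma cmp_imp [cmp_intros]: "cmp a \<Longrightarrow> cmp b \<Longrightarrow> cmp (\<lambda>x. a x \<longrightarrow> b x)"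
  unfolding imp_conv_disj by (intro cmp_intros)

lemma cmp_add [cmp_intros]: "cmp f \<Longrightarrow> cmp g \<Longrightarrow> cmp (\<lambda>x. f x + g x :: nat)"
proof -
  have *: "rec_nat b (\<lambda>k r. Suc r) a = a + b" for a b :: nat by (induction a) auto
  assume "cmp f" "cmp g"
  then have "cmp (\<lambda>x. rec_nat (g x) (\<lambda>k r. Suc r) (f x))" by (intro cmp_intros)
  then show ?thesis by (simp add: *)
qed

lemma cmp_diff [cmp_intros]: "cmp f \<Longrightarrow> cmp g \<Longrightarrow> cmp (\<lambda>x. f x - g x :: nat)"
proof -
  have *: "rec_nat 0 (\<lambda>k r. k) a = a - 1" for a :: nat by (induction a) auto
  have **: "rec_nat b (\<lambda>k r. rec_nat 0 (\<lambda>k r. k) r) a = b - a" for a b :: nat by (induction a) (auto simp: *)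
  assume "cmp f" "cmp g"
  then have "cmp (\<lambda>x. rec_nat (f x) (\<lambda>k r. rec_nat 0 (\<lambda>k r. k) r) (g x))" by (intro cmp_intros)
  then show ?thesis by (simp add: **)
qed

text \<open>Injectivity of \<open>enc\<close> reduces this to numbers, where equality means that
  both truncated differences vanish.\<close>

lemma cmp_eq [cmp_intros]: "cmp f \<Longrightarrow> cmp g \<Longrightarrow> cmp (\<lambda>x. f x = g x)"
proof -
  assume "cmp f" "cmp g"
  then have "cmp (\<lambda>x. 1 - ((enc (f x) - enc (g x)) + (enc (g x) - enc (f x))))" by (intro cmp_intros)
  then show ?thesis
  proof (rule cmp_code)
    fix x
    have "enc (f x) \<noteq> enc (g x)" if "f x \<noteq> g x" using that by simp
    then show "enc (f x = g x) = enc (1 - ((enc (f x) - enc (g x)) + (enc (g x) - enc (f x))))"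
      by (cases "f x = g x") (auto simp del: enc_eq)
  qed
qed

lemma cmp_le [cmp_intros]: "cmp f \<Longrightarrow> cmp g \<Longrightarrow> cmp (\<lambda>x. f x \<le> (g x :: nat))"
proof -
  assume "cmp f" "cmp g"
  then have "cmp (\<lambda>x. f x - g x = 0)" by (intro cmp_intros)
  then show ?thesis by (rule cmp_code) auto
qed

lemma cmp_less [cmp_intros]: "cmp f \<Longrightarrow> cmp g \<Longrightarrow> cmp (\<lambda>x. f x < (g x :: nat))"
  unfolding less_eq_Suc_le by (intro cmp_intros)

lemma cmp_div2: "cmp f \<Longrightarrow> cmp (\<lambda>x. f x div 2 :: nat)"
proof -
  \<comment> \<open>With \<open>r = k div 2\<close>, the quotient grows at \<open>Suc k\<close>
    exactly when \<open>Suc k\<close> equals twice \<open>Suc r\<close>.\<close>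
  have *: "rec_nat 0 (\<lambda>k r. if Suc k = Suc r + Suc r then Suc r else r) a = a div 2" for a :: nat
    by (induction a) (simp_all, presburger)
  assume "cmp f"
  then have "cmp (\<lambda>x. rec_nat 0 (\<lambda>k r. if Suc k = Suc r + Suc r then Suc r else r) (f x))" by (intro cmp_intros)
  then show ?thesis unfolding * .
qed

section \<open>Finite sets\<close>

text \<open>The element \<open>i\<close> contributes \<open>2 ^ i\<close> to the code, and
  \<open>i < 2 ^ i\<close>. Hence the code of a set bounds a loop over its elements and serves as a
  measure for recursion into them.\<close>

lemma set_decode_nat_lt: "i \<in> set_decode s \<Longrightarrow> i < s"
proof -
  assume "i \<in> set_decode s"
  moreover have "set_decode (set_encode {i}) = {i}" by (rule set_encode_inverse) simp
  ultimately have "set_encode {i} \<le> s" by (intro subset_decode_imp_le) auto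
  moreover have "set_encode {i} = 2 ^ i" by (simp add: set_encode_def)
  ultimately show ?thesis using less_exp[of i] by linarith
qed

definition decode_fset :: "nat \<Rightarrow> nat fset" where
  "decode_fset n = Abs_fset (set_decode n)"

lemma fset_decode_fset [simp]: "fset (decode_fset n) = set_decode n"
  unfolding decode_fset_def by (simp add: Abs_fset_inverse)

lemma enc_decode_fset [simp]: "enc (decode_fset n) = n"
  by (simp add: enc_fset)

lemma cmp_decode_fset [cmp_intros]: "cmp f \<Longrightarrow> cmp (\<lambda>x. decode_fset (f x))"
  by (rule cmp_code) auto

lemma set_decode_enc: "set_decode (enc X) = enc ` fset X" for X :: "'a::enc fset"
  by (simp add: enc_fset)

lemma cmp_fmember [cmp_intros]: "cmp f \<Longrightarrow> cmp S \<Longrightarrow> cmp (\<lambda>x. f x |\<in>| S x)"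
proof -
  assume *: "cmp f" "cmp S"
  have d: "rec_nat n (\<lambda>k r. r div 2) i = n div 2 ^ i" for n i :: nat
    by (induction i) (auto simp flip: div_mult2_eq simp: mult.commute)
  \<comment> \<open>Membership is a binary digit of the code of the set: halve
    \<open>enc (f x)\<close> times and test for oddness, expressed as not being twice the own
    half.\<close>
  have "cmp (\<lambda>x. \<not> (let n = rec_nat (enc (S x)) (\<lambda>k r. r div 2) (enc (f x)) in n = n div 2 + n div 2))"
    unfolding Let_def using * by (intro cmp_intros cmp_div2)
  moreover have "f x |\<in>| S x \<longleftrightarrow> odd (enc (S x) div 2 ^ enc (f x))" for x
  proof -
    have "f x |\<in>| S x \<longleftrightarrow> enc (f x) \<in> set_decode (enc (S x))" by (auto simp: set_decode_enc)
    then show ?thesis by (simp add: set_decode_def)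
  qed
  moreover have "odd n \<longleftrightarrow> \<not> n = n div 2 + n div 2" for n :: nat by presburger
  ultimately show ?thesis by (auto simp: d Let_def)
qed

lemma cmp_finsert [cmp_intros]: "cmp f \<Longrightarrow> cmp S \<Longrightarrow> cmp (\<lambda>x. finsert (f x) (S x))"
proof -
  have p: "rec_nat 1 (\<lambda>k r. r + r) i = (2::nat) ^ i" for i :: nat by (induction i) auto
  assume "cmp f" "cmp S"
  \<comment> \<open>A new element sets one binary digit; the test avoids adding the same power of 2
    twice.\<close>
  then have "cmp (\<lambda>x. if f x |\<in>| S x then enc (S x) else rec_nat 1 (\<lambda>k r. r + r) (enc (f x)) + enc (S x))"
    by (intro cmp_intros)
  then show ?thesis
  proof (rule cmp_code)
    fix x
    show "enc (finsert (f x) (S x)) = enc (if f x |\<in>| S x then enc (S x) else rec_nat 1 (\<lambda>k r. r + r) (enc (f x)) + enc (S x))"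
      unfolding p by (cases "f x |\<in>| S x") (simp_all add: enc_fset finsert_absorb image_iff)
  qed
qed

text \<open>Over numbers the loop can insert the candidates \<open>i\<close> themselves. This case
  is what \<open>cmp_fbind\<close> is built on, and the union over other types is recovered from
  there.\<close>

lemma cmp_nunion:
  assumes "cmp f" "cmp g"
  shows "cmp (\<lambda>x. f x |\<union>| g x :: nat fset)"
proof -
  have *: "fset (rec_nat A (\<lambda>i r. if i |\<in>| B then finsert i r else r) n) = fset A \<union> {i \<in> fset B. i < n}" for A B n
    by (induction n) (auto simp: less_Suc_eq)
  have "rec_nat A (\<lambda>i r. if i |\<in>| B then finsert i r else r) (enc B) = A |\<union>| B" for A B :: "nat fset"
    using set_decode_nat_lt[of _ "enc B"] by (intro fset_inject[THEN iffD1]) (auto simp: * set_decode_enc)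
  moreover have "cmp (\<lambda>x. rec_nat (f x) (\<lambda>i r. if i |\<in>| g x then finsert i r else r) (enc (g x)))"
    by (intro cmp_intros assms cmp_comp[OF assms(2)])
  ultimately show ?thesis by simp
qed

lemma fmember_fbind [simp]: "x |\<in>| fbind S f \<longleftrightarrow> (\<exists>y. y |\<in>| S \<and> x |\<in>| f y)"
  by (auto simp: fbind.rep_eq Set.bind_def)

lemma fmember_ffUnion [simp]: "x |\<in>| ffUnion X \<longleftrightarrow> (\<exists>Y. Y |\<in>| X \<and> x |\<in>| Y)"
  by (auto simp: ffUnion.rep_eq)

lemma enc_fset_eqI: "fset Y = enc ` fset X \<Longrightarrow> enc X = enc (Y :: nat fset)"
  by (simp add: enc_fset)

text \<open>The source of image, filter, union and bounded quantification. The loop \<open>R\<close>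
  collects codes only: an element of an arbitrary encodable type cannot be recovered from its code,
  but the codes of the elements of \<open>f x y\<close> are the binary digits of its own
  code.\<close>

lemma cmp_fbind [cmp_intros]:
  assumes "cmp S" "cmp (\<lambda>p. f (fst p) (snd p))"
  shows "cmp (\<lambda>x. fbind (S x) (f x))"
proof -
  obtain f' where f': "computable f'" "\<And>p. f' (enc p) = enc (f (fst p) (snd p))"
    using assms(2) by (rule cmpE) blast
  have f'': "f' (prod_encode (enc x, enc y)) = enc (f x y)" for x y
    using f'(2)[of "(x, y)"] by simp
  have c: "cmp f'" using f'(1) by (simp add: cmp_nat_iff)
  define R where "R x B n = rec_nat {||} (\<lambda>i r. if i |\<in>| B then r |\<union>| decode_fset (f' (prod_encode (x, i))) else r) n" for x B n
  have R: "fset (R x B n) = (\<Union>i\<in>{i. i |\<in>| B \<and> i < n}. set_decode (f' (prod_encode (x, i))))" for x B n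
    by (induction n) (auto simp: R_def less_Suc_eq)
  have pe: "cmp (\<lambda>p. prod_encode (g p, h p))" if "cmp g" "cmp h" for g h :: "'x::enc \<Rightarrow> nat"
    using cmp_enc[OF cmp_pair[OF that]] by simp
  have "cmp (\<lambda>x. R (enc x) (decode_fset (enc (S x))) (enc (S x)))"
    unfolding R_def by (intro cmp_intros cmp_nunion cmp_comp[OF c] pe assms(1) cmp_comp[OF assms(1)])
  then show ?thesis
  proof (rule cmp_code)
    fix x
    show "enc (fbind (S x) (f x)) = enc (R (enc x) (decode_fset (enc (S x))) (enc (S x)))"
    proof (rule enc_fset_eqI)
      have *: "{i. i |\<in>| decode_fset (enc (S x)) \<and> i < enc (S x)} = enc ` fset (S x)"
        using set_decode_nat_lt[of _ "enc (S x)"] by (auto simp: set_decode_enc)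
      show "fset (R (enc x) (decode_fset (enc (S x))) (enc (S x))) = enc ` fset (fbind (S x) (f x))"
        unfolding R * by (fastforce simp: f'' set_decode_enc)
    qed
  qed
qed

lemma cmp_fimage [cmp_intros]:
  assumes "cmp S" "cmp (\<lambda>p. f (fst p) (snd p))"
  shows "cmp (\<lambda>x. f x |`| S x)"
proof -
  have "f x |`| S x = fbind (S x) (\<lambda>y. {|f x y|})" for x by auto
  then show ?thesis using assms by (auto intro!: cmp_intros)
qed

lemma cmp_ffilter [cmp_intros]:
  assumes "cmp S" "cmp (\<lambda>p. P (fst p) (snd p))"
  shows "cmp (\<lambda>x. ffilter (P x) (S x))"
proof -
  have "ffilter (P x) (S x) = fbind (S x) (\<lambda>y. if P x y then {|y|} else {||})" for x by (auto split: if_splits)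
  then show ?thesis using assms by (auto intro!: cmp_intros)
qed

lemma cmp_ffUnion [cmp_intros]: "cmp S \<Longrightarrow> cmp (\<lambda>x. ffUnion (S x))"
proof -
  assume "cmp S"
  then have "cmp (\<lambda>x. fbind (S x) (\<lambda>y. y))" by (intro cmp_intros)
  moreover have "fbind (S x) (\<lambda>y. y) = ffUnion (S x)" for x by auto
  ultimately show ?thesis by simp
qed

lemma cmp_funion [cmp_intros]: "cmp f \<Longrightarrow> cmp g \<Longrightarrow> cmp (\<lambda>x. f x |\<union>| g x)"
proof -
  assume "cmp f" "cmp g"
  then have "cmp (\<lambda>x. ffUnion {|f x, g x|})" by (intro cmp_intros)
  then show ?thesis by simp
qed

lemma cmp_fminus [cmp_intros]: "cmp f \<Longrightarrow> cmp g \<Longrightarrow> cmp (\<lambda>x. f x |-| g x)"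
proof -
  assume "cmp f" "cmp g"
  then have "cmp (\<lambda>x. ffilter (\<lambda>y. \<not> y |\<in>| g x) (f x))" by (intro cmp_intros cmp_comp[OF \<open>cmp g\<close>])
  moreover have "ffilter (\<lambda>y. \<not> y |\<in>| g x) (f x) = f x |-| g x" for x by auto
  ultimately show ?thesis by simp
qed

lemma cmp_fBall [cmp_intros]:
  assumes "cmp S" "cmp (\<lambda>p. P (fst p) (snd p))"
  shows "cmp (\<lambda>x. fBall (S x) (P x))"
proof -
  have "fBall (S x) (P x) \<longleftrightarrow> ffilter (\<lambda>y. \<not> P x y) (S x) = {||}" for x by auto
  then show ?thesis using assms by (auto intro!: cmp_intros)
qed

lemma cmp_fBex [cmp_intros]:
  assumes "cmp S" "cmp (\<lambda>p. P (fst p) (snd p))"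
  shows "cmp (\<lambda>x. fBex (S x) (P x))"
proof -
  have *: "fBex (S x) (P x) \<longleftrightarrow> \<not> (fBall (S x) (\<lambda>y. \<not> P x y))" for x by auto
  show ?thesis unfolding * by (intro cmp_intros assms)
qed

lemma cmp_fsubset [cmp_intros]: "cmp f \<Longrightarrow> cmp g \<Longrightarrow> cmp (\<lambda>x. f x |\<subseteq>| g x)"
proof -
  assume "cmp f" "cmp g"
  then have "cmp (\<lambda>x. fBall (f x) (\<lambda>y. y |\<in>| g x))" by (intro cmp_intros cmp_comp[OF \<open>cmp g\<close>])
  moreover have "fBall (f x) (\<lambda>y. y |\<in>| g x) \<longleftrightarrow> f x |\<subseteq>| g x" for x by auto
  ultimately show ?thesis by simp
qed

text \<open>A subset has a code at most that of the whole set, so the power set is found by testing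
  all numbers up to that code; the bound is \<open>Suc\<close> of it to include the set
  itself.\<close>

lemma cmp_fPow [cmp_intros]:
  assumes "cmp S"
  shows "cmp (\<lambda>x. fPow (S x))"
proof -
  define R where "R B n = rec_nat {||} (\<lambda>i r. if decode_fset i |\<subseteq>| B then finsert i r else r) n" for B n
  have R: "fset (R B n) = {i. i < n \<and> decode_fset i |\<subseteq>| B}" for B n
    by (induction n) (auto simp: R_def less_Suc_eq)
  have "cmp (\<lambda>x. R (decode_fset (enc (S x))) (Suc (enc (S x))))"
    unfolding R_def by (intro cmp_intros assms cmp_comp[OF assms])
  then show ?thesis
  proof (rule cmp_code)
    fix x
    show "enc (fPow (S x)) = enc (R (decode_fset (enc (S x))) (Suc (enc (S x))))"
    proof (rule enc_fset_eqI, unfold R, intro set_eqI iffI)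
      fix i assume "i \<in> {i. i < Suc (enc (S x)) \<and> decode_fset i |\<subseteq>| decode_fset (enc (S x))}"
      then have i: "set_decode i \<subseteq> enc ` fset (S x)" by (auto simp: less_eq_fset.rep_eq set_decode_enc)
      define Y where "Y = ffilter (\<lambda>y. enc y \<in> set_decode i) (S x)"
      have "enc ` fset Y = set_decode i" using i by (auto simp: Y_def)
      then have "enc Y = i" by (simp add: enc_fset)
      moreover have "Y |\<subseteq>| S x" by (auto simp: Y_def)
      ultimately show "i \<in> enc ` fset (fPow (S x))" by auto
    next
      fix i assume "i \<in> enc ` fset (fPow (S x))"
      then obtain Y where Y: "i = enc Y" "Y |\<subseteq>| S x" by auto
      then have *: "set_decode i \<subseteq> set_decode (enc (S x))" by (auto simp: set_decode_enc)
      then have "i \<le> enc (S x)" by (rule subset_decode_imp_le)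
      then show "i \<in> {i. i < Suc (enc (S x)) \<and> decode_fset i |\<subseteq>| decode_fset (enc (S x))}"
        using * by (simp add: less_eq_fset.rep_eq)
    qed
  qed
qed


section \<open>Well-founded recursion\<close>

lemma cmp_dom:
  fixes F :: "'a::enc \<Rightarrow> 'b::enc" and G :: "nat \<Rightarrow> 'c::enc"
  shows "cmp G \<Longrightarrow> (\<And>x. enc (F x) = enc (G (enc x))) \<Longrightarrow> cmp F"
  by (rule cmp_code[OF cmp_comp[OF _ cmp_enc[OF cmp_id]]])

lemma cmp_prod_encode [cmp_intros]: "cmp f \<Longrightarrow> cmp (\<lambda>x. prod_encode (f x))"
  by (rule cmp_code) (auto simp: enc_prod)

lemma cmp_prod_decode [cmp_intros]: "cmp f \<Longrightarrow> cmp (\<lambda>x. prod_decode (f x))"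
  by (rule cmp_code[of f]) (auto simp: enc_prod)

lemma cmp_Least:
  fixes P :: "nat \<Rightarrow> nat \<Rightarrow> bool"
  assumes "cmp (\<lambda>p. P (fst p) (snd p))" "\<And>x. \<exists>k. P x k"
  shows "cmp (\<lambda>x. LEAST k. P x k)"
proof -
  have "cmp (\<lambda>p. \<not> P (fst p) (snd p))" by (intro cmp_intros assms)
  then obtain f where f: "computable f" "\<And>p. f (enc p) = enc (\<not> P (fst p) (snd p))" by (rule cmpE) blast
  have f': "f (prod_encode (x, k)) = 0 \<longleftrightarrow> P x k" for x k using f(2)[of "(x, k)"] by (simp add: enc_bool)
  show ?thesis using computable_mu[OF f(1)] assms(2) unfolding f' cmp_nat_iff .
qed

text \<open>As a congruence rule it tells the termination proofs that recursive calls under an image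
  are made on elements of the set.\<close>

lemma fimage_cong_fundef [fundef_cong]:
  "A = B \<Longrightarrow> (\<And>x. x |\<in>| B \<Longrightarrow> f x = g x) \<Longrightarrow> f |`| A = g |`| B"
  by auto

text \<open>\<open>H\<close> receives the argument together with the graph of the recursive calls.
  The filter by \<open>M\<close> makes the recursion well-founded for arbitrary \<open>D\<close> and
  \<open>M\<close>, so also on numbers that are not codes.\<close>

function nrec :: "(nat \<times> (nat \<times> nat) fset \<Rightarrow> nat) \<Rightarrow> (nat \<Rightarrow> nat fset) \<Rightarrow> (nat \<Rightarrow> nat) \<Rightarrow> nat \<Rightarrow> nat" where
  "nrec H D M a = H (a, (\<lambda>b. (b, nrec H D M b)) |`| ffilter (\<lambda>b. M b < M a) (D a))"
  by pat_completeness auto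
termination by (relation "measure (\<lambda>(H, D, M, a). M a)") auto

declare nrec.simps [simp del]

text \<open>The value is read off a finite table that is closed under the recursion; such a table is found
  by unbounded search.\<close>

lemma cmp_nrec:
  assumes H: "cmp H" and D: "cmp D" and M: "cmp M"
  shows "cmp (nrec H D M)"
proof -
  define E where "E a = ffilter (\<lambda>b. M b < M a) (D a)" for a
  define N where "N = nrec H D M"
  have N: "N a = H (a, (\<lambda>b. (b, N b)) |`| E a)" for a
    unfolding N_def E_def by (rule nrec.simps)
  \<comment> \<open>Checkable without knowing \<open>N\<close>: every entry finds all arguments that
    it depends on in the table and agrees with \<open>H\<close> on the entries found. Several values
    for one argument are not excluded here; the induction on \<open>M\<close> for
    \<open>correct\<close> does that.\<close>
  define ok where "ok T \<longleftrightarrow> fBall T (\<lambda>e. fst |`| ffilter (\<lambda>e'. fst e' |\<in>| E (fst e)) T = E (fst e) \<and>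
    snd e = H (fst e, ffilter (\<lambda>e'. fst e' |\<in>| E (fst e)) T))" for T
  have correct: "v = N a" if "ok T" "(a, v) |\<in>| T" for T a v
    using that(2)
  proof (induction "M a" arbitrary: a v rule: less_induct)
    case less
    let ?g = "ffilter (\<lambda>e'. fst e' |\<in>| E a) T"
    have g: "fst |`| ?g = E a" "v = H (a, ?g)" using less.prems that(1) by (auto simp: ok_def)
    have *: "e = (fst e, N (fst e))" if "e |\<in>| ?g" for e
      using less.hyps[of "fst e" "snd e"] that by (auto simp: E_def prod_eq_iff)
    have "?g = (\<lambda>e. (fst e, N (fst e))) |`| ?g" using * by (intro fset_eqI) (force simp: image_iff)
    also have "\<dots> = (\<lambda>b. (b, N b)) |`| fst |`| ?g" by (simp add: fset.map_comp comp_def)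
    finally show ?case using g N[of a] by simp
  qed
  have ex: "\<exists>T. ok T \<and> (a, N a) |\<in>| T" for a
  proof -
    \<comment> \<open>Unlike \<open>ok\<close>, this property mentions \<open>N\<close> and is
      preserved by unions, so tables for the recursive calls can be merged.\<close>
    define cl where "cl T \<longleftrightarrow> (\<forall>b v. (b, v) |\<in>| T \<longrightarrow> v = N b \<and> (\<forall>c. c |\<in>| E b \<longrightarrow> (c, N c) |\<in>| T))" for T
    have "\<exists>T. cl T \<and> (a, N a) |\<in>| T"
    proof (induction "M a" arbitrary: a rule: less_induct)
      case less
      have "\<forall>b. \<exists>T. b |\<in>| E a \<longrightarrow> cl T \<and> (b, N b) |\<in>| T" using less by (auto simp: E_def)
      then obtain T where T: "\<And>b. b |\<in>| E a \<Longrightarrow> cl (T b) \<and> (b, N b) |\<in>| T b" by metis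
      let ?T = "finsert (a, N a) (fbind (E a) T)"
      have "cl ?T" using T unfolding cl_def by (simp, blast)
      then show ?case by (intro exI[of _ ?T]) auto
    qed
    then obtain T where T: "cl T" "(a, N a) |\<in>| T" by blast
    have "ok T" unfolding ok_def
    proof (intro fBallI)
      fix e assume e: "e |\<in>| T"
      obtain b v where bv: "e = (b, v)" by fastforce
      have v: "v = N b" and c: "\<And>c. c |\<in>| E b \<Longrightarrow> (c, N c) |\<in>| T" using T(1) e bv by (auto simp: cl_def)
      have g: "ffilter (\<lambda>e'. fst e' |\<in>| E b) T = (\<lambda>b. (b, N b)) |`| E b"
        using c T(1) by (auto simp: cl_def)
      show "fst |`| ffilter (\<lambda>e'. fst e' |\<in>| E (fst e)) T = E (fst e) \<and>
        snd e = H (fst e, ffilter (\<lambda>e'. fst e' |\<in>| E (fst e)) T)"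
        unfolding bv fst_conv snd_conv g v by (auto simp: fset.map_comp comp_def N[of b])
    qed
    then show ?thesis using T(2) by blast
  qed
  have E: "cmp (\<lambda>x. E (f x))" if "cmp f" for f :: "'x::enc \<Rightarrow> nat"
    unfolding E_def by (intro cmp_intros cmp_comp[OF D] cmp_comp[OF M] that cmp_comp[OF that])
  have "cmp ok"
    unfolding ok_def by (intro cmp_intros cmp_comp[OF H] E)
  note ok = cmp_comp[OF this]
  \<comment> \<open>The search runs over codes of pairs of a table and a value, so that the result
    is a projection of the number found.\<close>
  define P where "P x k \<longleftrightarrow> ok (prod_decode |`| decode_fset (fst (prod_decode k))) \<and>
    (x, snd (prod_decode k)) |\<in>| prod_decode |`| decode_fset (fst (prod_decode k))" for x k
  have P: "snd (prod_decode k) = N x" if "P x k" for x k using that correct unfolding P_def by blast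
  have exP: "\<exists>k. P x k" for x
  proof -
    obtain T where T: "ok T" "(x, N x) |\<in>| T" using ex by blast
    have *: "fset (prod_decode |`| decode_fset (enc T)) = fset T"
      by (auto simp: set_decode_enc enc_prod image_image image_iff)
    then have "prod_decode |`| decode_fset (enc T) = T" by (simp only: fset_inject)
    then have "P x (prod_encode (enc T, N x))" using T unfolding P_def by simp
    then show ?thesis by blast
  qed
  have "cmp (\<lambda>p. P (fst p) (snd p))"
    unfolding P_def by (intro cmp_intros ok)
  then have "cmp (\<lambda>x. LEAST k. P x k)" using exP by (rule cmp_Least)
  then have "cmp (\<lambda>x. snd (prod_decode (LEAST k. P x k)))" by (intro cmp_intros)
  moreover have "snd (prod_decode (LEAST k. P x k)) = N x" for x using exP[of x] by (rule P[OF LeastI_ex])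
  ultimately show ?thesis by (simp add: N_def)
qed

text \<open>On codes the filter of \<open>nrec\<close> removes nothing, because \<open>M\<close>
  decreases along \<open>D\<close>. Thus the graph handed to the tracking function is the code of
  the graph of \<open>F\<close> on \<open>D x\<close>.\<close>

lemma cmp_rec:
  fixes F :: "'a::enc \<Rightarrow> 'b::enc"
  assumes "cmp h" "cmp D" "cmp M"
    and less: "\<And>x y. y |\<in>| D x \<Longrightarrow> M y < (M x :: nat)"
    and F: "\<And>x. F x = h (x, (\<lambda>y. (y, F y)) |`| D x)"
  shows "cmp F"
proof -
  obtain h' where h': "computable h'" "\<And>x. h' (enc x) = enc (h x)" using assms(1) by (rule cmpE) blast
  obtain D' where D': "computable D'" "\<And>x. D' (enc x) = enc (D x)" using assms(2) by (rule cmpE) blast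
  obtain M' where M': "computable M'" "\<And>x. M' (enc x) = M x" using assms(3) by (rule cmpE) auto
  let ?H = "\<lambda>p :: nat \<times> (nat \<times> nat) fset. h' (enc p)" and ?D = "\<lambda>n. decode_fset (D' n)"
  have "cmp (nrec ?H ?D M')"
  proof (rule cmp_nrec)
    have "cmp h'" "cmp D'" using h'(1) D'(1) by (auto simp: cmp_nat_iff)
    then show "cmp ?H" "cmp ?D" using cmp_comp[OF _ cmp_enc[OF cmp_id]] cmp_decode_fset by blast+
    show "cmp M'" using M'(1) by (simp add: cmp_nat_iff)
  qed
  moreover have "nrec ?H ?D M' (enc x) = enc (F x)" for x
  proof (induction "M x" arbitrary: x rule: less_induct)
    case less
    have IH: "nrec ?H ?D M' (enc y) = enc (F y)" if "y |\<in>| D x" for y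
      using less.hyps assms(4)[OF that] by blast
    have "ffilter (\<lambda>b. M' b < M' (enc x)) (?D (enc x)) = enc |`| D x"
      using assms(4) by (auto simp: D' M' set_decode_enc)
    then have "nrec ?H ?D M' (enc x) = h' (prod_encode (enc x, enc ((\<lambda>b. (b, nrec ?H ?D M' b)) |`| enc |`| D x)))"
      by (subst nrec.simps) simp
    also have "enc ((\<lambda>b. (b, nrec ?H ?D M' b)) |`| enc |`| D x) = enc ((\<lambda>y. (y, F y)) |`| D x)"
      using IH by (auto simp: enc_fset image_image intro!: arg_cong[of _ _ set_encode] image_cong)
    also have "h' (prod_encode (enc x, \<dots>)) = enc (F x)"
      unfolding F[of x] h'(2)[symmetric] enc_pair ..
    finally show ?case .
  qed
  ultimately show ?thesis using cmp_dom[of "nrec ?H ?D M'" F] by (simp only: enc_nat)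
qed

text \<open>Recursive results arrive as a finite graph, and a single value has to be extracted from
  a singleton; the test in front gives a fixed value on all other sets.\<close>

definition pick :: "'a fset \<Rightarrow> 'a" where
  "pick X = (if fBex X (\<lambda>x. X = {|x|}) then fthe_elem X else undefined)"

lemma pick_singleton [simp]: "pick {|x|} = x"
  by (auto simp: pick_def fthe_elem.rep_eq)

lemma cmp_pick [cmp_intros]: 
  assumes "cmp S"
  shows "cmp (\<lambda>x. pick (S x))"
proof -
  have r: "rec_nat 0 (\<lambda>i r. if i |\<in>| {|j|} then i else r) n = (if j < n then j else 0)" for j n :: nat
    by (induction n) auto
  have "cmp (\<lambda>x. if fBex (S x) (\<lambda>y. S x = {|y|}) then rec_nat 0 (\<lambda>i r. if i |\<in>| decode_fset (enc (S x)) then i else r) (enc (S x)) else enc (undefined :: 'b))"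
    by (intro cmp_intros assms cmp_comp[OF assms])
  then show ?thesis
  proof (rule cmp_code)
    fix x
    show "enc (pick (S x)) = enc (if fBex (S x) (\<lambda>y. S x = {|y|}) then rec_nat 0 (\<lambda>i r. if i |\<in>| decode_fset (enc (S x)) then i else r) (enc (S x)) else enc (undefined :: 'b))"
    proof (cases "fBex (S x) (\<lambda>y. S x = {|y|})")
      case True
      then obtain y where y: "S x = {|y|}" by blast
      have "enc y < enc (S x)" by (intro set_decode_nat_lt) (simp add: set_decode_enc y)
      moreover have d: "decode_fset (enc (S x)) = {|enc y|}"
        by (rule fset_inject[THEN iffD1]) (simp add: set_decode_enc y)
      ultimately have "rec_nat 0 (\<lambda>i r. if i |\<in>| decode_fset (enc (S x)) then i else r) (enc (S x)) = enc y"
        unfolding d r by simp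
      then show ?thesis using True y by simp
    qed (simp add: pick_def)
  qed
qed

section \<open>Lists\<close>

lemma enc_Nil [simp]: "enc [] = 0"
  by (simp add: enc_list)

lemma enc_Cons [simp]: "enc (x # xs) = Suc (prod_encode (enc x, enc xs))"
  by (simp add: enc_list)

lemma cmp_Cons [cmp_intros]: "cmp f \<Longrightarrow> cmp g \<Longrightarrow> cmp (\<lambda>x. f x # g x)"
proof -
  assume "cmp f" "cmp g"
  then have "cmp (\<lambda>x. Suc (prod_encode (enc (f x), enc (g x))))" by (intro cmp_intros)
  then show ?thesis by (rule cmp_code) simp
qed

definition hd_default :: "'a list \<Rightarrow> 'a" where "hd_default xs = (case xs of [] \<Rightarrow> undefined | x # _ \<Rightarrow> x)"

lemma hd_default_Cons [simp]: "hd_default (x # xs) = x" by (simp add: hd_default_def)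

lemma cmp_hd_default: "cmp f \<Longrightarrow> cmp (\<lambda>x. hd_default (f x))"
proof -
  have "cmp (\<lambda>n. if n = 0 then enc (undefined :: 'b) else fst (prod_decode (n - 1)))" by (intro cmp_intros)
  then have "cmp (hd_default :: 'b list \<Rightarrow> 'b)" by (rule cmp_dom) (auto simp: hd_default_def split: list.split)
  then show "cmp f \<Longrightarrow> cmp (\<lambda>x. hd_default (f x) :: 'b)" for f :: "'a \<Rightarrow> 'b list" by (rule cmp_comp)
qed

lemma cmp_tl: "cmp f \<Longrightarrow> cmp (\<lambda>x. tl (f x))"
proof -
  have "cmp (\<lambda>n. if n = 0 then 0 else snd (prod_decode (n - 1)))" by (intro cmp_intros)
  then have "cmp (tl :: 'b list \<Rightarrow> 'b list)"
  proof (rule cmp_dom)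
    show "enc (tl xs) = enc (if enc xs = 0 then 0 else snd (prod_decode (enc xs - 1)))" for xs :: "'b list"
      by (cases xs) auto
  qed
  then show "cmp f \<Longrightarrow> cmp (\<lambda>x. tl (f x) :: 'b list)" for f :: "'a \<Rightarrow> 'b list" by (rule cmp_comp)
qed

lemma cmp_case_list [cmp_intros]:
  assumes "cmp f" "cmp a" "cmp (\<lambda>p. b (fst p) (fst (snd p)) (snd (snd p)))"
  shows "cmp (\<lambda>x. case f x of [] \<Rightarrow> a x | y # ys \<Rightarrow> b x y ys)"
proof -
  have "cmp (\<lambda>x. if f x = [] then a x else b x (hd_default (f x)) (tl (f x)))"
    using cmp_comp[OF assms(3), of "\<lambda>x. (x, hd_default (f x), tl (f x))"]
    by (intro cmp_intros assms) (simp add: cmp_intros cmp_hd_default cmp_tl assms)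
  moreover have "(if f x = [] then a x else b x (hd_default (f x)) (tl (f x))) = (case f x of [] \<Rightarrow> a x | y # ys \<Rightarrow> b x y ys)" for x
    by (cases "f x") auto
  ultimately show ?thesis by simp
qed

text \<open>The parameter may change at each recursive call, through \<open>q\<close>; this admits
  accumulators such as the head in \<open>apps\<close> and the index in
  \<open>nth_default\<close>.\<close>

lemma cmp_list_rec:
  fixes F :: "'p::enc \<Rightarrow> 'a::enc list \<Rightarrow> 'b::enc"
  assumes "\<And>p. F p [] = a p" "\<And>p x xs. F p (x # xs) = c p x xs (F (q p x xs) xs)"
    and "cmp a" "cmp (\<lambda>(p, x, xs). q p x xs)" "cmp (\<lambda>(p, x, xs, r). c p x xs r)"
    and "cmp f" "cmp l"
  shows "cmp (\<lambda>x. F (f x) (l x))"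
proof -
  have q: "cmp (\<lambda>x. q (f x) (g x) (h x))" if "cmp f" "cmp g" "cmp h" for f g h
    using cmp_comp[OF assms(4) cmp_pair[OF that(1) cmp_pair[OF that(2,3)]]] by simp
  have c: "cmp (\<lambda>x. c (f x) (g x) (h x) (r x))" if "cmp f" "cmp g" "cmp h" "cmp r" for f g h r
    using cmp_comp[OF assms(5) cmp_pair[OF that(1) cmp_pair[OF that(2) cmp_pair[OF that(3,4)]]]] by simp
  have "cmp (\<lambda>p. F (fst p) (snd p))"
  proof (rule cmp_rec)
    show "cmp (\<lambda>(y, g). case snd y of [] \<Rightarrow> a (fst y) | x # xs \<Rightarrow> c (fst y) x xs (pick (snd |`| g)))"
      by (intro cmp_intros c cmp_comp[OF assms(3)])
    show "cmp (\<lambda>y. case snd y of [] \<Rightarrow> {||} | x # xs \<Rightarrow> {|(q (fst y) x xs, xs)|})"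
      by (intro cmp_intros q)
    show "cmp (\<lambda>y. enc (snd y))" by (intro cmp_intros)
    show "enc (snd z) < enc (snd y)" if "z |\<in>| (case snd y of [] \<Rightarrow> {||} | x # xs \<Rightarrow> {|(q (fst y) x xs, xs)|})" for y z
      using that by (auto split: list.splits simp: le_prod_encode_2 less_Suc_eq_le)
    show "F (fst y) (snd y) = (case (y, (\<lambda>y. (y, F (fst y) (snd y))) |`| (case snd y of [] \<Rightarrow> {||} | x # xs \<Rightarrow> {|(q (fst y) x xs, xs)|})) of
      (y, g) \<Rightarrow> case snd y of [] \<Rightarrow> a (fst y) | x # xs \<Rightarrow> c (fst y) x xs (pick (snd |`| g)))" for y
      by (auto split: list.split simp: assms(1,2))
  qed
  from cmp_comp2[OF this assms(6,7)] show ?thesis .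
qed

lemma cmp_append [cmp_intros]: 
  assumes "cmp f" "cmp g"
  shows "cmp (\<lambda>x. f x @ g x)"
  by (rule cmp_list_rec[of "\<lambda>p l. l @ p" "\<lambda>p. p" "\<lambda>p x xs r. x # r" "\<lambda>p x xs. p" g f])
    (auto intro!: cmp_intros assms)

lemma cmp_length [cmp_intros]: 
  assumes "cmp f"
  shows "cmp (\<lambda>x. length (f x))"
  by (rule cmp_list_rec[of "\<lambda>p l. length l" "\<lambda>p. 0" "\<lambda>p x xs r. Suc r" "\<lambda>p x xs. p" "\<lambda>x. 0::nat" f])
    (auto intro!: cmp_intros assms)

lemma cmp_map [cmp_intros]: 
  assumes "cmp l" "cmp (\<lambda>p. f (fst p) (snd p))"
  shows "cmp (\<lambda>x. map (f x) (l x))"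
  by (rule cmp_list_rec[of "\<lambda>p l. map (f p) l" "\<lambda>p. []" "\<lambda>p x xs r. f p x # r" "\<lambda>p x xs. p" "\<lambda>x. x" l])
    (auto intro!: cmp_intros assms cmp_comp2[OF assms(2)])

lemma cmp_fset_of_list [cmp_intros]: 
  assumes "cmp f"
  shows "cmp (\<lambda>x. fset_of_list (f x))"
  by (rule cmp_list_rec[of "\<lambda>p l. fset_of_list l" "\<lambda>p. {||}" "\<lambda>p x xs r. finsert x r" "\<lambda>p x xs. p" "\<lambda>x. 0::nat" f])
    (auto intro!: cmp_intros assms)

lemma cmp_upt [cmp_intros]: 
  assumes "cmp f"
  shows "cmp (\<lambda>x. [0..<f x])"
proof -
  have "rec_nat [] (\<lambda>k r. r @ [k]) n = [0..<n]" for n by (induction n) auto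
  moreover have "cmp (\<lambda>x. rec_nat [] (\<lambda>k r. r @ [k]) (f x))" by (intro cmp_intros assms)
  ultimately show ?thesis by simp
qed


section \<open>Recursion on types, terms and formulas\<close>

lemma inj_code_ty: "code_ty s = code_ty t \<Longrightarrow> s = t"
proof (induction s arbitrary: t)
  case Iota
  then show ?case by (cases t) auto
next
  case (Fun a b)
  then show ?case by (cases t) auto
qed

lemma inj_code_tm: "code_tm s = code_tm t \<Longrightarrow> s = t"
proof (induction s arbitrary: t)
  case (Var i)
  then show ?case by (cases t) auto
next
  case (Sym c)
  then show ?case by (cases t) auto
next
  case (App u v)
  then show ?case by (cases t) auto
qed

instantiation ty :: enc
begin
definition enc_ty: "enc (t::ty) = code_ty t"
instance by standard (rule injI, simp add: enc_ty inj_code_ty)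
end

instantiation tm :: enc
begin
definition enc_tm: "enc (t::tm) = code_tm t"
instance by standard (rule injI, simp add: enc_tm inj_code_tm)
end

lemma code_ctxt_eq [simp]: "code_ctxt \<Gamma> = enc \<Gamma>"
  by (simp add: code_ctxt_def enc_list enc_ty[abs_def])

lemma inj_code_fm: "code_fm C = code_fm C' \<Longrightarrow> C = C'"
proof (induction C arbitrary: C')
  case (Atom P t)
  then show ?case by (cases C') (auto dest: inj_code_tm)
next
  case (Imp zs U G)
  then obtain zs' U' G' where C': "C' = Imp zs' U' G'" by (cases C') auto
  have *: "X = Y" if 1: "\<And>x y. x |\<in>| X \<Longrightarrow> code_fm x = code_fm y \<Longrightarrow> x = y"
    and 2: "code_fm ` fset X = code_fm ` fset Y" for X Y
  proof (intro fset_eqI iffI)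
    fix x assume "x |\<in>| X"
    then obtain y where "y |\<in>| Y" "code_fm x = code_fm y" using 2 by (metis image_iff)
    then show "x |\<in>| Y" using 1[OF \<open>x |\<in>| X\<close>] by blast
  next
    fix y assume "y |\<in>| Y"
    then obtain x where "x |\<in>| X" "code_fm x = code_fm y" using 2 by (metis image_iff)
    then show "y |\<in>| X" using 1 by blast
  qed
  have "zs = zs'" "code_fm ` fset U = code_fm ` fset U'" "code_fm ` fset G = code_fm ` fset G'"
    using Imp.prems by (auto simp: C' set_encode_eq)
  then show ?case using *[of U U'] *[of G G'] Imp.IH C' by simp
qed

instantiation fm :: enc
begin
definition enc_fm: "enc (C::fm) = code_fm C"
instance by standard (rule injI, simp add: enc_fm inj_code_fm)
end

lemma code_clauses_eq: "code_clauses (fset G) = enc G"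
  by (simp add: code_clauses_def enc_fset enc_fm[abs_def])

lemma code_formula_eq [simp]: "code_formula G = enc G"
  by (simp add: code_formula_def code_clauses_eq)

lemma enc_ty_simps [simp]: "enc Iota = 0" "enc (Fun a b) = Suc (prod_encode (enc a, enc b))"
  by (auto simp: enc_ty)

lemma enc_tm_simps [simp]: "enc (Var i) = prod_encode (0, i)" "enc (Sym c) = prod_encode (1, c)"
  "enc (App u v) = prod_encode (2, prod_encode (enc u, enc v))"
  by (auto simp: enc_tm)

lemma enc_fm_simps [simp]: "enc (Atom P t) = prod_encode (0, prod_encode (P, enc t))"
  "enc (Imp zs U G) = prod_encode (1, prod_encode (enc zs, prod_encode (enc U, enc G)))"
  by (auto simp: enc_fm enc_tm enc_fset enc_fm[abs_def])

lemma cmp_Fun [cmp_intros]: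
  assumes "cmp f" "cmp g" shows "cmp (\<lambda>x. Fun (f x) (g x))"
proof -
  have "cmp (\<lambda>x. Suc (prod_encode (enc (f x), enc (g x))))" by (intro cmp_intros assms)
  then show ?thesis by (rule cmp_code) simp
qed

lemma cmp_Var [cmp_intros]:
  assumes "cmp f" shows "cmp (\<lambda>x. Var (f x))"
proof -
  have "cmp (\<lambda>x. prod_encode (0, f x))" by (intro cmp_intros assms)
  then show ?thesis by (rule cmp_code) simp
qed

lemma cmp_Sym [cmp_intros]:
  assumes "cmp f" shows "cmp (\<lambda>x. Sym (f x))"
proof -
  have "cmp (\<lambda>x. prod_encode (1, f x))" by (intro cmp_intros assms)
  then show ?thesis by (rule cmp_code) simp
qed

lemma cmp_App [cmp_intros]:
  assumes "cmp f" "cmp g" shows "cmp (\<lambda>x. App (f x) (g x))"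
proof -
  have "cmp (\<lambda>x. prod_encode (2, prod_encode (enc (f x), enc (g x))))" by (intro cmp_intros assms)
  then show ?thesis by (rule cmp_code) simp
qed

lemma cmp_Atom [cmp_intros]:
  assumes "cmp f" "cmp g" shows "cmp (\<lambda>x. Atom (f x) (g x))"
proof -
  have "cmp (\<lambda>x. prod_encode (0, prod_encode (f x, enc (g x))))" by (intro cmp_intros assms)
  then show ?thesis by (rule cmp_code) simp
qed

lemma cmp_Imp [cmp_intros]:
  assumes "cmp f" "cmp g" "cmp h" shows "cmp (\<lambda>x. Imp (f x) (g x) (h x))"
proof -
  have "cmp (\<lambda>x. prod_encode (1, prod_encode (enc (f x), prod_encode (enc (g x), enc (h x)))))" by (intro cmp_intros assms)
  then show ?thesis by (rule cmp_code) simp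
qed

lemma cmp_case_ty [cmp_intros]:
  assumes "cmp t" "cmp a" "cmp (\<lambda>p. b (fst p) (fst (snd p)) (snd (snd p)))"
  shows "cmp (\<lambda>x. case t x of Iota \<Rightarrow> a x | Fun u v \<Rightarrow> b x u v)"
proof -
  let ?l = "\<lambda>t. case t of Iota \<Rightarrow> Iota | Fun u v \<Rightarrow> u" and ?r = "\<lambda>t. case t of Iota \<Rightarrow> Iota | Fun u v \<Rightarrow> v"
  have "cmp (\<lambda>n. if n = 0 then 0 else fst (prod_decode (n - 1)))"
    "cmp (\<lambda>n. if n = 0 then 0 else snd (prod_decode (n - 1)))" by (intro cmp_intros)+
  then have l: "cmp ?l" and r: "cmp ?r"
    by - (rule cmp_dom, assumption, auto split: ty.split)+
  have "cmp (\<lambda>x. if t x = Iota then a x else b x (?l (t x)) (?r (t x)))"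
    using cmp_comp[OF assms(3) cmp_pair[OF cmp_id cmp_pair[OF cmp_comp[OF l assms(1)] cmp_comp[OF r assms(1)]]]]
    by (intro cmp_intros assms) simp
  moreover have "(if t x = Iota then a x else b x (?l (t x)) (?r (t x))) = (case t x of Iota \<Rightarrow> a x | Fun u v \<Rightarrow> b x u v)" for x
    by (cases "t x") auto
  ultimately show ?thesis by simp
qed

lemma cmp_case_tm [cmp_intros]:
  assumes "cmp t" "cmp (\<lambda>p. a (fst p) (snd p))" "cmp (\<lambda>p. b (fst p) (snd p))"
    "cmp (\<lambda>p. c (fst p) (fst (snd p)) (snd (snd p)))"
  shows "cmp (\<lambda>x. case t x of Var i \<Rightarrow> a x i | Sym k \<Rightarrow> b x k | App u v \<Rightarrow> c x u v)"
proof -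
  let ?l = "\<lambda>t. case t of App u v \<Rightarrow> u | _ \<Rightarrow> t" and ?r = "\<lambda>t. case t of App u v \<Rightarrow> v | _ \<Rightarrow> t"
  let ?tag = "\<lambda>t::tm. fst (prod_decode (enc t))" and ?i = "\<lambda>t::tm. snd (prod_decode (enc t))"
  have "cmp (\<lambda>n. if fst (prod_decode n) = 2 then fst (prod_decode (snd (prod_decode n))) else n)"
    "cmp (\<lambda>n. if fst (prod_decode n) = 2 then snd (prod_decode (snd (prod_decode n))) else n)"
    by (intro cmp_intros)+
  then have l: "cmp ?l" and r: "cmp ?r"
    by - (rule cmp_dom, assumption, auto split: tm.split)+
  have c: "cmp (\<lambda>x. c x (?l (t x)) (?r (t x)))"
    using cmp_comp[OF assms(4) cmp_pair[OF cmp_id cmp_pair[OF cmp_comp[OF l assms(1)] cmp_comp[OF r assms(1)]]]]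
    by simp
  have "cmp (\<lambda>x. if ?tag (t x) = 0 then a x (?i (t x)) else if ?tag (t x) = 1 then b x (?i (t x)) else c x (?l (t x)) (?r (t x)))"
    by (intro cmp_intros assms c cmp_comp2[OF assms(2)] cmp_comp2[OF assms(3)])
  moreover have "(if ?tag (t x) = 0 then a x (?i (t x)) else if ?tag (t x) = 1 then b x (?i (t x)) else c x (?l (t x)) (?r (t x)))
    = (case t x of Var i \<Rightarrow> a x i | Sym k \<Rightarrow> b x k | App u v \<Rightarrow> c x u v)" for x
    by (cases "t x") auto
  ultimately show ?thesis by simp
qed

lemma cmp_case_fm [cmp_intros]:
  assumes "cmp t" "cmp (\<lambda>p. a (fst p) (fst (snd p)) (snd (snd p)))"
    "cmp (\<lambda>p. b (fst p) (fst (snd p)) (fst (snd (snd p))) (snd (snd (snd p))))"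
  shows "cmp (\<lambda>x. case t x of Atom P s \<Rightarrow> a x P s | Imp zs U G \<Rightarrow> b x zs U G)"
proof -
  let ?P = "\<lambda>t. case t of Atom P s \<Rightarrow> P | _ \<Rightarrow> 0" and ?s = "\<lambda>t. case t of Atom P s \<Rightarrow> s | _ \<Rightarrow> Var 0"
  let ?z = "\<lambda>t. case t of Imp zs U G \<Rightarrow> zs | _ \<Rightarrow> []" and ?U = "\<lambda>t. case t of Imp zs U G \<Rightarrow> U | _ \<Rightarrow> {||}"
    and ?G = "\<lambda>t. case t of Imp zs U G \<Rightarrow> G | _ \<Rightarrow> {||}"
  let ?d = "\<lambda>n. snd (prod_decode n)"
  have "cmp (\<lambda>n. if fst (prod_decode n) = 0 then fst (prod_decode (?d n)) else 0)"
    "cmp (\<lambda>n. if fst (prod_decode n) = 0 then snd (prod_decode (?d n)) else prod_encode (0, 0))"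
    "cmp (\<lambda>n. if fst (prod_decode n) = 0 then 0 else fst (prod_decode (?d n)))"
    "cmp (\<lambda>n. if fst (prod_decode n) = 0 then 0 else fst (prod_decode (?d (?d n))))"
    "cmp (\<lambda>n. if fst (prod_decode n) = 0 then 0 else snd (prod_decode (?d (?d n))))"
    by (intro cmp_intros)+
  then have d: "cmp ?P" "cmp ?s" "cmp ?z" "cmp ?U" "cmp ?G"
    by - (rule cmp_dom, assumption, auto split: fm.split simp: enc_fset)+
  note d = d[THEN cmp_comp, OF assms(1)]
  have "cmp (\<lambda>x. if fst (prod_decode (enc (t x))) = 0 then a x (?P (t x)) (?s (t x)) else b x (?z (t x)) (?U (t x)) (?G (t x)))"
    using cmp_comp[OF assms(2) cmp_pair[OF cmp_id cmp_pair[OF d(1) d(2)]]]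
      cmp_comp[OF assms(3) cmp_pair[OF cmp_id cmp_pair[OF d(3) cmp_pair[OF d(4) d(5)]]]]
    by (intro cmp_intros assms) simp_all
  moreover have "(if fst (prod_decode (enc (t x))) = 0 then a x (?P (t x)) (?s (t x)) else b x (?z (t x)) (?U (t x)) (?G (t x)))
    = (case t x of Atom P s \<Rightarrow> a x P s | Imp zs U G \<Rightarrow> b x zs U G)" for x
    by (cases "t x") auto
  ultimately show ?thesis by simp
qed

text \<open>Pairing alone need not increase, since \<open>prod_encode (0, 0) = 0\<close>; the tag 2
  makes both inequalities strict.\<close>

lemma enc_less_App: "enc u < enc (App u v)" "enc v < enc (App u v)"
proof -
  have "n < prod_encode (2, n)" for n by (simp add: prod_encode_def numeral_2_eq_2)
  then show "enc u < enc (App u v)" "enc v < enc (App u v)"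
    using le_prod_encode_1[of "enc u" "enc v"] le_prod_encode_2[of "enc v" "enc u"] by (auto intro: le_less_trans)
qed

lemma enc_less_fset: "x |\<in>| X \<Longrightarrow> enc x < enc X"
  by (rule set_decode_nat_lt) (simp add: set_decode_enc)

text \<open>Strictness comes from the step from an element to its set; the surrounding pairs are
  only weakly increasing.\<close>

lemma enc_less_Imp: "C |\<in>| U |\<union>| G \<Longrightarrow> enc C < enc (Imp zs U G)"
proof -
  assume "C |\<in>| U |\<union>| G"
  then have "enc C < enc U \<or> enc C < enc G" by (auto dest: enc_less_fset)
  moreover have "enc U \<le> enc (Imp zs U G)" "enc G \<le> enc (Imp zs U G)"
    by (auto intro: order_trans[OF _ le_prod_encode_2] le_prod_encode_1 le_prod_encode_2
        order_trans[OF order_trans[OF le_prod_encode_1 le_prod_encode_2] le_prod_encode_2]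
        order_trans[OF order_trans[OF le_prod_encode_2 le_prod_encode_2] le_prod_encode_2])
  ultimately show ?thesis by linarith
qed

lemma cmp_tm_rec:
  fixes F :: "'p::enc \<Rightarrow> tm \<Rightarrow> 'b::enc"
  assumes "\<And>p i. F p (Var i) = v p i" "\<And>p c. F p (Sym c) = s p c"
    "\<And>p u w. F p (App u w) = a p u w (F p u) (F p w)"
    and "cmp (\<lambda>(p, i). v p i)" "cmp (\<lambda>(p, c). s p c)" "cmp (\<lambda>(p, u, w, r, r'). a p u w r r')"
    and "cmp f" "cmp t"
  shows "cmp (\<lambda>x. F (f x) (t x))"
proof -
  have v: "cmp (\<lambda>x. v (f x) (g x))" if "cmp f" "cmp g" for f g
    using cmp_comp[OF assms(4) cmp_pair[OF that]] by simp
  have s: "cmp (\<lambda>x. s (f x) (g x))" if "cmp f" "cmp g" for f g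
    using cmp_comp[OF assms(5) cmp_pair[OF that]] by simp
  have a: "cmp (\<lambda>x. a (f x) (g x) (h x) (r x) (r' x))" if "cmp f" "cmp g" "cmp h" "cmp r" "cmp r'" for f g h r r'
    using cmp_comp[OF assms(6) cmp_pair[OF that(1) cmp_pair[OF that(2) cmp_pair[OF that(3) cmp_pair[OF that(4,5)]]]]] by simp
  let ?D = "\<lambda>y. case snd y of Var _ \<Rightarrow> {||} | Sym _ \<Rightarrow> {||} | App u w \<Rightarrow> {|(fst y, u), (fst y, w)|}"
  \<comment> \<open>The two recursive values are told apart by looking up their arguments in the
    graph.\<close>
  let ?get = "\<lambda>g z. pick (snd |`| ffilter (\<lambda>e. fst e = z) g)"
  let ?h = "\<lambda>(y, g). case snd y of Var i \<Rightarrow> v (fst y) i | Sym c \<Rightarrow> s (fst y) c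
    | App u w \<Rightarrow> a (fst y) u w (?get g (fst y, u)) (?get g (fst y, w))"
  have get: "snd |`| ffilter (\<lambda>e. fst e = z) ((\<lambda>y. (y, F (fst y) (snd y))) |`| A) = {|F (fst z) (snd z)|}"
    if "z |\<in>| A" for z A using that by force
  have "cmp (\<lambda>p. F (fst p) (snd p))"
  proof (rule cmp_rec)
    show "cmp ?h" by (intro cmp_intros v s a)
    show "cmp ?D" by (intro cmp_intros)
    show "cmp (\<lambda>y. enc (snd y))" by (intro cmp_intros)
    show "enc (snd z) < enc (snd y)" if "z |\<in>| ?D y" for y z
      using that enc_less_App by (auto split: tm.splits simp del: enc_tm_simps)
    show "F (fst y) (snd y) = ?h (y, (\<lambda>y. (y, F (fst y) (snd y))) |`| ?D y)" for y
      using get[of "(fst y, _)" "?D y"] by (auto simp: assms(1-3) split: tm.split)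
  qed
  from cmp_comp2[OF this assms(7,8)] show ?thesis .
qed

text \<open>The parameter is changed by \<open>q\<close> on the way below a binder, which covers
  substitutions, typing contexts and rewriting states. The combining function sees only the sets of
  recursive values for \<open>U\<close> and for \<open>G\<close>.\<close>

lemma cmp_fm_rec:
  fixes F :: "'p::enc \<Rightarrow> fm \<Rightarrow> 'b::enc"
  assumes "\<And>p P t. F p (Atom P t) = a p P t"
    "\<And>p zs U G. F p (Imp zs U G) = b p zs U G (F (q p zs U) |`| U) (F (q p zs U) |`| G)"
    and "cmp (\<lambda>(p, P, t). a p P t)" "cmp (\<lambda>(p, zs, U, G, r, r'). b p zs U G r r')"
    "cmp (\<lambda>(p, zs, U). q p zs U)"
    and "cmp f" "cmp t"
  shows "cmp (\<lambda>x. F (f x) (t x))"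
proof -
  have a: "cmp (\<lambda>x. a (f x) (g x) (h x))" if "cmp f" "cmp g" "cmp h" for f g h
    using cmp_comp[OF assms(3) cmp_pair[OF that(1) cmp_pair[OF that(2,3)]]] by simp
  have q: "cmp (\<lambda>x. q (f x) (g x) (h x))" if "cmp f" "cmp g" "cmp h" for f g h
    using cmp_comp[OF assms(5) cmp_pair[OF that(1) cmp_pair[OF that(2,3)]]] by simp
  have b: "cmp (\<lambda>x. b (f x) (g x) (h x) (k x) (r x) (r' x))"
    if "cmp f" "cmp g" "cmp h" "cmp k" "cmp r" "cmp r'" for f g h k r r'
    using cmp_comp[OF assms(4) cmp_pair[OF that(1) cmp_pair[OF that(2) cmp_pair[OF that(3) cmp_pair[OF that(4) cmp_pair[OF that(5,6)]]]]]] by simp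
  let ?D = "\<lambda>y. case snd y of Atom _ _ \<Rightarrow> {||} | Imp zs U G \<Rightarrow> Pair (q (fst y) zs U) |`| (U |\<union>| G)"
  let ?get = "\<lambda>g X. snd |`| ffilter (\<lambda>e. snd (fst e) |\<in>| X) g"
  let ?h = "\<lambda>(y, g). case snd y of Atom P t \<Rightarrow> a (fst y) P t
    | Imp zs U G \<Rightarrow> b (fst y) zs U G (?get g U) (?get g G)"
  have get: "?get ((\<lambda>y. (y, F (fst y) (snd y))) |`| Pair p |`| A) X = F p |`| X"
    if "X |\<subseteq>| A" for p X A using that by force
  have "cmp (\<lambda>p. F (fst p) (snd p))"
  proof (rule cmp_rec)
    show "cmp ?h" by (intro cmp_intros a b)
    show "cmp ?D" by (intro cmp_intros q)
    show "cmp (\<lambda>y. enc (snd y))" by (intro cmp_intros)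
    show "enc (snd z) < enc (snd y)" if "z |\<in>| ?D y" for y z
      using that enc_less_Imp by (auto split: fm.splits simp del: enc_fm_simps)
    show "F (fst y) (snd y) = ?h (y, (\<lambda>y. (y, F (fst y) (snd y))) |`| ?D y)" for y
    proof (cases "snd y")
      case (Imp zs U G)
      then show ?thesis
        using get[of U "U |\<union>| G" "q (fst y) zs U"] get[of G "U |\<union>| G" "q (fst y) zs U"]
        by (simp add: assms(2) del: fimage_funion)
    qed (simp add: assms(1))
  qed
  from cmp_comp2[OF this assms(6,7)] show ?thesis .
qed


section \<open>Computable syntax\<close>

lemma subst_tm_comp: "subst_tm \<tau> (subst_tm \<sigma> t) = subst_tm (\<lambda>i. subst_tm \<tau> (\<sigma> i)) t"
  by (induction t) auto

lemma subst_tm_cong: "(\<And>i. i \<in> fv_tm t \<Longrightarrow> \<sigma> i = \<tau> i) \<Longrightarrow> subst_tm \<sigma> t = subst_tm \<tau> t"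
  by (induction t) auto

lemma subst_tm_Var [simp]: "subst_tm Var t = t"
  by (induction t) auto

lemma lift_tm_simps [simp]: "lift_tm n (Var i) = Var (i + n)" "lift_tm n (Sym c) = Sym c"
  "lift_tm n (App u v) = App (lift_tm n u) (lift_tm n v)"
  by (auto simp: lift_tm_def)

lemma lift_tm_lift_tm: "lift_tm n (lift_tm k t) = lift_tm (k + n) t"
  by (induction t) (auto simp: ac_simps)

lemma lift_tm_0 [simp]: "lift_tm 0 t = t"
  by (induction t) auto

lemma subst_tm_under_lift: "subst_tm (under n \<sigma>) (lift_tm n t) = lift_tm n (subst_tm \<sigma> t)"
  by (simp add: lift_tm_def subst_tm_comp under_def)

lemma under_comp: "(\<lambda>i. subst_tm (under n \<tau>) (under n \<sigma> i)) = under n (\<lambda>i. subst_tm \<tau> (\<sigma> i))"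
proof
  show "subst_tm (under n \<tau>) (under n \<sigma> i) = under n (\<lambda>i. subst_tm \<tau> (\<sigma> i)) i" for i
    by (cases "i < n") (auto simp: under_def[of n \<sigma>] under_def[of n "\<lambda>i. subst_tm \<tau> (\<sigma> i)"] subst_tm_under_lift, simp add: under_def)
qed

lemma under_Var [simp]: "under n Var = Var"
  by (auto simp: under_def)

lemma subst_fm_Imp [simp]:
  "subst_fm (Imp zs U G) \<sigma> = Imp zs (subst (under (length zs) \<sigma>) U) (subst (under (length zs) \<sigma>) G)"
  by (simp add: subst_def fset.map_comp comp_def)

declare subst_fm.simps(2) [simp del]

lemma subst_simps [simp]: "subst \<sigma> {||} = {||}" "subst \<sigma> (finsert C G) = finsert (subst_fm C \<sigma>) (subst \<sigma> G)"
  "subst \<sigma> (G |\<union>| H) = subst \<sigma> G |\<union>| subst \<sigma> H"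
  by (auto simp: subst_def)

lemma subst_fm_comp: "subst_fm (subst_fm C \<sigma>) \<tau> = subst_fm C (\<lambda>i. subst_tm \<tau> (\<sigma> i))"
proof (induction C arbitrary: \<sigma> \<tau>)
  case (Imp zs U G)
  have "subst (under (length zs) \<tau>) (subst (under (length zs) \<sigma>) X) = subst (under (length zs) (\<lambda>i. subst_tm \<tau> (\<sigma> i))) X"
    if "X = U \<or> X = G" for X
    using Imp.IH that unfolding subst_def by (auto simp: fset.map_comp comp_def under_comp)
  then show ?case by simp
qed (simp add: subst_tm_comp)

lemma subst_comp: "subst \<tau> (subst \<sigma> G) = subst (\<lambda>i. subst_tm \<tau> (\<sigma> i)) G"
  by (simp add: subst_def fset.map_comp comp_def subst_fm_comp)

definition fv :: "formula \<Rightarrow> nat set" where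
  "fv G = (\<Union>C \<in> fset G. fv_fm C)"

lemma fv_simps [simp]: "fv {||} = {}" "fv (finsert C G) = fv_fm C \<union> fv G" "fv (G |\<union>| H) = fv G \<union> fv H"
  by (auto simp: fv_def)

lemma fv_fm_Imp [simp]: "fv_fm (Imp zs U G) = {i. i + length zs \<in> fv U \<union> fv G}"
  by (simp add: fv_def)

declare fv_fm.simps(2) [simp del]

lemma subst_fm_cong: "(\<And>i. i \<in> fv_fm C \<Longrightarrow> \<sigma> i = \<tau> i) \<Longrightarrow> subst_fm C \<sigma> = subst_fm C \<tau>"
proof (induction C arbitrary: \<sigma> \<tau>)
  case (Imp zs U G)
  have "subst (under (length zs) \<sigma>) X = subst (under (length zs) \<tau>) X" if X: "X = U \<or> X = G" for X
    unfolding subst_def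
  proof (intro fimage_cong refl)
    fix C assume C: "C |\<in>| X"
    show "subst_fm C (under (length zs) \<sigma>) = subst_fm C (under (length zs) \<tau>)"
    proof -
      have *: "under (length zs) \<sigma> i = under (length zs) \<tau> i" if "i \<in> fv_fm C" for i
      proof (cases "i < length zs")
        case False
        then have "i - length zs \<in> fv_fm (Imp zs U G)" using that C X by (auto simp: fv_def)
        then have "\<sigma> (i - length zs) = \<tau> (i - length zs)" by (rule Imp.prems)
        then show ?thesis using False by (simp add: under_def)
      qed (simp add: under_def)
      show ?thesis using X
      proof
        assume "X = U"
        then have "C |\<in>| U" using C by simp
        then show ?thesis by (rule Imp.IH(1)) (rule *)
      next
        assume "X = G"
        then have "C |\<in>| G" using C by simp
        then show ?thesis by (rule Imp.IH(2)) (rule *)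
      qed
    qed
  qed
  then show ?case by simp
qed (auto intro: subst_tm_cong)

lemma subst_fm_Var [simp]: "subst_fm C Var = C"
proof (induction C)
  case (Imp zs U G)
  then have "subst Var X = X" if "X = U \<or> X = G" for X
    using that by (auto simp: subst_def image_iff intro!: fset_eqI)
  then show ?case by simp
qed simp

lemma subst_Var [simp]: "subst Var G = G"
  by (simp add: subst_def)

lemma subst_cong: "(\<And>i. i \<in> fv G \<Longrightarrow> \<sigma> i = \<tau> i) \<Longrightarrow> subst \<sigma> G = subst \<tau> G"
  unfolding subst_def by (intro fimage_cong refl subst_fm_cong) (auto simp: fv_def)

lemma unlift_tm_lift_tm [simp]: "subst_tm (\<lambda>i. Var (i - n)) (lift_tm n t) = t"
  by (simp add: lift_tm_def subst_tm_comp)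

lemma unlift_lift [simp]: "subst (\<lambda>i. Var (i - n)) (lift n G) = G"
  by (simp add: lift_def subst_comp)

section \<open>Computability of substitution, restriction and clauses\<close>

definition nth_default :: "'a \<Rightarrow> 'a list \<Rightarrow> nat \<Rightarrow> 'a" where
  "nth_default d xs i = (if i < length xs then xs ! i else d)"

lemma cmp_nth_default [cmp_intros]:
  assumes "cmp d" "cmp l" "cmp i"
  shows "cmp (\<lambda>x. nth_default (d x) (l x) (i x))"
proof -
  have "cmp (\<lambda>x. (\<lambda>p l. nth_default (fst p) l (snd p)) (d x, i x) (l x))"
    by (rule cmp_list_rec[of "\<lambda>p l. nth_default (fst p) l (snd p)" fst "\<lambda>p x xs r. if snd p = 0 then x else r"
          "\<lambda>p x xs. (fst p, snd p - 1)"])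
      (auto intro!: cmp_intros assms simp: nth_default_def nth_Cons' less_Suc_eq_0_disj)
  then show ?thesis by simp
qed

lemma cmp_lift_tm [cmp_intros]:
  assumes "cmp n" "cmp t"
  shows "cmp (\<lambda>x. lift_tm (n x) (t x))"
  by (rule cmp_tm_rec[of lift_tm "\<lambda>n i. Var (i + n)" "\<lambda>n c. Sym c" "\<lambda>n u v r r'. App r r'"])
    (auto intro!: cmp_intros assms)

text \<open>Below \<open>k\<close> binders, \<open>list_subst (k, ss, d)\<close> substitutes \<open>ss\<close> for the first variables outside and
  shifts the remaining ones down by \<open>length ss\<close> and up by \<open>d\<close>.\<close>

definition list_subst :: "nat \<times> tm list \<times> nat \<Rightarrow> nat \<Rightarrow> tm" where
  "list_subst p i = (if i < fst p then Var i
     else lift_tm (fst p) (nth_default (Var (i - fst p - length (fst (snd p)) + snd (snd p))) (fst (snd p)) (i - fst p)))"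

text \<open>The family is closed under passing below binders and only the first component changes.
  Substitution thereby becomes a recursion on formulas whose parameter is a code, although a
  substitution itself is a function.\<close>

lemma under_list_subst: "under n (list_subst p) = list_subst (fst p + n, snd p)"
proof
  show "under n (list_subst p) i = list_subst (fst p + n, snd p) i" for i
  proof -
    consider "i < n" | "n \<le> i" "i < fst p + n" | "fst p + n \<le> i" by linarith
    then show ?thesis
    proof cases
      case 3
      then have "i - n - fst p = i - (fst p + n)" by simp
      then show ?thesis using 3 by (auto simp: under_def list_subst_def lift_tm_lift_tm)
    qed (auto simp: under_def list_subst_def)
  qed
qed

lemma inst_list_subst: "inst ss = list_subst (0, ss, 0)"
  by (auto simp: inst_def list_subst_def nth_default_def)

lemma shift_list_subst: "(\<lambda>i. Var (i + n)) = list_subst (0, [], n)"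
  by (auto simp: list_subst_def nth_default_def)

text \<open>Subtraction is truncated, so each of the first \<open>n\<close> indices goes to
  \<open>Var 0\<close>; hence the \<open>n\<close> copies of it.\<close>

lemma unshift_list_subst: "(\<lambda>i. Var (i - n)) = list_subst (0, map (\<lambda>_. Var 0) [0..<n], 0)"
  by (auto simp: list_subst_def nth_default_def)

lemma cmp_list_subst [cmp_intros]: "cmp p \<Longrightarrow> cmp i \<Longrightarrow> cmp (\<lambda>x. list_subst (p x) (i x))"
  unfolding list_subst_def by (intro cmp_intros)

lemma cmp_subst_tm_list_subst [cmp_intros]:
  assumes "cmp p" "cmp t"
  shows "cmp (\<lambda>x. subst_tm (list_subst (p x)) (t x))"
  by (rule cmp_tm_rec[of "\<lambda>p. subst_tm (list_subst p)" list_subst "\<lambda>n c. Sym c" "\<lambda>n u v r r'. App r r'"])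
    (auto intro!: cmp_intros assms)

lemma cmp_subst_fm_list_subst [cmp_intros]:
  assumes "cmp p" "cmp t"
  shows "cmp (\<lambda>x. subst_fm (t x) (list_subst (p x)))"
  by (rule cmp_fm_rec[of "\<lambda>p t. subst_fm t (list_subst p)" "\<lambda>p P t. Atom P (subst_tm (list_subst p) t)"
        "\<lambda>p zs U G r r'. Imp zs r r'" "\<lambda>p zs U. (fst p + length zs, snd p)"])
    (auto intro!: cmp_intros assms simp: under_list_subst subst_def)

lemma cmp_subst_list_subst [cmp_intros]:
  assumes "cmp p" "cmp G"
  shows "cmp (\<lambda>x. subst (list_subst (p x)) (G x))"
  unfolding subst_def by (intro cmp_intros assms cmp_comp[OF assms(1)])

lemma cmp_subst_inst [cmp_intros]: "cmp ss \<Longrightarrow> cmp G \<Longrightarrow> cmp (\<lambda>x. subst (inst (ss x)) (G x))"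
  unfolding inst_list_subst by (intro cmp_intros)

lemma cmp_lift [cmp_intros]: "cmp n \<Longrightarrow> cmp G \<Longrightarrow> cmp (\<lambda>x. lift (n x) (G x))"
  unfolding lift_def shift_list_subst by (intro cmp_intros)

lemma cmp_unlift [cmp_intros]: "cmp n \<Longrightarrow> cmp G \<Longrightarrow> cmp (\<lambda>x. subst (\<lambda>i. Var (i - n x)) (G x))"
  unfolding unshift_list_subst by (intro cmp_intros)

lemma cmp_unlift_tm [cmp_intros]: "cmp n \<Longrightarrow> cmp t \<Longrightarrow> cmp (\<lambda>x. subst_tm (\<lambda>i. Var (i - n x)) (t x))"
  unfolding unshift_list_subst by (intro cmp_intros)

lemma finite_fv_tm [simp]: "finite (fv_tm t)"
  by (induction t) auto

lemma finite_fv_fm [simp]: "finite (fv_fm C)"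
proof (induction C)
  case (Imp zs U G)
  then have "finite (fv U \<union> fv G)" by (auto simp: fv_def)
  moreover have "{i. i + length zs \<in> fv U \<union> fv G} = (\<lambda>i. i + length zs) -` (fv U \<union> fv G)" by auto
  ultimately show ?case by (simp add: finite_vimageI inj_on_def)
qed simp

definition fvs_tm :: "tm \<Rightarrow> nat fset" where "fvs_tm t = Abs_fset (fv_tm t)"

definition fvs_fm :: "fm \<Rightarrow> nat fset" where "fvs_fm C = Abs_fset (fv_fm C)"

lemma fset_fvs_tm [simp]: "fset (fvs_tm t) = fv_tm t" by (simp add: fvs_tm_def Abs_fset_inverse)

lemma fset_fvs_fm [simp]: "fset (fvs_fm C) = fv_fm C" by (simp add: fvs_fm_def Abs_fset_inverse)

lemma cmp_fvs_tm [cmp_intros]: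
  assumes "cmp t" shows "cmp (\<lambda>x. fvs_tm (t x))"
  by (rule cmp_tm_rec[of "\<lambda>p. fvs_tm" "\<lambda>p i. {|i|}" "\<lambda>n c. {||}" "\<lambda>n u v r r'. r |\<union>| r'" "\<lambda>x. 0::nat"])
    (auto intro!: cmp_intros assms fset_eqI)

lemma cmp_fvs_fm [cmp_intros]:
  assumes "cmp t" shows "cmp (\<lambda>x. fvs_fm (t x))"
proof (rule cmp_fm_rec[of "\<lambda>p. fvs_fm" "\<lambda>p P t. fvs_tm t"
      "\<lambda>p zs U G r r'. (\<lambda>i. i - length zs) |`| ffilter (\<lambda>i. length zs \<le> i) (ffUnion r |\<union>| ffUnion r')" "\<lambda>p zs U. p" "\<lambda>x. 0::nat"])
  fix p :: nat and zs U G
  let ?X = "ffUnion (fvs_fm |`| U) |\<union>| ffUnion (fvs_fm |`| G)"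
  have X: "fset ?X = fv U \<union> fv G" by (auto simp: fv_def)
  have "fset (fvs_fm (Imp zs U G)) = (\<lambda>i. i - length zs) ` {i \<in> fset ?X. length zs \<le> i}"
  proof (intro set_eqI iffI)
    fix i assume "i \<in> fset (fvs_fm (Imp zs U G))"
    then have "i + length zs \<in> {i \<in> fset ?X. length zs \<le> i}" unfolding X by simp
    then show "i \<in> (\<lambda>i. i - length zs) ` {i \<in> fset ?X. length zs \<le> i}" by (rule rev_image_eqI) simp
  qed (auto simp: fv_def)
  then show "fvs_fm (Imp zs U G) = (\<lambda>i. i - length zs) |`| ffilter (\<lambda>i. length zs \<le> i) ?X"
    by (intro fset_inject[THEN iffD1]) (simp, intro arg_cong[where f = "image _"], auto)
qed (auto intro!: cmp_intros assms fset_eqI)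

lemma restrict_fvs_fm: "restrict xs zs U = subst (\<lambda>i. Var (i - length xs))
    (ffilter (\<lambda>C. fBex (fvs_fm C) (\<lambda>i. length xs \<le> i \<and> i < length xs + length zs)) U)"
proof -
  have "ffilter (\<lambda>C. fv_fm C \<inter> {length xs ..< length xs + length zs} \<noteq> {}) U =
    ffilter (\<lambda>C. fBex (fvs_fm C) (\<lambda>i. length xs \<le> i \<and> i < length xs + length zs)) U"
    by (rule fset_eqI) auto
  then show ?thesis by (simp add: restrict_def)
qed

lemma cmp_restrict [cmp_intros]:
  assumes "cmp xs" "cmp zs" "cmp U"
  shows "cmp (\<lambda>x. restrict (xs x) (zs x) (U x))"
  unfolding restrict_fvs_fm by (intro cmp_intros assms assms[THEN cmp_comp])

lemma cmp_apps [cmp_intros]: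
  assumes "cmp h" "cmp ss"
  shows "cmp (\<lambda>x. apps (h x) (ss x))"
  by (rule cmp_list_rec[of apps "\<lambda>h. h" "\<lambda>h s ss r. r" "\<lambda>h s ss. App h s"])
    (auto intro!: cmp_intros assms simp: apps_def)

lemma cmp_bvars [cmp_intros]: "cmp zs \<Longrightarrow> cmp (\<lambda>x. bvars (zs x))"
  unfolding bvars_def by (intro cmp_intros)

lemma cmp_clause [cmp_intros]:
  assumes "cmp ts" "cmp U" "cmp P" "cmp h"
  shows "cmp (\<lambda>x. clause (ts x) (U x) (P x) (h x))"
  unfolding clause_def Let_def by (intro cmp_intros assms)

lemma cmp_fun_ty [cmp_intros]:
  assumes "cmp ts" shows "cmp (\<lambda>x. fun_ty (ts x))"
  by (rule cmp_list_rec[of "\<lambda>p. fun_ty" "\<lambda>p. Iota" "\<lambda>p t ts r. Fun t r" "\<lambda>p t ts. p" "\<lambda>x. 0::nat"])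
    (auto intro!: cmp_intros assms simp: fun_ty_def)

primrec spine :: "tm \<Rightarrow> tm \<times> tm list" where
  "spine (Var i) = (Var i, [])"
| "spine (Sym c) = (Sym c, [])"
| "spine (App u v) = (fst (spine u), snd (spine u) @ [v])"

lemma cmp_spine [cmp_intros]:
  assumes "cmp t" shows "cmp (\<lambda>x. spine (t x))"
  by (rule cmp_tm_rec[of "\<lambda>p. spine" "\<lambda>p i. (Var i, [])" "\<lambda>n c. (Sym c, [])" "\<lambda>n u v r r'. (fst r, snd r @ [v])" "\<lambda>x. 0::nat"])
    (auto intro!: cmp_intros assms)

lemma apps_simps [simp]: "apps h [] = h" "apps h (s # ss) = apps (App h s) ss" "apps h (ss @ [s]) = App (apps h ss) s"
  by (auto simp: apps_def)

lemma bvars_Nil [simp]: "bvars [] = []"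
  by (simp add: bvars_def)

lemma spine_apps: "is_head h \<Longrightarrow> spine (apps h ss) = (h, ss)"
  by (induction ss rule: rev_induct) (auto simp: is_head_def)

lemma apps_spine: "apps (fst (spine t)) (snd (spine t)) = t \<and> is_head (fst (spine t))"
  by (induction t) (auto simp: is_head_def)

lemma is_head_simps [simp]: "is_head (Var i)" "is_head (Sym c)" "\<not> is_head (App u v)"
  by (auto simp: is_head_def)

lemma cmp_is_head [cmp_intros]: "cmp t \<Longrightarrow> cmp (\<lambda>x. is_head (t x))"
proof -
  assume "cmp t"
  then have "cmp (\<lambda>x. case t x of Var i \<Rightarrow> True | Sym c \<Rightarrow> True | App u v \<Rightarrow> False)" by (intro cmp_intros)
  moreover have "(case s of Var i \<Rightarrow> True | Sym c \<Rightarrow> True | App u v \<Rightarrow> False) = is_head s" for s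
    by (cases s) auto
  ultimately show ?thesis by simp
qed

text \<open>All ways to read \<open>C\<close> as a clause with an atomic head. Under a binder the
  candidate head is lowered blindly and the candidate is accepted only if rebuilding it returns
  \<open>C\<close>, which rules out captured heads, extra conjuncts and wrong argument lists in one
  test.\<close>

definition dest_clause :: "fm \<Rightarrow> (ty list \<times> formula \<times> nat \<times> tm) fset" where
  "dest_clause C = (case C of
     Atom P t \<Rightarrow> if is_head t then {|([], {||}, P, t)|} else {||}
   | Imp ts U B \<Rightarrow> ffilter (\<lambda>(ts, U, P, h). is_head h \<and> clause ts U P h = C)
       (fbind B (\<lambda>A. case A of
          Atom P t \<Rightarrow> {|(ts, U, P, subst_tm (\<lambda>i. Var (i - length ts)) (fst (spine t)))|}
        | Imp _ _ _ \<Rightarrow> {||})))"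

lemma is_head_lift_tm [simp]: "is_head (lift_tm n h) \<longleftrightarrow> is_head h"
  by (cases h) auto

lemma dest_clause_iff: "(ts, U, P, h) |\<in>| dest_clause C \<longleftrightarrow> is_head h \<and> clause ts U P h = C"
proof
  show "(ts, U, P, h) |\<in>| dest_clause C \<Longrightarrow> is_head h \<and> clause ts U P h = C"
    by (auto simp: dest_clause_def clause_def split: fm.splits if_splits)
  assume h: "is_head h \<and> clause ts U P h = C"
  show "(ts, U, P, h) |\<in>| dest_clause C"
  proof (cases "ts = [] \<and> U = {||}")
    case True
    then have "C = Atom P h" using h by (auto simp: clause_def)
    then show ?thesis using h True by (simp add: dest_clause_def)
  next
    case False
    then have "clause ts U P h = Imp ts U {|Atom P (apps (lift_tm (length ts) h) (bvars ts))|}"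
      unfolding clause_def Let_def by (simp only: if_False)
    then have "C = Imp ts U {|Atom P (apps (lift_tm (length ts) h) (bvars ts))|}" using h by simp
    then show ?thesis using h by (simp add: dest_clause_def spine_apps)
  qed
qed

lemma cmp_dest_clause [cmp_intros]: 
  assumes "cmp C"
  shows "cmp (\<lambda>x. dest_clause (C x))"
  unfolding dest_clause_def by (intro cmp_intros assms cmp_comp[OF assms])


section \<open>Successors of a formula\<close>

primrec tys :: "sig \<Rightarrow> ctxt \<Rightarrow> tm \<Rightarrow> ty fset" where
  "tys S \<Gamma> (Var i) = (if i < length \<Gamma> then {|nth_default Iota \<Gamma> i|} else {||})"
| "tys S \<Gamma> (Sym c) = (case S c of None \<Rightarrow> {||} | Some t \<Rightarrow> {|t|})"
| "tys S \<Gamma> (App u v) = fbind (tys S \<Gamma> u)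
     (\<lambda>t. case t of Iota \<Rightarrow> {||} | Fun a b \<Rightarrow> if a |\<in>| tys S \<Gamma> v then {|b|} else {||})"

inductive_cases has_ty_VarE: "has_ty S \<Gamma> (Var i) t"
inductive_cases has_ty_SymE: "has_ty S \<Gamma> (Sym c) t"
inductive_cases has_ty_AppE: "has_ty S \<Gamma> (App u v) t"

lemma has_ty_simps: 
  "has_ty S \<Gamma> (Var i) t \<longleftrightarrow> i < length \<Gamma> \<and> t = \<Gamma> ! i"
  "has_ty S \<Gamma> (Sym c) t \<longleftrightarrow> S c = Some t"
  "has_ty S \<Gamma> (App u v) t \<longleftrightarrow> (\<exists>a. has_ty S \<Gamma> u (Fun a t) \<and> has_ty S \<Gamma> v a)"
  by (auto intro: has_ty.intros elim: has_ty_VarE has_ty_SymE has_ty_AppE)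

lemma tys_iff: "t |\<in>| tys S \<Gamma> u \<longleftrightarrow> has_ty S \<Gamma> u t"
proof (induction u arbitrary: t)
  case (App u v)
  have "t |\<in>| tys S \<Gamma> (App u v) \<longleftrightarrow> (\<exists>a. Fun a t |\<in>| tys S \<Gamma> u \<and> a |\<in>| tys S \<Gamma> v)"
    by (auto split: ty.splits if_splits) (metis fempty_iff finsertI1 ty.exhaust)+
  then show ?case by (simp add: App has_ty_simps)
qed (auto simp: has_ty_simps nth_default_def split: option.split)

lemma cmp_tys [cmp_intros]:
  assumes S: "finite (dom S)" and "cmp \<Gamma>" "cmp u"
  shows "cmp (\<lambda>x. tys S (\<Gamma> x) (u x))"
proof (rule cmp_tm_rec[of "tys S" "\<lambda>p i. if i < length p then {|nth_default Iota p i|} else {||}" "\<lambda>p c. case S c of None \<Rightarrow> {||} | Some t \<Rightarrow> {|t|}"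
      "\<lambda>p u v A B. fbind A (\<lambda>t. case t of Iota \<Rightarrow> {||} | Fun a b \<Rightarrow> if a |\<in>| B then {|b|} else {||})"])
  \<comment> \<open>A finite signature is a finite table, hence a constant of the
    computation.\<close>
  define T where "T = Abs_fset {(c, t). S c = Some t}"
  have "{(c, t). S c = Some t} \<subseteq> (\<lambda>c. (c, the (S c))) ` dom S" by force
  then have "finite {(c, t). S c = Some t}" using S finite_surj by blast
  then have T: "(c, t) |\<in>| T \<longleftrightarrow> S c = Some t" for c t by (simp add: T_def Abs_fset_inverse)
  have "(case S c of None \<Rightarrow> {||} | Some t \<Rightarrow> {|t|}) = snd |`| ffilter (\<lambda>e. fst e = c) T" for c
  proof (rule fset_eqI)
    fix x
    have "x |\<in>| snd |`| ffilter (\<lambda>e. fst e = c) T \<longleftrightarrow> S c = Some x"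
      by (auto simp: T intro: rev_image_eqI[of "(c, x)"])
    then show "x |\<in>| (case S c of None \<Rightarrow> {||} | Some t \<Rightarrow> {|t|}) \<longleftrightarrow> x |\<in>| snd |`| ffilter (\<lambda>e. fst e = c) T"
      by (auto split: option.split)
  qed
  then show "cmp (\<lambda>(p::ctxt, c). case S c of None \<Rightarrow> {||} | Some t \<Rightarrow> {|t|})"
    by (simp only:) (intro cmp_intros)
qed (auto intro!: cmp_intros assms)

primrec args_tys :: "sig \<Rightarrow> ctxt \<Rightarrow> tm list \<Rightarrow> ty list fset" where
  "args_tys S \<Gamma> [] = {|[]|}"
| "args_tys S \<Gamma> (s # ss) = fbind (tys S \<Gamma> s) (\<lambda>t. (#) t |`| args_tys S \<Gamma> ss)"

lemma args_tys_iff: "zs |\<in>| args_tys S \<Gamma> ss \<longleftrightarrow> list_all2 (has_ty S \<Gamma>) ss zs"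
  by (induction ss arbitrary: zs) (auto simp: list_all2_Cons1 tys_iff image_iff)

lemma cmp_args_tys [cmp_intros]:
  assumes "finite (dom S)" "cmp \<Gamma>" "cmp ss"
  shows "cmp (\<lambda>x. args_tys S (\<Gamma> x) (ss x))"
  by (rule cmp_list_rec[of "args_tys S" "\<lambda>\<Gamma>. {|[]|}" "\<lambda>\<Gamma> s ss r. fbind (tys S \<Gamma> s) (\<lambda>t. (#) t |`| r)" "\<lambda>\<Gamma> s ss. \<Gamma>"])
    (auto intro!: cmp_intros assms)

primrec splits :: "'a list \<Rightarrow> ('a list \<times> 'a list) fset" where
  "splits [] = {|([], [])|}"
| "splits (x # xs) = finsert ([], x # xs) ((\<lambda>p. (x # fst p, snd p)) |`| splits xs)"

lemma splits_iff: "(ys, zs) |\<in>| splits xs \<longleftrightarrow> xs = ys @ zs"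
proof (induction xs arbitrary: ys)
  case (Cons x xs)
  have "(ys, zs) \<in> (\<lambda>p. (x # fst p, snd p)) ` A \<longleftrightarrow> (\<exists>a. ys = x # a \<and> (a, zs) \<in> A)" for A
    by (auto intro: rev_image_eqI)
  then show ?case by (auto simp: Cons Cons_eq_append_conv)
qed auto

lemma cmp_splits [cmp_intros]:
  assumes "cmp l" shows "cmp (\<lambda>x. splits (l x))"
  by (rule cmp_list_rec[of "\<lambda>p. splits" "\<lambda>p. {|([], [])|}"
        "\<lambda>p x xs r. finsert ([], x # xs) ((\<lambda>p. (x # fst p, snd p)) |`| r)" "\<lambda>p x xs. p" "\<lambda>x. 0::nat"])
    (auto intro!: cmp_intros assms)

section \<open>Enumerating the one-step successors\<close>

type_synonym state = "ctxt \<times> formula \<times> nat list"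

definition refl_succs :: "formula \<Rightarrow> nat \<Rightarrow> tm \<Rightarrow> formula fset" where
  "refl_succs V P t =
    (if Atom P t |\<in>| V then case t of Var _ \<Rightarrow> {|{||}|} | Sym _ \<Rightarrow> {||} | App _ _ \<Rightarrow> {||} else {||})"

definition step_succs :: "formula \<Rightarrow> nat \<Rightarrow> tm \<Rightarrow> formula fset" where
  "step_succs V P t = fbind (fbind V dest_clause) (\<lambda>(xs, U, P', f).
     if P' = P \<and> f = fst (spine t) \<and> length (snd (spine t)) = length xs
     then {|subst (inst (snd (spine t))) U|} else {||})"

definition assm_succs :: "sig \<Rightarrow> state \<Rightarrow> nat \<Rightarrow> tm \<Rightarrow> formula fset" where
  "assm_succs S p P t = fbind (fset_of_list (snd (snd p))) (\<lambda>y.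
     if fst (spine t) = Var y then
       fbind (fbind (fst (snd p)) dest_clause) (\<lambda>(ts, U, P', f).
         if P' = P then
           fbind (splits ts) (\<lambda>(xs, zs).
             if zs |\<in>| args_tys S (fst p) (snd (spine t)) then
               {|subst (inst (snd (spine t))) (restrict xs zs U) |\<union>| {|clause zs (restrict xs zs U) P (Var y)|}|}
             else {||})
         else {||})
     else {||})"

text \<open>The predicate symbol is taken from the elements of \<open>G\<close>, so that every
  quantifier is bounded by a finite set.\<close>

definition blocked :: "nat list \<Rightarrow> ty list \<Rightarrow> formula \<Rightarrow> bool" where
  "blocked ys zs G \<longleftrightarrow> fBex (fset_of_list ys) (\<lambda>y. fBex G (\<lambda>A. case A of
     Atom P t \<Rightarrow> G = {|A|} \<and> t = apps (Var (y + length zs)) (bvars zs) | Imp _ _ _ \<Rightarrow> False))"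

text \<open>Lowering the indices is a left inverse of \<open>lift\<close>. So \<open>G\<close> is a
  lifted formula iff lowering and lifting return it, and the preimage is then unique.\<close>

definition scope_succs :: "ty list \<Rightarrow> formula \<Rightarrow> formula fset" where
  "scope_succs zs G = (if lift (length zs) (subst (\<lambda>i. Var (i - length zs)) G) = G
     then {|subst (\<lambda>i. Var (i - length zs)) G|} else {||})"

definition split_succs :: "ty list \<Rightarrow> formula \<Rightarrow> formula \<Rightarrow> formula fset" where
  "split_succs zs U G = fbind (fPow G) (\<lambda>G1. fbind (fPow G) (\<lambda>G2.
     if G1 |\<union>| G2 = G then {|{|Imp zs U G1, Imp zs U G2|}|} else {||}))"

text \<open>A set containing \<open>C\<close> splits as \<open>{|C|} |\<union>| H\<close> with or
  without \<open>C\<close> in \<open>H\<close>; accordingly the rewritten conjunct survives or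
  disappears.\<close>

definition combine :: "formula \<Rightarrow> (fm \<times> formula fset) fset \<Rightarrow> formula fset" where
  "combine G T = fbind T (\<lambda>(C, Ks). fbind Ks (\<lambda>K. {|K |\<union>| G, K |\<union>| (G |-| {|C|})|}))"

definition state_under :: "state \<Rightarrow> ty list \<Rightarrow> formula \<Rightarrow> state" where
  "state_under p zs U = (zs @ fst p, U |\<union>| lift (length zs) (fst (snd p)), map (\<lambda>y. y + length zs) (snd (snd p)))"

text \<open>The successors of a conjunct are paired with that conjunct so that the recursion only has to
  take images of formulas.\<close>

primrec succs :: "sig \<Rightarrow> fm \<Rightarrow> state \<Rightarrow> fm \<times> formula fset" where
  "succs S (Atom P t) = (\<lambda>p. (Atom P t,
     refl_succs (fst (snd p)) P t |\<union>| step_succs (fst (snd p)) P t |\<union>| assm_succs S p P t))"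
| "succs S (Imp zs U G) = (\<lambda>p. (Imp zs U G,
     (if blocked (snd (snd p)) zs G then {||}
      else (\<lambda>G'. {|Imp zs U G'|}) |`| combine G ((\<lambda>s. s (state_under p zs U)) |`| (succs S |`| G)))
     |\<union>| scope_succs zs G |\<union>| split_succs zs U G))"

definition steps :: "sig \<Rightarrow> state \<Rightarrow> formula \<Rightarrow> formula fset" where
  "steps S p G = combine G ((\<lambda>C. succs S C p) |`| G)"

lemma fst_succs [simp]: "fst (succs S C p) = C"
  by (cases C) auto

lemma steps_iff: "H |\<in>| steps S p G \<longleftrightarrow>
  (\<exists>C K. C |\<in>| G \<and> K |\<in>| snd (succs S C p) \<and> (H = K |\<union>| G \<or> H = K |\<union>| (G |-| {|C|})))"
proof -
  have "succs S C p = (C, snd (succs S C p))" for C by (simp add: prod_eq_iff)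
  then show ?thesis unfolding steps_def combine_def by (auto split: prod.split) (metis prod.inject)+
qed

lemma succs_Imp: "snd (succs S (Imp zs U G) p) =
    (if blocked (snd (snd p)) zs G then {||} else (\<lambda>G'. {|Imp zs U G'|}) |`| steps S (state_under p zs U) G)
    |\<union>| scope_succs zs G |\<union>| split_succs zs U G"
  by (simp add: steps_def fset.map_comp comp_def)

lemma blocked_iff: "blocked ys zs G \<longleftrightarrow>
  (\<exists>P. \<exists>y \<in> set ys. G = {|Atom P (apps (Var (y + length zs)) (bvars zs))|})"
proof -
  have *: "(case A of Atom P t \<Rightarrow> G = {|A|} \<and> t = u | Imp _ _ _ \<Rightarrow> False) \<longleftrightarrow> (\<exists>P. A = Atom P u \<and> G = {|A|})" for A u
    by (cases A) auto
  show ?thesis unfolding blocked_def * by (auto simp: fset_of_list.rep_eq)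
qed

lemma steps_sound_aux:
  assumes "C |\<in>| G" "rew S \<Gamma> V ys {|C|} K"
  shows "rew S \<Gamma> V ys G (K |\<union>| G)" "rew S \<Gamma> V ys G (K |\<union>| (G |-| {|C|}))"
proof -
  have "{|C|} |\<union>| G = G" "{|C|} |\<union>| (G |-| {|C|}) = G" using assms(1) by auto
  then show "rew S \<Gamma> V ys G (K |\<union>| G)" "rew S \<Gamma> V ys G (K |\<union>| (G |-| {|C|}))"
    using rew_and[OF assms(2), of G] rew_and[OF assms(2), of "G |-| {|C|}"] by simp_all
qed

lemma succs_Atom_cases:
  assumes "K |\<in>| snd (succs S (Atom P t) (\<Gamma>, V, ys))"
  obtains (refl) x where "t = Var x" "Atom P t |\<in>| V" "K = {||}"
  | (step) xs U f ss where "t = apps f ss" "clause xs U P f |\<in>| V" "is_head f" "length ss = length xs"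
      "K = subst (inst ss) U"
  | (assm) y xs zs U f ss where "t = apps (Var y) ss" "y \<in> set ys" "clause (xs @ zs) U P f |\<in>| V" "is_head f"
      "list_all2 (has_ty S \<Gamma>) ss zs"
      "K = subst (inst ss) (restrict xs zs U) |\<union>| {|clause zs (restrict xs zs U) P (Var y)|}"
proof -
  obtain f ss where f: "spine t = (f, ss)" by fastforce
  then have t: "t = apps f ss" using apps_spine[of t] by simp
  consider "K |\<in>| refl_succs V P t" | "K |\<in>| step_succs V P t" | "K |\<in>| assm_succs S (\<Gamma>, V, ys) P t"
    using assms by auto
  then show thesis
  proof cases
    case 1
    then show ?thesis by (auto simp: refl_succs_def intro: refl split: if_splits tm.splits)
  next
    case 2
    then obtain xs U C where "C |\<in>| V" "(xs, U, P, f) |\<in>| dest_clause C" "length ss = length xs" "K = subst (inst ss) U"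
      by (auto simp: step_succs_def f split: if_splits)
    then show ?thesis using t by (auto simp: dest_clause_iff intro: step)
  next
    case 3
    then obtain y xs zs U C h where *: "y \<in> set ys" "f = Var y" "C |\<in>| V" "(xs @ zs, U, P, h) |\<in>| dest_clause C"
      and ss: "list_all2 (has_ty S \<Gamma>) ss zs"
      and K: "K = subst (inst ss) (restrict xs zs U) |\<union>| {|clause zs (restrict xs zs U) P (Var y)|}"
      by (auto simp: assm_succs_def f splits_iff args_tys_iff fset_of_list.rep_eq split: if_splits)
    note h = *(4)[unfolded dest_clause_iff]
    have cl: "clause (xs @ zs) U P h |\<in>| V" using *(3) h by simp
    show ?thesis by (rule assm[OF t[unfolded *(2)] *(1) cl _ ss K]) (use h in blast)
  qed
qed

lemma succs_Imp_cases:
  assumes "K |\<in>| snd (succs S (Imp zs U G) (\<Gamma>, V, ys))"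
  obtains (imp) G' where "\<not> blocked ys zs G" "K = {|Imp zs U G'|}"
      "G' |\<in>| steps S (zs @ \<Gamma>, U |\<union>| lift (length zs) V, map (\<lambda>y. y + length zs) ys) G"
  | (scope) "G = lift (length zs) K"
  | (split) G1 G2 where "G = G1 |\<union>| G2" "K = {|Imp zs U G1, Imp zs U G2|}"
proof -
  consider (1) G' where "\<not> blocked ys zs G" "K = {|Imp zs U G'|}"
      "G' |\<in>| steps S (zs @ \<Gamma>, U |\<union>| lift (length zs) V, map (\<lambda>y. y + length zs) ys) G"
    | (2) "K |\<in>| scope_succs zs G" | (3) "K |\<in>| split_succs zs U G"
    using assms unfolding succs_Imp by (auto simp: state_under_def split: if_splits)
  then show thesis
  proof cases
    case 2
    then have "lift (length zs) K = G" by (auto simp: scope_succs_def split: if_splits)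
    then show ?thesis using scope by simp
  next
    case 3
    then obtain G1 G2 where "G1 |\<union>| G2 = G" "K = {|Imp zs U G1, Imp zs U G2|}"
      by (auto simp: split_succs_def split: if_splits)
    then show ?thesis using split by blast
  qed (rule imp)
qed

lemma succs_sound: "K |\<in>| snd (succs S C (\<Gamma>, V, ys)) \<Longrightarrow> rew S \<Gamma> V ys {|C|} K"
proof (induction C arbitrary: \<Gamma> V ys K)
  case (Atom P t)
  then show ?case
  proof (cases rule: succs_Atom_cases)
    case (refl x)
    then show ?thesis using rew_refl by simp
  next
    case (step xs U f ss)
    show ?thesis unfolding step(1,5) by (rule rew_step) (fact step)+
  next
    case (assm y xs zs U f ss)
    show ?thesis unfolding assm(1,6) by (rule rew_assm) (fact assm)+
  qed
next
  case (Imp zs U G)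
  let ?p = "(zs @ \<Gamma>, U |\<union>| lift (length zs) V, map (\<lambda>y. y + length zs) ys)"
  from Imp.prems show ?case
  proof (cases rule: succs_Imp_cases)
    case (imp G')
    then obtain C L where C: "C |\<in>| G" "L |\<in>| snd (succs S C ?p)" "G' = L |\<union>| G \<or> G' = L |\<union>| (G |-| {|C|})"
      unfolding steps_iff by blast
    then have "rew S (zs @ \<Gamma>) (U |\<union>| lift (length zs) V) (map (\<lambda>y. y + length zs) ys) G G'"
      using steps_sound_aux[OF C(1) Imp.IH(2)[OF C(1,2)]] by blast
    then show ?thesis using imp unfolding blocked_iff by (auto intro: rew_imp)
  qed (auto intro: rew_scope rew_imp_and)
qed

text \<open>Nested uses of (AndL) and (AndR) collapse to a single one: a step rewrites one conjunct
  by another rule, and all contexts merge into the remaining set.\<close>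

lemma steps_correct: "rew S \<Gamma> V ys G H \<longleftrightarrow> H |\<in>| steps S (\<Gamma>, V, ys) G"
proof
  have single: "H |\<in>| steps S p {|C|}" if "H |\<in>| snd (succs S C p)" for p C H
    using that unfolding steps_iff by fastforce
  assume "rew S \<Gamma> V ys G H"
  then show "H |\<in>| steps S (\<Gamma>, V, ys) G"
  proof induction
    case (rew_refl P x V \<Gamma> ys)
    then show ?case by (intro single) (simp add: refl_succs_def)
  next
    case (rew_step xs U P f V ss \<Gamma> ys)
    then have "(xs, U, P, f) |\<in>| dest_clause (clause xs U P f)" by (simp add: dest_clause_iff)
    then have "subst (inst ss) U |\<in>| step_succs V P (apps f ss)"
      using rew_step by (fastforce simp: step_succs_def spine_apps)
    then show ?case by (intro single) simp
  next
    case (rew_assm y ys xs zs U P f V \<Gamma> ss)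
    then have "(xs @ zs, U, P, f) |\<in>| dest_clause (clause (xs @ zs) U P f)" "(xs, zs) |\<in>| splits (xs @ zs)"
      by (simp_all add: dest_clause_iff splits_iff)
    then have "subst (inst ss) (restrict xs zs U) |\<union>| {|clause zs (restrict xs zs U) P (Var y)|}
      |\<in>| assm_succs S (\<Gamma>, V, ys) P (apps (Var y) ss)"
      using rew_assm unfolding assm_succs_def
      by (fastforce simp: spine_apps args_tys_iff fset_of_list.rep_eq)
    then show ?case by (intro single) simp
  next
    case (rew_and \<Gamma> V ys G G' H)
    then obtain C K where C: "C |\<in>| G" "K |\<in>| snd (succs S C (\<Gamma>, V, ys))" and
      "G' = K |\<union>| G \<or> G' = K |\<union>| (G |-| {|C|})" unfolding steps_iff by blast
    moreover have "K |\<union>| G |\<union>| H = K |\<union>| (G |\<union>| H)" by auto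
    \<comment> \<open>A conjunct removed from \<open>G\<close> comes back if the added context
      contains it as well.\<close>
    moreover have "K |\<union>| (G |-| {|C|}) |\<union>| H = K |\<union>| (G |\<union>| H)" if "C |\<in>| H" using that by auto
    moreover have "K |\<union>| (G |-| {|C|}) |\<union>| H = K |\<union>| ((G |\<union>| H) |-| {|C|})" if "C |\<notin>| H" using that by auto
    ultimately have "G' |\<union>| H = K |\<union>| (G |\<union>| H) \<or> G' |\<union>| H = K |\<union>| ((G |\<union>| H) |-| {|C|})"
      by metis
    then show ?case using C unfolding steps_iff by blast
  next
    case (rew_imp zs \<Gamma> U V ys G G')
    then show ?case by (intro single) (simp add: succs_Imp blocked_iff state_under_def del: succs.simps)
  next
    case (rew_scope \<Gamma> V ys zs U G)
    then show ?case by (intro single) (simp add: succs_Imp scope_succs_def del: succs.simps)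
  next
    case (rew_imp_and \<Gamma> V ys zs U G H)
    have "{|Imp zs U G, Imp zs U H|} |\<in>| split_succs zs U (G |\<union>| H)"
      unfolding split_succs_def fmember_fbind
      by (rule exI[of _ G], intro conjI, force, rule exI[of _ H], auto)
    then show ?case by (intro single) (simp add: succs_Imp del: succs.simps)
  qed
next
  assume "H |\<in>| steps S (\<Gamma>, V, ys) G"
  then obtain C K where C: "C |\<in>| G" "K |\<in>| snd (succs S C (\<Gamma>, V, ys))" "H = K |\<union>| G \<or> H = K |\<union>| (G |-| {|C|})"
    unfolding steps_iff by blast
  then show "rew S \<Gamma> V ys G H"
    using steps_sound_aux[OF C(1) succs_sound[OF C(2)]] by metis
qed

lemma cmp_combine [cmp_intros]: "cmp G \<Longrightarrow> cmp T \<Longrightarrow> cmp (\<lambda>x. combine (G x) (T x))"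
proof -
  assume 1: "cmp G" and 2: "cmp T"
  show ?thesis unfolding combine_def by (intro cmp_intros 1 2 cmp_comp[OF 1])
qed

lemma cmp_succs [cmp_intros]:
  assumes S: "finite (dom S)" and C: "cmp C" and p: "cmp p"
  shows "cmp (\<lambda>x. succs S (C x) (p x))"
proof (rule cmp_fm_rec[of "\<lambda>p C. succs S C p" "\<lambda>p P t. (Atom P t,
     refl_succs (fst (snd p)) P t |\<union>| step_succs (fst (snd p)) P t |\<union>| assm_succs S p P t)"
     "\<lambda>p zs U G r r'. (Imp zs U G,
     (if blocked (snd (snd p)) zs G then {||} else (\<lambda>G'. {|Imp zs U G'|}) |`| combine G r')
     |\<union>| scope_succs zs G |\<union>| split_succs zs U G)" "\<lambda>p zs U. state_under p zs U"])
  show "succs S (Imp zs U G) p = (Imp zs U G,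
     (if blocked (snd (snd p)) zs G then {||} else (\<lambda>G'. {|Imp zs U G'|}) |`| combine G ((\<lambda>C. succs S C (state_under p zs U)) |`| G))
     |\<union>| scope_succs zs G |\<union>| split_succs zs U G)" for p zs U G
    by (simp add: fset.map_comp comp_def)
  show "cmp (\<lambda>(p, P, t). (Atom P t,
     refl_succs (fst (snd p)) P t |\<union>| step_succs (fst (snd p)) P t |\<union>| assm_succs S p P t))"
    unfolding refl_succs_def step_succs_def assm_succs_def by (intro cmp_intros S)
  show "cmp (\<lambda>(p :: state, zs, U, G, r :: (fm \<times> formula fset) fset, r'). (Imp zs U G,
     (if blocked (snd (snd p)) zs G then {||} else (\<lambda>G'. {|Imp zs U G'|}) |`| combine G r')
     |\<union>| scope_succs zs G |\<union>| split_succs zs U G))"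
    unfolding blocked_def scope_succs_def split_succs_def by (intro cmp_intros)
  show "cmp (\<lambda>(p, zs, U). state_under p zs U)"
    unfolding state_under_def by (intro cmp_intros)
qed (auto intro: C p)

lemma cmp_steps [cmp_intros]:
  assumes "finite (dom S)" and "cmp p" "cmp G"
  shows "cmp (\<lambda>x. steps S (p x) (G x))"
  unfolding steps_def by (intro cmp_intros assms cmp_comp[OF assms(2)])


section \<open>Renaming and rank\<close>

lemma fv_tm_lift [simp]: "fv_tm (lift_tm n t) = (\<lambda>i. i + n) ` fv_tm t"
  by (induction t) auto

lemma fv_tm_apps: "fv_tm (apps h ss) = fv_tm h \<union> (\<Union>s \<in> set ss. fv_tm s)"
  by (induction ss rule: rev_induct) auto

lemma fv_tm_bvars [simp]: "(\<Union>s \<in> set (bvars ts). fv_tm s) = {..<length ts}"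
  by (auto simp: bvars_def)

lemma subst_tm_apps: "subst_tm \<sigma> (apps h ss) = apps (subst_tm \<sigma> h) (map (subst_tm \<sigma>) ss)"
  by (induction ss rule: rev_induct) auto

lemma map_under_bvars [simp]: "map (subst_tm (under (length ts) \<sigma>)) (bvars ts) = bvars ts"
  by (auto simp: bvars_def under_def)

lemma clause_Imp: "\<not> (ts = [] \<and> U = {||}) \<Longrightarrow>
    clause ts U P h = Imp ts U {|Atom P (apps (lift_tm (length ts) h) (bvars ts))|}"
  unfolding clause_def Let_def by (simp only: if_False)

lemma clause_Nil [simp]: "clause [] {||} P h = Atom P h"
  by (simp add: clause_def)

lemma fv_fm_clause:
  assumes "fv U \<subseteq> {..<length ts}"
  shows "fv_fm (clause ts U P h) = fv_tm h"
proof (cases "ts = [] \<and> U = {||}")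
  case False
  then have "fv_fm (clause ts U P h) = {i. i + length ts \<in> fv U \<union> fv_tm (apps (lift_tm (length ts) h) (bvars ts))}"
    by (auto simp: clause_Imp)
  then show ?thesis using assms by (auto simp: fv_tm_apps)
qed simp

lemma subst_fm_clause:
  "subst_fm (clause ts U P h) \<sigma> = clause ts (subst (under (length ts) \<sigma>) U) P (subst_tm \<sigma> h)"
proof (cases "ts = [] \<and> U = {||}")
  case False
  then have "ts \<noteq> [] \<or> subst (under (length ts) \<sigma>) U \<noteq> {||}" by (auto simp: subst_def)
  then show ?thesis using False by (auto simp: clause_Imp subst_tm_apps subst_tm_under_lift)
qed simp

lemma subst_closed: "fv U \<subseteq> {..<n} \<Longrightarrow> subst (under n \<sigma>) U = U"
  using subst_cong[of U "under n \<sigma>" Var] by (simp add: under_def subset_iff)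

lemma subst_fm_closed_clause:
  "fv U \<subseteq> {..<length ts} \<Longrightarrow> subst_fm (clause ts U P h) \<sigma> = clause ts U P (subst_tm \<sigma> h)"
  by (simp add: subst_fm_clause subst_closed)

definition up :: "nat \<Rightarrow> (nat \<Rightarrow> nat) \<Rightarrow> nat \<Rightarrow> nat" where
  "up n r i = (if i < n then i else r (i - n) + n)"

lemma under_ren: "under n (\<lambda>i. Var (r i)) = (\<lambda>i. Var (up n r i))"
  by (auto simp: under_def up_def)

lemma inj_up: "inj r \<Longrightarrow> inj (up n r)"
proof (rule injI)
  fix i j assume r: "inj r" and "up n r i = up n r j"
  then have "(i < n \<and> i = j) \<or> (\<not> i < n \<and> \<not> j < n \<and> r (i - n) = r (j - n))" by (auto simp: up_def split: if_splits)
  then show "i = j" using r by (auto dest!: injD)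
qed

lemma fv_tm_ren: "fv_tm (subst_tm (\<lambda>i. Var (r i)) t) = r ` fv_tm t"
  by (induction t) auto

lemma fv_fm_ren: "fv_fm (subst_fm C (\<lambda>i. Var (r i))) = r ` fv_fm C"
proof (induction C arbitrary: r)
  case (Imp zs U G)
  have X: "fv (subst (\<lambda>i. Var (up (length zs) r i)) X) = up (length zs) r ` fv X" if "X = U \<or> X = G" for X
    using that Imp.IH unfolding fv_def subst_def image_UN by auto
  have "{i. i + n \<in> up n r ` A} = r ` {i. i + n \<in> A}" for n A
  proof (intro set_eqI iffI; clarsimp)
    fix i j assume *: "i + n = up n r j" "j \<in> A"
    then have "\<not> j < n" by (auto simp: up_def)
    then have "j - n + n \<in> A" "i = r (j - n)" using * by (auto simp: up_def)
    then show "i \<in> r ` {i. i + n \<in> A}" by blast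
  next
    fix i assume "i + n \<in> A"
    moreover have "r i + n = up n r (i + n)" by (simp add: up_def)
    ultimately show "r i + n \<in> up n r ` A" by blast
  qed
  then show ?case by (simp add: under_ren X flip: image_Un)
qed (simp add: fv_tm_ren)

lemma restrict_ren:
  "restrict xs zs (subst (under (length (xs @ zs)) (\<lambda>i. Var (r i))) U) =
   subst (under (length zs) (\<lambda>i. Var (r i))) (restrict xs zs U)"
\<comment> \<open>Indices below \<open>length xs\<close> are lowered to 0, which a renaming under
  the binder of \<open>zs\<close> leaves fixed only if \<open>zs\<close> is nonempty. For empty
  \<open>zs\<close> nothing passes the filter.\<close>
proof (cases "zs = []")
  case True
  then show ?thesis by (simp add: restrict_def)
next
  case False
  let ?n = "length xs" and ?m = "length zs"
  let ?I = "{?n..<?n + ?m}"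
  have filter_image: "ffilter P (f |`| U) = f |`| ffilter P U" if "\<And>C. P (f C) \<longleftrightarrow> P C" for P and f :: "fm \<Rightarrow> fm"
    using that by auto
  have "up (?n + ?m) r ` A \<inter> ?I \<noteq> {} \<longleftrightarrow> A \<inter> ?I \<noteq> {}" for A
    by (auto simp: up_def split: if_splits)
  then have "ffilter (\<lambda>C. fv_fm C \<inter> ?I \<noteq> {}) ((\<lambda>C. subst_fm C (\<lambda>i. Var (up (?n + ?m) r i))) |`| U) =
    (\<lambda>C. subst_fm C (\<lambda>i. Var (up (?n + ?m) r i))) |`| ffilter (\<lambda>C. fv_fm C \<inter> ?I \<noteq> {}) U"
    by (intro filter_image) (simp only: fv_fm_ren)
  then show ?thesis
    using False unfolding restrict_def under_ren length_append
    by (simp add: subst_def fset.map_comp comp_def subst_fm_comp)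
      (intro fimage_cong refl subst_fm_cong, auto simp: up_def)
qed

lemma subst_inst_ren:
  assumes "length ss = n"
  shows "subst (inst (map (subst_tm \<sigma>) ss)) (subst (under n \<sigma>) U) = subst \<sigma> (subst (inst ss) U)"
proof -
  have "subst_tm (inst (map (subst_tm \<sigma>) ss)) (under n \<sigma> i) = subst_tm \<sigma> (inst ss i)" for i
    using assms by (auto simp: under_def inst_def lift_tm_def subst_tm_comp)
  then show ?thesis by (simp add: subst_comp)
qed

lemma inj_subst_ren:
  assumes "inj r" "subst (\<lambda>i. Var (r i)) G = subst (\<lambda>i. Var (r i)) H"
  shows "G = H"
proof -
  have "subst (\<lambda>i. Var (inv r i)) (subst (\<lambda>i. Var (r i)) X) = X" for X
    using assms(1) by (simp add: subst_comp)
  then show ?thesis using assms(2) by metis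
qed

lemma subst_under_lift: "subst (under n \<sigma>) (lift n G) = lift n (subst \<sigma> G)"
  by (simp add: lift_def subst_comp under_def lift_tm_def subst_tm_comp)

lemma has_ty_ren:
  assumes "has_ty S \<Gamma> t a" "\<And>i. i < length \<Gamma> \<Longrightarrow> r i < length \<Gamma>' \<and> \<Gamma>' ! r i = \<Gamma> ! i"
  shows "has_ty S \<Gamma>' (subst_tm (\<lambda>i. Var (r i)) t) a"
  using assms by (induction t arbitrary: a) (auto simp: has_ty_simps)

lemma subst_mono: "G |\<subseteq>| H \<Longrightarrow> subst \<sigma> G |\<subseteq>| subst \<sigma> H"
  unfolding subst_def by auto

text \<open>Injectivity protects the side condition of (Imp): identifying variables could turn a
  conclusion into a blocked one. Allowing a larger context and a larger set of clauses yields both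
  lifting below a binder and monotonicity in \<open>V\<close>.\<close>

lemma rew_ren:
  assumes "rew S \<Gamma> V ys G H" "inj r"
    and "\<And>i. i < length \<Gamma> \<Longrightarrow> r i < length \<Gamma>' \<and> \<Gamma>' ! r i = \<Gamma> ! i"
    and "subst (\<lambda>i. Var (r i)) V |\<subseteq>| V'"
  shows "rew S \<Gamma>' V' (map r ys) (subst (\<lambda>i. Var (r i)) G) (subst (\<lambda>i. Var (r i)) H)"
  using assms
proof (induction arbitrary: r \<Gamma>' V')
  case (rew_refl P x V \<Gamma> ys)
  then have "Atom P (Var (r x)) |\<in>| V'" by (force simp: subst_def)
  then show ?case by (auto intro: rew.rew_refl)
next
  case (rew_step xs U P f V ss \<Gamma> ys)
  let ?\<sigma> = "\<lambda>i. Var (r i)"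
  have 1: "clause xs (subst (under (length xs) ?\<sigma>) U) P (subst_tm ?\<sigma> f) |\<in>| V'"
    using rew_step(1,6) by (force simp: subst_def subst_fm_clause)
  have 2: "is_head (subst_tm ?\<sigma> f)" using rew_step(2) by (auto simp: is_head_def)
  have 3: "length (map (subst_tm ?\<sigma>) ss) = length xs" using rew_step(3) by simp
  from rew.rew_step[OF 1 2 3, of S \<Gamma>' "map r ys"] show ?case
    by (simp add: subst_tm_apps subst_inst_ren rew_step(3))
next
  case (rew_assm y ys xs zs U P f V \<Gamma> ss)
  let ?\<sigma> = "\<lambda>i. Var (r i)"
  have 1: "clause (xs @ zs) (subst (under (length (xs @ zs)) ?\<sigma>) U) P (subst_tm ?\<sigma> f) |\<in>| V'"
    using rew_assm(2,7) by (force simp: subst_def subst_fm_clause)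
  have 2: "is_head (subst_tm ?\<sigma> f)" using rew_assm(3) by (auto simp: is_head_def)
  have 3: "list_all2 (has_ty S \<Gamma>') (map (subst_tm ?\<sigma>) ss) zs"
    using rew_assm(4) has_ty_ren[OF _ rew_assm(6)] by (auto simp: list_all2_conv_all_nth)
  have 4: "r y \<in> set (map r ys)" using rew_assm(1) by simp
  have 5: "length ss = length zs" using rew_assm(4) by (rule list_all2_lengthD)
  from rew.rew_assm[OF 4 1 2 3] show ?case
    unfolding restrict_ren by (simp add: subst_tm_apps subst_inst_ren 5 subst_fm_clause)
next
  case (rew_and \<Gamma> V ys G G' H)
  from rew_and.IH[OF rew_and.prems] show ?case by (auto intro: rew.rew_and)
next
  case (rew_imp zs \<Gamma> U V ys G G')
  let ?n = "length zs"
  let ?r = "up ?n r"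
  let ?\<sigma> = "\<lambda>i. Var (?r i)"
  have 1: "?r i < length (zs @ \<Gamma>') \<and> (zs @ \<Gamma>') ! ?r i = (zs @ \<Gamma>) ! i" if "i < length (zs @ \<Gamma>)" for i
  proof (cases "i < ?n")
    case False
    then have "i - ?n < length \<Gamma>" using that by auto
    from rew_imp.prems(2)[OF this] show ?thesis using False by (auto simp: up_def nth_append)
  qed (auto simp: up_def nth_append)
  have 2: "subst ?\<sigma> (U |\<union>| lift ?n V) |\<subseteq>| subst ?\<sigma> U |\<union>| lift ?n V'"
  proof -
    have "subst ?\<sigma> (lift ?n V) = lift ?n (subst (\<lambda>i. Var (r i)) V)"
      using subst_under_lift[of ?n "\<lambda>i. Var (r i)" V] by (simp add: under_ren)
    also have "\<dots> |\<subseteq>| lift ?n V'" unfolding lift_def by (intro subst_mono rew_imp.prems)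
    finally show ?thesis by auto
  qed
  have 3: "map ?r (map (\<lambda>y. y + ?n) ys) = map (\<lambda>y. y + ?n) (map r ys)" by (auto simp: up_def)
  have "rew S (zs @ \<Gamma>') (subst ?\<sigma> U |\<union>| lift ?n V') (map (\<lambda>y. y + ?n) (map r ys)) (subst ?\<sigma> G) (subst ?\<sigma> G')"
    using rew_imp.IH[OF inj_up[OF rew_imp.prems(1)] 1 2] unfolding 3 .
  moreover have "\<not> (\<exists>P. \<exists>y \<in> set (map r ys). subst ?\<sigma> G = {|Atom P (apps (Var (y + ?n)) (bvars zs))|})"
  proof
    assume "\<exists>P. \<exists>y \<in> set (map r ys). subst ?\<sigma> G = {|Atom P (apps (Var (y + ?n)) (bvars zs))|}"
    then obtain P y where y: "y \<in> set ys" "subst ?\<sigma> G = {|Atom P (apps (Var (r y + ?n)) (bvars zs))|}" by auto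
    have "map (subst_tm ?\<sigma>) (bvars zs) = bvars zs"
      using map_under_bvars[of zs "\<lambda>i. Var (r i)"] by (simp add: under_ren)
    then have "subst ?\<sigma> G = subst ?\<sigma> {|Atom P (apps (Var (y + ?n)) (bvars zs))|}"
      using y(2) by (simp add: subst_tm_apps up_def)
    then have "G = {|Atom P (apps (Var (y + ?n)) (bvars zs))|}"
      by (rule inj_subst_ren[OF inj_up[OF rew_imp.prems(1)]])
    then show False using y(1) rew_imp.hyps by blast
  qed
  ultimately show ?case by (simp add: under_ren rew.rew_imp)
next
  case (rew_scope \<Gamma> V ys zs U G)
  show ?case by (simp add: subst_under_lift rew.rew_scope)
next
  case (rew_imp_and \<Gamma> V ys zs U G H)
  show ?case by (simp add: rew.rew_imp_and)
qed

lemma rew_lift: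
  assumes "rew S \<Gamma> V ys G H"
  shows "rew S (zs @ \<Gamma>) (U |\<union>| lift (length zs) V) (map (\<lambda>y. y + length zs) ys) (lift (length zs) G) (lift (length zs) H)"
  unfolding lift_def using assms by (rule rew_ren) (auto simp: inj_def nth_append)

lemma rew_mono:
  assumes "rew S \<Gamma> V ys G H" "V |\<subseteq>| V'"
  shows "rew S \<Gamma> V' ys G H"
  using rew_ren[OF assms(1), of "\<lambda>i. i" \<Gamma> V'] assms(2) by simp

section \<open>Types and the rank of a term\<close>

lemma has_ty_det: "has_ty S \<Gamma> t a \<Longrightarrow> has_ty S \<Gamma> t b \<Longrightarrow> a = b"
proof (induction t arbitrary: a b)
  case (App u v)
  then obtain c d where "has_ty S \<Gamma> u (Fun c a)" "has_ty S \<Gamma> u (Fun d b)" by (auto simp: has_ty_simps)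
  from App.IH(1)[OF this] show ?case by simp
qed (auto simp: has_ty_simps)

lemma fun_ty_simps [simp]: "fun_ty [] = Iota" "fun_ty (t # ts) = Fun t (fun_ty ts)"
  by (auto simp: fun_ty_def)

lemma fun_ty_inj: "fun_ty ts = fun_ty us \<Longrightarrow> ts = us"
proof (induction ts arbitrary: us)
  case Nil
  then show ?case by (cases us) auto
next
  case (Cons t ts)
  then show ?case by (cases us) auto
qed

lemma has_ty_apps:
  "has_ty S \<Gamma> (apps h ss) a \<longleftrightarrow> (\<exists>ts. list_all2 (has_ty S \<Gamma>) ss ts \<and> has_ty S \<Gamma> h (foldr Fun ts a))"
proof (induction ss arbitrary: h)
  case (Cons s ss)
  show ?case
  proof
    assume "has_ty S \<Gamma> (apps h (s # ss)) a"
    then obtain ts t where "list_all2 (has_ty S \<Gamma>) ss ts" "has_ty S \<Gamma> h (Fun t (foldr Fun ts a))" "has_ty S \<Gamma> s t"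
      by (auto simp: Cons has_ty_simps)
    then show "\<exists>ts. list_all2 (has_ty S \<Gamma>) (s # ss) ts \<and> has_ty S \<Gamma> h (foldr Fun ts a)"
      by (intro exI[of _ "t # ts"]) auto
  qed (auto simp: Cons has_ty_simps list_all2_Cons1, blast)
qed simp

text \<open>This is the order of a simple type.\<close>

primrec depth :: "ty \<Rightarrow> nat" where
  "depth Iota = 0"
| "depth (Fun a b) = max (Suc (depth a)) (depth b)"

text \<open>The rank bounds the depths of the types of the head and, strictly, the ranks of the arguments;
  hence instantiating a clause and applying an argument to fresh variables lowers it.\<close>

primrec rank :: "sig \<Rightarrow> ctxt \<Rightarrow> tm \<Rightarrow> nat" where
  "rank S \<Gamma> (Var i) = depth (\<Gamma> ! i)"
| "rank S \<Gamma> (Sym c) = depth (the (S c))"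
| "rank S \<Gamma> (App u v) = max (rank S \<Gamma> u) (Suc (rank S \<Gamma> v))"

lemma rank_lift [simp]: "rank S (zs @ \<Gamma>) (lift_tm (length zs) t) = rank S \<Gamma> t"
  by (induction t) (auto simp: nth_append)

lemma depth_le_rank: "has_ty S \<Gamma> t a \<Longrightarrow> depth a \<le> rank S \<Gamma> t"
proof (induction t arbitrary: a)
  case (App u v)
  then obtain b where "has_ty S \<Gamma> u (Fun b a)" by (auto simp: has_ty_simps)
  from App.IH(1)[OF this] show ?case by (simp add: max.coboundedI1)
qed (auto simp: has_ty_simps)

lemma rank_apps_less: "s \<in> set ss \<Longrightarrow> rank S \<Gamma> s < rank S \<Gamma> (apps h ss)"
  by (induction ss rule: rev_induct) auto

lemma rank_apps_le: "rank S \<Gamma> h \<le> m \<Longrightarrow> (\<And>s. s \<in> set ss \<Longrightarrow> rank S \<Gamma> s < m) \<Longrightarrow> rank S \<Gamma> (apps h ss) \<le> m"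
  by (induction ss rule: rev_induct) (auto simp: Suc_le_eq)

lemma depth_fun_ty: "t \<in> set ts \<Longrightarrow> depth t < depth (fun_ty ts)"
  by (induction ts) auto

text \<open>The fresh variables have the argument types of the type of \<open>s\<close>, and these
  are of strictly smaller depth than that type, whose depth is bounded by the rank of
  \<open>s\<close>. The strict descent comes from \<open>s\<close> being an argument of the
  rewritten atom.\<close>

lemma rank_apply_bvars:
  assumes "has_ty S \<Gamma> s (fun_ty ts)"
  shows "rank S (ts @ \<Gamma>) (apps (lift_tm (length ts) s) (bvars ts)) \<le> rank S \<Gamma> s"
proof (rule rank_apps_le)
  fix v assume "v \<in> set (bvars ts)"
  then obtain i where "i < length ts" "v = Var i" by (auto simp: bvars_def)
  then have "rank S (ts @ \<Gamma>) v < depth (fun_ty ts)" by (simp add: nth_append depth_fun_ty)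
  then show "rank S (ts @ \<Gamma>) v < rank S \<Gamma> s" using depth_le_rank[OF assms] by simp
qed simp

lemma has_ty_lift: "has_ty S \<Gamma> t a \<Longrightarrow> has_ty S (zs @ \<Gamma>) (lift_tm (length zs) t) a"
  unfolding lift_tm_def by (erule has_ty_ren) (auto simp: nth_append)

lemma has_ty_apply_bvars:
  assumes "has_ty S \<Gamma> s (fun_ty ts)"
  shows "has_ty S (ts @ \<Gamma>) (apps (lift_tm (length ts) s) (bvars ts)) Iota"
  unfolding has_ty_apps using has_ty_lift[OF assms, of ts]
  by (intro exI[of _ ts]) (auto simp: fun_ty_def list_all2_conv_all_nth bvars_def has_ty_simps nth_append)


section \<open>Reachability\<close>

text \<open>The flag tells whether the head may be a function symbol.  It may not in the bodies of clauses,
  where a symbol would break the descent of the rank.\<close>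

inductive typed_clause :: "sig \<Rightarrow> ctxt \<Rightarrow> bool \<Rightarrow> fm \<Rightarrow> bool" for S :: sig where
  "is_head h \<Longrightarrow> b \<or> (\<exists>x. h = Var x) \<Longrightarrow> has_ty S \<Gamma> h (fun_ty ts) \<Longrightarrow> (ts = [] \<longrightarrow> U = {||}) \<Longrightarrow>
    (\<forall>C \<in> fset U. typed_clause S ts False C) \<Longrightarrow> typed_clause S \<Gamma> b (clause ts U P h)"

lemma typed_clauseE:
  assumes "typed_clause S \<Gamma> b C"
  obtains ts U P h where "C = clause ts U P h" "is_head h" "b \<or> (\<exists>x. h = Var x)" "has_ty S \<Gamma> h (fun_ty ts)"
    "ts = [] \<longrightarrow> U = {||}" "\<forall>C \<in> fset U. typed_clause S ts False C"
  using assms by (cases rule: typed_clause.cases) blast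

lemma clause_inj:
  assumes "clause ts U P h = clause ts' U' P' h'" "is_head h" "is_head h'"
  shows "ts = ts' \<and> U = U' \<and> P = P' \<and> h = h'"
proof -
  have *: "(ts, U, P, h) |\<in>| dest_clause (clause ts' U' P' h')" using assms by (simp add: dest_clause_iff)
  show ?thesis
  proof (cases "ts' = [] \<and> U' = {||}")
    case True
    then show ?thesis using * assms(3) by (simp add: dest_clause_def)
  next
    case False
    then show ?thesis using * assms(3) by (simp add: clause_Imp dest_clause_def spine_apps)
  qed
qed

lemma typed_clause_fv: "typed_clause S \<Gamma> b C \<Longrightarrow> fv_fm C \<subseteq> {..<length \<Gamma>}"
proof (induction rule: typed_clause.induct)
  case (1 h b \<Gamma> ts U P)
  then have "fv U \<subseteq> {..<length ts}" by (auto simp: fv_def)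
  moreover have "fv_tm h \<subseteq> {..<length \<Gamma>}" using 1 by (auto simp: is_head_def has_ty_simps)
  ultimately show ?case by (simp add: fv_fm_clause)
qed

lemma typed_clauses_fv: "\<forall>C \<in> fset U. typed_clause S ts b C \<Longrightarrow> fv U \<subseteq> {..<length ts}"
  using typed_clause_fv unfolding fv_def by blast

lemma typed_clause_ren:
  assumes "typed_clause S \<Gamma> b C" "b \<longrightarrow> b'"
    "\<And>i. i < length \<Gamma> \<Longrightarrow> r i < length \<Gamma>' \<and> \<Gamma>' ! r i = \<Gamma> ! i"
  shows "typed_clause S \<Gamma>' b' (subst_fm C (\<lambda>i. Var (r i)))"
  using assms(1)
proof (cases rule: typed_clauseE)
  case (1 ts U P h)
  have "is_head (subst_tm (\<lambda>i. Var (r i)) h)" "b' \<or> (\<exists>x. subst_tm (\<lambda>i. Var (r i)) h = Var x)"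
    using 1 assms(2) by (auto simp: is_head_def)
  then show ?thesis
    unfolding 1(1) subst_fm_closed_clause[OF typed_clauses_fv[OF 1(6)]]
    using 1 has_ty_ren[OF _ assms(3)] by (intro typed_clause.intros) auto
qed

lemma typed_clause_lift:
  assumes "typed_clause S \<Gamma> b C"
  shows "typed_clause S (zs @ \<Gamma>) b (subst_fm C (\<lambda>i. Var (i + length zs)))"
  using assms by (rule typed_clause_ren) (auto simp: nth_append)

lemma typed_clause_weaken:
  assumes "typed_clause S \<Gamma> b C" "b \<longrightarrow> b'"
  shows "typed_clause S (\<Gamma> @ \<Delta>) b' C"
  using typed_clause_ren[OF assms, of "\<lambda>i. i" "\<Gamma> @ \<Delta>"] by (simp add: nth_append)

definition typed_clauses :: "sig \<Rightarrow> ctxt \<Rightarrow> formula \<Rightarrow> bool" where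
  "typed_clauses S \<Gamma> V \<longleftrightarrow> (\<forall>C \<in> fset V. typed_clause S \<Gamma> True C)"

lemma typed_clauses_under:
  assumes "typed_clauses S \<Gamma> V" "\<forall>C \<in> fset U. typed_clause S zs b C"
  shows "typed_clauses S (zs @ \<Gamma>) (U |\<union>| lift (length zs) V)"
  using assms typed_clause_weaken[of S zs b _ True \<Gamma>] typed_clause_lift
  by (auto simp: typed_clauses_def lift_def subst_def)

text \<open>The head is the only free variable of a clause with variable head, so a clause that
  passes the filter has its head among \<open>zs\<close> and can be lowered without changing its
  type.\<close>

lemma typed_restrict:
  assumes "\<forall>C \<in> fset U. typed_clause S (xs @ zs) False C" "C |\<in>| restrict xs zs U"
  shows "typed_clause S zs False C"
proof -
  obtain D where D: "D |\<in>| U" "fv_fm D \<inter> {length xs ..< length xs + length zs} \<noteq> {}"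
    "C = subst_fm D (\<lambda>i. Var (i - length xs))"
    using assms(2) by (auto simp: restrict_def subst_def)
  have "typed_clause S (xs @ zs) False D" using assms(1) D(1) by blast
  then obtain ts W P h where h: "D = clause ts W P h" "\<exists>x. h = Var x" "has_ty S (xs @ zs) h (fun_ty ts)"
    "ts = [] \<longrightarrow> W = {||}" "\<forall>C \<in> fset W. typed_clause S ts False C" by (rule typed_clauseE) auto
  then obtain x where x: "h = Var x" by blast
  have "fv_fm D = {x}" using h(1) x fv_fm_clause[OF typed_clauses_fv[OF h(5)]] by simp
  then have "length xs \<le> x" "x < length xs + length zs" using D(2) by auto
  moreover have "(xs @ zs) ! x = fun_ty ts" using h(3) x by (simp add: has_ty_simps)
  moreover have "C = clause ts W P (Var (x - length xs))"
    using D(3) h(1) x subst_fm_closed_clause[OF typed_clauses_fv[OF h(5)]] by simp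
  ultimately show ?thesis using h(4,5) by (auto intro!: typed_clause.intros simp: has_ty_simps nth_append)
qed

text \<open>The flag is \<open>True\<close> because \<open>zs\<close> may be empty, and automaton
  formulas over the empty environment concern function symbols.\<close>

inductive typed_goal :: "sig \<Rightarrow> ctxt \<Rightarrow> fm \<Rightarrow> bool" for S :: sig where
  typed_Atom: "has_ty S \<Gamma> t Iota \<Longrightarrow> typed_goal S \<Gamma> (Atom P t)"
| typed_Imp: "(\<forall>C \<in> fset U. typed_clause S zs True C) \<Longrightarrow> (\<forall>C \<in> fset G. typed_goal S (zs @ \<Gamma>) C) \<Longrightarrow>
    typed_goal S \<Gamma> (Imp zs U G)"

lemma mem_env: "(x, t) \<in> env \<Gamma> \<longleftrightarrow> x < length \<Gamma> \<and> t = \<Gamma> ! x"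
  by (auto simp: env_def)

lemma env_eq_empty [simp]: "env \<Gamma> = {} \<longleftrightarrow> \<Gamma> = []"
  by (auto simp: env_def)

text \<open>Conjunction joins empty environments only with empty ones, so a nonempty environment
  excludes clauses about symbols. Bodies of clauses have a nonempty prefix, which is why the flag is
  \<open>False\<close> there.\<close>

lemma automaton_typed:
  assumes "automaton S Pr \<Delta> U" "C |\<in>| U" "\<Delta> \<subseteq> env \<Gamma>" "b \<or> \<Delta> \<noteq> {}"
  shows "typed_clause S \<Gamma> b C"
  using assms
proof (induction arbitrary: C \<Gamma> b)
  case (aut_const P c)
  then show ?case using typed_clause.intros[of "Sym c" b S \<Gamma> "[]" "{||}" P] by (simp add: has_ty_simps)
next
  case (aut_var P x)
  then show ?case using typed_clause.intros[of "Var x" b S \<Gamma> "[]" "{||}" P] by (simp add: has_ty_simps mem_env)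
next
  case (aut_fun P ts U f)
  then show ?case by (auto intro!: typed_clause.intros simp: has_ty_simps)
next
  case (aut_app P ts U x)
  then show ?case by (auto intro!: typed_clause.intros simp: has_ty_simps mem_env)
next
  case (aut_true \<Delta>)
  then show ?case by simp
next
  case (aut_and \<Delta>1 U \<Delta>2 V)
  then show ?case by (cases "C |\<in>| U") auto
qed

lemma automaton_formula_typed: "automaton_formula S Pr \<Gamma> V \<Longrightarrow> typed_clauses S \<Gamma> V"
  unfolding automaton_formula_def typed_clauses_def using automaton_typed by blast

lemma goal_fm_typed: "goal_fm S Pr \<Gamma> C \<Longrightarrow> typed_goal S \<Gamma> C"
proof (induction rule: goal_fm.induct)
  case (2 zs U G \<Gamma>)
  then show ?case using automaton_typed[of S Pr "env zs" U _ zs True] by (intro typed_Imp) auto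
qed (rule typed_Atom)

section \<open>Finite closed sets of conjuncts\<close>

definition closed_conjuncts :: "sig \<Rightarrow> state \<Rightarrow> fm set \<Rightarrow> bool" where
  "closed_conjuncts S p X \<longleftrightarrow> (\<forall>C \<in> X. \<forall>K. K |\<in>| snd (succs S C p) \<longrightarrow> fset K \<subseteq> X)"

definition finitary :: "sig \<Rightarrow> state \<Rightarrow> fm \<Rightarrow> bool" where
  "finitary S p C \<longleftrightarrow> (\<exists>X. finite X \<and> C \<in> X \<and> closed_conjuncts S p X)"

lemma closed_conjuncts_steps: "closed_conjuncts S p X \<Longrightarrow> fset G \<subseteq> X \<Longrightarrow> H |\<in>| steps S p G \<Longrightarrow> fset H \<subseteq> X"
  unfolding closed_conjuncts_def steps_iff by fastforce

lemma finitary_set: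
  assumes "\<And>C. C |\<in>| G \<Longrightarrow> finitary S p C"
  obtains X where "finite X" "fset G \<subseteq> X" "closed_conjuncts S p X"
proof -
  obtain X where X: "\<And>C. C |\<in>| G \<Longrightarrow> finite (X C) \<and> C \<in> X C \<and> closed_conjuncts S p (X C)"
    using assms unfolding finitary_def by metis
  show thesis
  proof (rule that)
    show "finite (\<Union>C \<in> fset G. X C)" using X by auto
    show "fset G \<subseteq> (\<Union>C \<in> fset G. X C)" using X by blast
    show "closed_conjuncts S p (\<Union>C \<in> fset G. X C)" using X unfolding closed_conjuncts_def by blast
  qed
qed

text \<open>The alternative \<open>C' = C\<close> is needed for (Assm) with an empty argument list,
  which reproduces the atom that it rewrites.\<close>

lemma finitary_step:
  assumes "\<And>K C'. K |\<in>| snd (succs S C p) \<Longrightarrow> C' |\<in>| K \<Longrightarrow> C' = C \<or> finitary S p C'"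
  shows "finitary S p C"
proof -
  obtain X where X: "finite X" "fset (ffUnion (snd (succs S C p)) |-| {|C|}) \<subseteq> X" "closed_conjuncts S p X"
    by (rule finitary_set[of "ffUnion (snd (succs S C p)) |-| {|C|}"]) (use assms in auto)
  have "closed_conjuncts S p (insert C X)"
    using X(2,3) unfolding closed_conjuncts_def by fastforce
  then show ?thesis unfolding finitary_def using X(1) by blast
qed

lemma finite_subformulas: "finite X \<Longrightarrow> finite {G :: formula. fset G \<subseteq> X}"
proof -
  assume "finite X"
  have "inj_on fset {G. fset G \<subseteq> X}" by (auto simp: inj_on_def fset_inject)
  moreover have "fset ` {G. fset G \<subseteq> X} \<subseteq> Pow X" by auto
  ultimately show ?thesis using \<open>finite X\<close> by (meson finite_Pow_iff finite_imageD finite_subset)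
qed

lemma inj_lift_fm: "inj (\<lambda>C. subst_fm C (\<lambda>i. Var (i + n)))"
proof (rule injI)
  fix C D assume "subst_fm C (\<lambda>i. Var (i + n)) = subst_fm D (\<lambda>i. Var (i + n))"
  then have "subst (\<lambda>i. Var (i + n)) {|C|} = subst (\<lambda>i. Var (i + n)) {|D|}" by simp
  then have "{|C|} = {|D|}" by (rule inj_subst_ren[rotated]) (auto simp: inj_def)
  then show "C = D" by simp
qed

lemma finitary_Imp:
  assumes "\<And>C. C |\<in>| G \<Longrightarrow> finitary S (zs @ \<Gamma>, U |\<union>| lift (length zs) V, map (\<lambda>y. y + length zs) ys) C"
  shows "finitary S (\<Gamma>, V, ys) (Imp zs U G)"
proof -
  let ?n = "length zs" and ?p' = "(zs @ \<Gamma>, U |\<union>| lift (length zs) V, map (\<lambda>y. y + length zs) ys)"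
  let ?l = "\<lambda>C. subst_fm C (\<lambda>i. Var (i + ?n))"
  obtain X where X: "finite X" "fset G \<subseteq> X" "closed_conjuncts S ?p' X"
    using assms by (rule finitary_set)
  \<comment> \<open>The first part follows the implication itself. The second contains what (Scope)
    releases together with all that comes from it; it is finite because lifting is
    injective.\<close>
  let ?Y = "Imp zs U ` {G. fset G \<subseteq> X} \<union> ?l -` X"
  have lift_sub: "fset (lift ?n K) \<subseteq> X \<longleftrightarrow> fset K \<subseteq> ?l -` X" for K by (auto simp: lift_def subst_def)
  have "finite ?Y" using X(1) finite_subformulas finite_vimageI[OF X(1) inj_lift_fm] by blast
  moreover have "Imp zs U G \<in> ?Y" using X(2) by blast
  moreover have "closed_conjuncts S (\<Gamma>, V, ys) ?Y"
    unfolding closed_conjuncts_def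
  proof (intro ballI allI impI)
    fix C K assume C: "C \<in> ?Y" and K: "K |\<in>| snd (succs S C (\<Gamma>, V, ys))"
    from C show "fset K \<subseteq> ?Y"
    proof
      assume "C \<in> Imp zs U ` {G. fset G \<subseteq> X}"
      then obtain G where G: "C = Imp zs U G" "fset G \<subseteq> X" by blast
      from K[unfolded G(1)] show ?thesis
      proof (cases rule: succs_Imp_cases)
        case (imp G')
        then have "fset G' \<subseteq> X" using closed_conjuncts_steps[OF X(3) G(2)] by blast
        then show ?thesis using imp(2) by auto
      next
        case scope
        then show ?thesis using G(2) lift_sub by blast
      next
        case (split G1 G2)
        then show ?thesis using G(2) by auto
      qed
    next
      assume C: "C \<in> ?l -` X"
      \<comment> \<open>A step of a released conjunct is mirrored below the binder, where
        \<open>X\<close> is already known to be closed.\<close>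
      have "rew S (zs @ \<Gamma>) (U |\<union>| lift ?n V) (map (\<lambda>y. y + ?n) ys) (lift ?n {|C|}) (lift ?n K)"
        by (intro rew_lift succs_sound K)
      then have "lift ?n K |\<in>| steps S ?p' (lift ?n {|C|})" by (simp add: steps_correct)
      moreover have "fset (lift ?n {|C|}) \<subseteq> X" using C by (simp add: lift_def)
      ultimately have "fset (lift ?n K) \<subseteq> X" using closed_conjuncts_steps[OF X(3)] by blast
      then show ?thesis using lift_sub by blast
    qed
  qed
  ultimately show ?thesis unfolding finitary_def by blast
qed

text \<open>Assumption clauses cannot be rewritten below their binder.\<close>

lemma finitary_blocked:
  assumes "zs \<noteq> []" "y \<in> set ys"
  shows "finitary S (\<Gamma>, V, ys) (Imp zs U {|Atom P (apps (Var (y + length zs)) (bvars zs))|})"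
    (is "finitary S ?p (Imp zs U {|?A|})")
proof -
  have "closed_conjuncts S ?p {Imp zs U {|?A|}, Imp zs U {||}}"
    unfolding closed_conjuncts_def
  proof (intro ballI allI impI)
    fix C K assume C: "C \<in> {Imp zs U {|?A|}, Imp zs U {||}}" and K: "K |\<in>| snd (succs S C ?p)"
    from C obtain G where G: "C = Imp zs U G" "G = {|?A|} \<or> G = {||}" by blast
    from K[unfolded G(1)] show "fset K \<subseteq> {Imp zs U {|?A|}, Imp zs U {||}}"
    proof (cases rule: succs_Imp_cases)
      case (imp G')
      have "blocked ys zs {|?A|}" using assms(2) unfolding blocked_iff by blast
      then have "G = {||}" using G(2) imp(1) by blast
      then show ?thesis using imp(3) by (simp add: steps_iff)
    next
      case scope
      \<comment> \<open>As \<open>zs\<close> is nonempty, the atom mentions a bound variable, so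
        (Scope) cannot release it; only the implication with conclusion \<open>true\<close> can be
        removed by that rule.\<close>
      have 1: "0 \<in> fv_fm ?A" using assms(1) by (auto simp: fv_tm_apps)
      have 2: "0 \<notin> fv_fm D" if "D |\<in>| lift (length zs) K" for D
        using that assms(1) by (auto simp: lift_def subst_def fv_fm_ren)
      have "G = {||}"
      proof (rule ccontr)
        assume "G \<noteq> {||}"
        then have "?A |\<in>| lift (length zs) K" using G(2) scope by auto
        then show False using 1 2 by blast
      qed
      then show ?thesis using scope by (simp add: lift_def subst_def)
    next
      case (split G1 G2)
      then have "G1 |\<subseteq>| {|?A|}" "G2 |\<subseteq>| {|?A|}" using G(2) by auto
      then have "G1 = {||} \<or> G1 = {|?A|}" "G2 = {||} \<or> G2 = {|?A|}" by (simp_all only: fsubset_fsingletonD)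
      then show ?thesis using split(2) by auto
    qed
  qed
  then show ?thesis unfolding finitary_def
    by (intro exI[of _ "{Imp zs U {|?A|}, Imp zs U {||}}"]) simp
qed

text \<open>Context, clauses and variables are generalised in the induction, because an argument of
  higher type is applied to fresh variables below a new binder, with the body of its clause as an
  additional assumption. (Step) and (Assm) both instantiate clause bodies, which is
  \<open>inst\<close>; the second summand of (Assm) is a blocked implication or the atom
  itself.\<close>

lemma finitary_Atom:
  assumes "typed_clauses S \<Gamma> V" "has_ty S \<Gamma> t Iota"
  shows "finitary S (\<Gamma>, V, ys) (Atom P t)"
  using assms
proof (induction "rank S \<Gamma> t" arbitrary: \<Gamma> V ys P t rule: less_induct)
  case less
  \<comment> \<open>A conjunct of \<open>U\<close> is headed by some variable \<open>x\<close> of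
    \<open>zs\<close>, so its instance is headed by the argument \<open>ss ! x\<close>: an atom
    about that argument if the prefix is empty, and otherwise an implication whose conclusion
    applies it to the prefix.\<close>
  have inst: "finitary S (\<Gamma>, V, ys) C"
    if U: "\<forall>C \<in> fset U. typed_clause S zs False C" and ss: "list_all2 (has_ty S \<Gamma>) ss zs"
      and rank: "\<And>s. s \<in> set ss \<Longrightarrow> rank S \<Gamma> s < rank S \<Gamma> t" and C: "C |\<in>| subst (inst ss) U" for U zs ss C
  proof -
    obtain D where D: "D |\<in>| U" "C = subst_fm D (inst ss)" using C by (auto simp: subst_def)
    have "typed_clause S zs False D" using U D(1) by blast
    then obtain ts W Q h where h: "D = clause ts W Q h" "\<exists>x. h = Var x" "has_ty S zs h (fun_ty ts)"
      "ts = [] \<longrightarrow> W = {||}" "\<forall>C \<in> fset W. typed_clause S ts False C" by (rule typed_clauseE) auto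
    then obtain x where x: "h = Var x" "x < length zs" "zs ! x = fun_ty ts" by (auto simp: has_ty_simps)
    let ?s = "ss ! x"
    have len: "length ss = length zs" using ss by (rule list_all2_lengthD)
    have s: "has_ty S \<Gamma> ?s (fun_ty ts)" "rank S \<Gamma> ?s < rank S \<Gamma> t"
      using x len list_all2_nthD2[OF ss, of x] by (auto intro: rank)
    have C': "C = clause ts W Q ?s"
      using D(2) h(1) x len subst_fm_closed_clause[OF typed_clauses_fv[OF h(5)]] by (simp add: inst_def)
    show ?thesis
    proof (cases "ts = []")
      case True
      then show ?thesis using less.hyps[OF s(2) less.prems(1)] s(1) h(4) C' by simp
    next
      case False
      let ?u = "apps (lift_tm (length ts) ?s) (bvars ts)"
      have "rank S (ts @ \<Gamma>) ?u < rank S \<Gamma> t" using rank_apply_bvars[OF s(1)] s(2) by simp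
      then have "finitary S (ts @ \<Gamma>, W |\<union>| lift (length ts) V, map (\<lambda>y. y + length ts) ys) (Atom Q ?u)"
        by (intro less.hyps typed_clauses_under[OF less.prems(1) h(5)] has_ty_apply_bvars s(1))
      then have "finitary S (\<Gamma>, V, ys) (Imp ts W {|Atom Q ?u|})" by (intro finitary_Imp) auto
      then show ?thesis using False C' by (simp add: clause_Imp)
    qed
  qed
  show ?case
  proof (rule finitary_step)
    fix K C' assume K: "K |\<in>| snd (succs S (Atom P t) (\<Gamma>, V, ys))" and C': "C' |\<in>| K"
    have V: "has_ty S \<Gamma> f (fun_ty xs) \<and> (\<forall>C \<in> fset U. typed_clause S xs False C)"
      if cl: "clause xs U P f |\<in>| V" "is_head f" for xs U f
    proof -
      have "typed_clause S \<Gamma> True (clause xs U P f)" using less.prems(1) cl(1) by (auto simp: typed_clauses_def)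
      then show ?thesis by (rule typed_clauseE) (use cl(2) clause_inj in blast)
    qed
    from K show "C' = Atom P t \<or> finitary S (\<Gamma>, V, ys) C'"
    proof (cases rule: succs_Atom_cases)
      case (refl x)
      then show ?thesis using C' by simp
    next
      case (step xs U f ss)
      obtain ts where ts: "list_all2 (has_ty S \<Gamma>) ss ts" "has_ty S \<Gamma> f (fun_ty ts)"
        using less.prems(2) unfolding step(1) has_ty_apps fun_ty_def by blast
      \<comment> \<open>(Step) compares lengths only. The argument types agree with the prefix
        because the head has a unique type and \<open>fun_ty\<close> is injective.\<close>
      have "ts = xs" using has_ty_det[OF ts(2)] V[OF step(2,3)] fun_ty_inj by blast
      then have "list_all2 (has_ty S \<Gamma>) ss xs" using ts(1) by simp
      then show ?thesis using inst[of U xs ss C'] V[OF step(2,3)] C' step(1,5) by (simp add: rank_apps_less)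
    next
      case (assm y xs zs U f ss)
      have U: "\<forall>C \<in> fset (restrict xs zs U). typed_clause S zs False C"
        using typed_restrict V[OF assm(3,4)] by blast
      from C'[unfolded assm(6)] consider "C' |\<in>| subst (inst ss) (restrict xs zs U)"
        | "C' = clause zs (restrict xs zs U) P (Var y)" by auto
      then show ?thesis
      proof cases
        case 1
        then show ?thesis using inst[OF U assm(5)] assm(1) by (simp add: rank_apps_less)
      next
        case 2
        show ?thesis
        proof (cases "zs = []")
          case True
          then show ?thesis using 2 assm(1,5) by (simp add: restrict_def)
        next
          case False
          then show ?thesis using 2 finitary_blocked[OF False assm(2)] by (simp add: clause_Imp)
        qed
      qed
    qed
  qed
qed

lemma finitary_goal: "typed_goal S \<Gamma> C \<Longrightarrow> typed_clauses S \<Gamma> V \<Longrightarrow> finitary S (\<Gamma>, V, ys) C"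
proof (induction arbitrary: V ys rule: typed_goal.induct)
  case (typed_Imp U zs G \<Gamma>)
  then show ?case by (intro finitary_Imp) (auto intro: typed_clauses_under)
qed (rule finitary_Atom)

lemma finite_reachable:
  assumes "\<forall>C \<in> fset G. typed_goal S \<Gamma> C" "typed_clauses S \<Gamma> V"
  shows "finite {H. rews S \<Gamma> V ys G H}"
proof -
  obtain X where X: "finite X" "fset G \<subseteq> X" "closed_conjuncts S (\<Gamma>, V, ys) X"
    by (rule finitary_set[of G S "(\<Gamma>, V, ys)"]) (use assms finitary_goal in auto)
  have "fset H \<subseteq> X" if "rews S \<Gamma> V ys G H" for H
    using that by induction (use X closed_conjuncts_steps[OF X(3)] in \<open>auto simp: steps_correct\<close>)
  then have "{H. rews S \<Gamma> V ys G H} \<subseteq> {H. fset H \<subseteq> X}" by blast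
  then show ?thesis using finite_subformulas[OF X(1)] by (rule finite_subset)
qed


section \<open>Decision procedure\<close>

lemma fst_prod_decode_le: "fst (prod_decode n) \<le> n"
  using le_prod_encode_1[of "fst (prod_decode n)" "snd (prod_decode n)"] by simp

lemma snd_prod_decode_le: "snd (prod_decode n) \<le> n"
  using le_prod_encode_2[of "snd (prod_decode n)" "fst (prod_decode n)"] by simp

lemma le_triangle: "n \<le> triangle n"
  by (induction n) auto

lemma snd_prod_decode_less: "fst (prod_decode n) \<noteq> 0 \<Longrightarrow> snd (prod_decode n) < n"
  using triangle_prod_decode[of n] le_triangle[of "fst (prod_decode n) + snd (prod_decode n)"] by linarith

text \<open>Minimisation needs a witness at every number, code or not. Total decoders turn any
  number into genuine syntax, on which validity can be tested before the search.\<close>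

function dec_ty :: "nat \<Rightarrow> ty" where
  "dec_ty n = (if n = 0 then Iota
     else Fun (dec_ty (fst (prod_decode (n - 1)))) (dec_ty (snd (prod_decode (n - 1)))))"
  by pat_completeness auto
termination
  by (relation "measure id")
    (auto intro: le_less_trans[OF fst_prod_decode_le] le_less_trans[OF snd_prod_decode_le])

declare dec_ty.simps [simp del]

lemma dec_ty_enc [simp]: "dec_ty (enc t) = t"
  by (induction t) (simp_all add: dec_ty.simps)

lemma get_graph: "y |\<in>| A \<Longrightarrow> pick (snd |`| ffilter (\<lambda>e. fst e = y) ((\<lambda>y. (y, F y)) |`| A)) = F y"
proof -
  assume "y |\<in>| A"
  then have "snd |`| ffilter (\<lambda>e. fst e = y) ((\<lambda>y. (y, F y)) |`| A) = {|F y|}" by force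
  then show ?thesis by simp
qed

lemma cmp_dec_ty: "cmp dec_ty"
proof (rule cmp_rec[where M = "\<lambda>n. n"])
  let ?l = "\<lambda>n. fst (prod_decode (n - 1))" and ?r = "\<lambda>n. snd (prod_decode (n - 1))"
  let ?D = "\<lambda>n. if n = 0 then {||} else {|?l n, ?r n|}"
  let ?get = "\<lambda>(g :: (nat \<times> ty) fset) y. pick (snd |`| ffilter (\<lambda>e. fst e = y) g)"
  let ?h = "\<lambda>(n, g). if n = 0 then Iota else Fun (?get g (?l n)) (?get g (?r n))"
  show "cmp ?D" "cmp ?h" "cmp (\<lambda>n::nat. n)" by (intro cmp_intros)+
  show "y < x" if "y |\<in>| ?D x" for x y
    using that fst_prod_decode_le[of "x - 1"] snd_prod_decode_le[of "x - 1"] by (auto split: if_splits)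
  show "dec_ty n = ?h (n, (\<lambda>y. (y, dec_ty y)) |`| ?D n)" for n
    by (subst dec_ty.simps) (auto simp: get_graph simp del: fimage_finsert)
qed

function dec_tm :: "nat \<Rightarrow> tm" where
  "dec_tm n = (if fst (prod_decode n) = 0 then Var (snd (prod_decode n))
     else if fst (prod_decode n) = 1 then Sym (snd (prod_decode n))
     else App (dec_tm (fst (prod_decode (snd (prod_decode n))))) (dec_tm (snd (prod_decode (snd (prod_decode n))))))"
  by pat_completeness auto
termination
  by (relation "measure id")
    (auto intro: le_less_trans[OF fst_prod_decode_le] le_less_trans[OF snd_prod_decode_le] snd_prod_decode_less)

declare dec_tm.simps [simp del]

lemma dec_tm_enc [simp]: "dec_tm (enc t) = t"
  by (induction t) (simp_all add: dec_tm.simps)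

lemma cmp_dec_tm: "cmp dec_tm"
proof (rule cmp_rec[where M = "\<lambda>n. n"])
  let ?k = "\<lambda>n. fst (prod_decode n)" and ?m = "\<lambda>n. snd (prod_decode n)"
  let ?l = "\<lambda>n. fst (prod_decode (?m n))" and ?r = "\<lambda>n. snd (prod_decode (?m n))"
  let ?D = "\<lambda>n. if ?k n = 0 then {||} else {|?l n, ?r n|}"
  let ?get = "\<lambda>(g :: (nat \<times> tm) fset) y. pick (snd |`| ffilter (\<lambda>e. fst e = y) g)"
  let ?h = "\<lambda>(n, g). if ?k n = 0 then Var (?m n) else if ?k n = 1 then Sym (?m n)
    else App (?get g (?l n)) (?get g (?r n))"
  show "cmp ?D" "cmp ?h" "cmp (\<lambda>n::nat. n)" by (intro cmp_intros)+
  show "y < x" if "y |\<in>| ?D x" for x y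
    using that snd_prod_decode_less[of x] fst_prod_decode_le[of "?m x"] snd_prod_decode_le[of "?m x"]
    by (auto split: if_splits)
  show "dec_tm n = ?h (n, (\<lambda>y. (y, dec_tm y)) |`| ?D n)" for n
    by (subst dec_tm.simps) (auto simp: get_graph simp del: fimage_finsert)
qed

definition dec_ctxt :: "nat \<Rightarrow> ctxt" where
  "dec_ctxt n = map dec_ty (list_decode n)"

lemma dec_ctxt_enc [simp]: "dec_ctxt (enc \<Gamma>) = \<Gamma>"
  by (simp add: dec_ctxt_def enc_list comp_def)

lemma enc_nat_list [simp]: "enc (xs :: nat list) = list_encode xs"
  by (simp add: enc_list enc_nat[abs_def])

lemma cmp_list_decode [cmp_intros]: "cmp f \<Longrightarrow> cmp (\<lambda>x. list_decode (f x))"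
  by (rule cmp_code[of f]) auto

lemma cmp_dec_ctxt [cmp_intros]: "cmp f \<Longrightarrow> cmp (\<lambda>x. dec_ctxt (f x))"
  unfolding dec_ctxt_def by (intro cmp_intros cmp_comp[OF cmp_dec_ty])

function dec_fm :: "nat \<Rightarrow> fm" where
  "dec_fm n = (if fst (prod_decode n) = 0
     then Atom (fst (prod_decode (snd (prod_decode n)))) (dec_tm (snd (prod_decode (snd (prod_decode n)))))
     else Imp (dec_ctxt (fst (prod_decode (snd (prod_decode n)))))
       (dec_fm |`| decode_fset (fst (prod_decode (snd (prod_decode (snd (prod_decode n)))))))
       (dec_fm |`| decode_fset (snd (prod_decode (snd (prod_decode (snd (prod_decode n))))))))"
  by pat_completeness auto

lemma dec_fm_less:
  assumes "fst (prod_decode n) \<noteq> 0"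
    "x |\<in>| decode_fset (fst (prod_decode (snd (prod_decode (snd (prod_decode n)))))) \<or>
     x |\<in>| decode_fset (snd (prod_decode (snd (prod_decode (snd (prod_decode n))))))"
  shows "x < n"
proof -
  let ?m = "snd (prod_decode (snd (prod_decode n)))"
  have "x < fst (prod_decode ?m) \<or> x < snd (prod_decode ?m)"
    using assms(2) set_decode_nat_lt by auto
  then have "x < ?m" using fst_prod_decode_le[of ?m] snd_prod_decode_le[of ?m] by auto
  then show ?thesis using snd_prod_decode_le[of "snd (prod_decode n)"] snd_prod_decode_less[OF assms(1)] by linarith
qed

termination
  by (relation "measure id") (auto intro: dec_fm_less)

declare dec_fm.simps [simp del]

lemma decode_fset_enc_image: "decode_fset (enc U) = enc |`| U"
  by (intro fset_inject[THEN iffD1]) (simp add: set_decode_enc)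

lemma dec_fm_enc [simp]: "dec_fm (enc C) = C"
proof (induction C)
  case (Imp zs U G)
  have "dec_fm |`| enc |`| X = X" if "X = U \<or> X = G" for X
    using Imp.IH that by (intro fset_eqI) (force simp: image_iff)
  then show ?case by (simp add: dec_fm.simps decode_fset_enc_image)
qed (simp add: dec_fm.simps)

lemma cmp_dec_fm: "cmp dec_fm"
proof (rule cmp_rec[where M = "\<lambda>n. n"])
  let ?k = "\<lambda>n. fst (prod_decode n)" and ?m = "\<lambda>n. snd (prod_decode n)"
  let ?U = "\<lambda>n. decode_fset (fst (prod_decode (?m (?m n))))" and ?G = "\<lambda>n. decode_fset (snd (prod_decode (?m (?m n))))"
  let ?D = "\<lambda>n. if ?k n = 0 then {||} else ?U n |\<union>| ?G n"
  let ?get = "\<lambda>(g :: (nat \<times> fm) fset) X. snd |`| ffilter (\<lambda>e. fst e |\<in>| X) g"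
  let ?h = "\<lambda>(n, g). if ?k n = 0 then Atom (?k (?m n)) (dec_tm (?m (?m n)))
    else Imp (dec_ctxt (?k (?m n))) (?get g (?U n)) (?get g (?G n))"
  have get: "?get ((\<lambda>y. (y, dec_fm y)) |`| A) X = dec_fm |`| X" if "X |\<subseteq>| A" for A X
    using that by force
  show "cmp ?D" "cmp ?h" "cmp (\<lambda>n::nat. n)" by (intro cmp_intros cmp_comp[OF cmp_dec_tm])+
  show "y < x" if "y |\<in>| ?D x" for x y
    using that dec_fm_less[of x y] by (auto split: if_splits)
  show "dec_fm n = ?h (n, (\<lambda>y. (y, dec_fm y)) |`| ?D n)" for n
    using get[of "?U n" "?U n |\<union>| ?G n"] get[of "?G n" "?U n |\<union>| ?G n"]
    by (subst dec_fm.simps) (simp del: fimage_funion)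
qed

definition dec_formula :: "nat \<Rightarrow> formula" where
  "dec_formula n = dec_fm |`| decode_fset n"

lemma dec_formula_enc [simp]: "dec_formula (enc G) = G"
  by (force simp: dec_formula_def decode_fset_enc_image image_iff)

lemma cmp_dec_formula [cmp_intros]: "cmp f \<Longrightarrow> cmp (\<lambda>x. dec_formula (f x))"
  unfolding dec_formula_def by (intro cmp_intros cmp_comp[OF cmp_dec_fm])

section \<open>Deciding well-typedness\<close>

definition is_Var :: "tm \<Rightarrow> bool" where
  "is_Var t \<longleftrightarrow> (case t of Var _ \<Rightarrow> True | Sym _ \<Rightarrow> False | App _ _ \<Rightarrow> False)"

lemma is_Var_iff: "is_Var t \<longleftrightarrow> (\<exists>x. t = Var x)"
  by (cases t) (auto simp: is_Var_def)

lemma cmp_is_Var [cmp_intros]: "cmp t \<Longrightarrow> cmp (\<lambda>x. is_Var (t x))"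
  unfolding is_Var_def by (intro cmp_intros)

lemma typed_clause_iff: "typed_clause S \<Gamma> b C \<longleftrightarrow> fBex (dest_clause C) (\<lambda>(ts, U, P, h).
    (b \<or> is_Var h) \<and> fun_ty ts |\<in>| tys S \<Gamma> h \<and> (ts = [] \<longrightarrow> U = {||}) \<and> fBall U (typed_clause S ts False))"
proof
  assume "typed_clause S \<Gamma> b C"
  then show "fBex (dest_clause C) (\<lambda>(ts, U, P, h).
    (b \<or> is_Var h) \<and> fun_ty ts |\<in>| tys S \<Gamma> h \<and> (ts = [] \<longrightarrow> U = {||}) \<and> fBall U (typed_clause S ts False))"
  proof (rule typed_clauseE)
    fix ts U P h
    assume "C = clause ts U P h" "is_head h" "b \<or> (\<exists>x. h = Var x)" "has_ty S \<Gamma> h (fun_ty ts)"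
      "ts = [] \<longrightarrow> U = {||}" "\<forall>C \<in> fset U. typed_clause S ts False C"
    then show ?thesis by (intro bexI[of _ "(ts, U, P, h)"]) (auto simp: dest_clause_iff is_Var_iff tys_iff)
  qed
next
  assume "fBex (dest_clause C) (\<lambda>(ts, U, P, h).
    (b \<or> is_Var h) \<and> fun_ty ts |\<in>| tys S \<Gamma> h \<and> (ts = [] \<longrightarrow> U = {||}) \<and> fBall U (typed_clause S ts False))"
  then obtain ts U P h where "(ts, U, P, h) |\<in>| dest_clause C" "b \<or> is_Var h" "fun_ty ts |\<in>| tys S \<Gamma> h"
    "ts = [] \<longrightarrow> U = {||}" "fBall U (typed_clause S ts False)" by auto
  then show "typed_clause S \<Gamma> b C"
    unfolding dest_clause_iff is_Var_iff tys_iff using typed_clause.intros[of h b S \<Gamma> ts U P] by auto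
qed

lemma clause_eq_ImpD: "clause ts U P h = Imp zs W G \<Longrightarrow> ts = zs \<and> U = W"
  by (auto simp: clause_def Let_def split: if_splits)

lemma cmp_typed_clause [cmp_intros]:
  assumes S: "finite (dom S)" and "cmp \<Gamma>" "cmp b" "cmp C"
  shows "cmp (\<lambda>x. typed_clause S (\<Gamma> x) (b x) (C x))"
proof -
  have "cmp (\<lambda>x. (\<lambda>p C. typed_clause S (fst p) (snd p) C) (\<Gamma> x, b x) (C x))"
  proof (rule cmp_fm_rec[of "\<lambda>p C. typed_clause S (fst p) (snd p) C"
        "\<lambda>p P t. is_head t \<and> (snd p \<or> is_Var t) \<and> Iota |\<in>| tys S (fst p) t"
        "\<lambda>p zs U G r r'. fBex (dest_clause (Imp zs U G)) (\<lambda>(ts, W, P, h).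
          (snd p \<or> is_Var h) \<and> fun_ty ts |\<in>| tys S (fst p) h \<and> (ts = [] \<longrightarrow> W = {||}) \<and> fBall r (\<lambda>c. c))"
        "\<lambda>p zs U. (zs, False)"])
    show "typed_clause S (fst p) (snd p) (Atom P t) \<longleftrightarrow> is_head t \<and> (snd p \<or> is_Var t) \<and> Iota |\<in>| tys S (fst p) t" for p P t
      by (subst typed_clause_iff) (auto simp: dest_clause_def)
    show "typed_clause S (fst p) (snd p) (Imp zs U G) \<longleftrightarrow> fBex (dest_clause (Imp zs U G)) (\<lambda>(ts, W, P, h).
          (snd p \<or> is_Var h) \<and> fun_ty ts |\<in>| tys S (fst p) h \<and> (ts = [] \<longrightarrow> W = {||}) \<and>
          fBall ((\<lambda>C. typed_clause S (fst (zs, False)) (snd (zs, False)) C) |`| U) (\<lambda>c. c))" for p zs U G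
    proof (subst typed_clause_iff, intro fBex_cong refl)
      fix x assume "x |\<in>| dest_clause (Imp zs U G)"
      moreover obtain ts W P h where x: "x = (ts, W, P, h)" by (metis prod_cases4)
      \<comment> \<open>Every reading of the implication as a clause has prefix \<open>zs\<close>
        and body \<open>U\<close>, so the recursive values computed for \<open>U\<close> in context
        \<open>zs\<close> are the ones required.\<close>
      ultimately have "ts = zs \<and> W = U" by (auto simp: dest_clause_iff dest: clause_eq_ImpD)
      then show "(case x of (ts, U, P, h) \<Rightarrow> (snd p \<or> is_Var h) \<and> fun_ty ts |\<in>| tys S (fst p) h \<and>
          (ts = [] \<longrightarrow> U = {||}) \<and> fBall U (typed_clause S ts False)) =
        (case x of (ts, W, P, h) \<Rightarrow> (snd p \<or> is_Var h) \<and> fun_ty ts |\<in>| tys S (fst p) h \<and> (ts = [] \<longrightarrow> W = {||}) \<and>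
          fBall ((\<lambda>C. typed_clause S (fst (zs, False)) (snd (zs, False)) C) |`| U) (\<lambda>c. c))"
        unfolding x by simp
    qed
  qed (intro cmp_intros assms)+
  then show ?thesis by simp
qed

lemma typed_goal_Atom: "typed_goal S \<Gamma> (Atom P t) \<longleftrightarrow> Iota |\<in>| tys S \<Gamma> t"
  by (auto simp: tys_iff elim: typed_goal.cases intro: typed_Atom)

lemma typed_goal_Imp: "typed_goal S \<Gamma> (Imp zs U G) \<longleftrightarrow>
    fBall U (typed_clause S zs True) \<and> fBall G (typed_goal S (zs @ \<Gamma>))"
  by (auto elim: typed_goal.cases intro: typed_Imp)

lemma cmp_typed_goal [cmp_intros]:
  assumes S: "finite (dom S)" and "cmp \<Gamma>" "cmp C"
  shows "cmp (\<lambda>x. typed_goal S (\<Gamma> x) (C x))"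
proof (rule cmp_fm_rec[of "typed_goal S" "\<lambda>\<Gamma> P t. Iota |\<in>| tys S \<Gamma> t"
      "\<lambda>\<Gamma> zs U G r r'. fBall U (\<lambda>C. typed_clause S zs True C) \<and> fBall r' (\<lambda>c. c)" "\<lambda>\<Gamma> zs U. zs @ \<Gamma>"])
  show "typed_goal S \<Gamma> (Imp zs U G) \<longleftrightarrow> fBall U (\<lambda>C. typed_clause S zs True C) \<and> fBall (typed_goal S (zs @ \<Gamma>) |`| G) (\<lambda>c. c)"
    for \<Gamma> zs U G by (simp add: typed_goal_Imp)
qed (intro typed_goal_Atom cmp_intros assms)+

section \<open>Iteration up to a fixed point\<close>

text \<open>If the chain still grew at stage \<open>card B\<close>, it would have grown at all
  earlier stages too, giving \<open>card B + 1\<close> elements inside \<open>B\<close>. The bound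
  depends on \<open>B\<close> alone, so one number of iterations serves all chains inside
  \<open>B\<close>.\<close>

lemma chain_stable:
  fixes X :: "nat \<Rightarrow> 'a fset"
  assumes "\<And>k. X (Suc k) = g (X k)" "\<And>k. X k |\<subseteq>| X (Suc k)" "\<And>k. fset (X k) \<subseteq> B" "finite B"
  shows "X (Suc (card B)) = X (card B)"
proof (rule ccontr)
  assume neq: "X (Suc (card B)) \<noteq> X (card B)"
  \<comment> \<open>Each stage is a function of the previous one, so a single repetition makes the
    chain constant from there on.\<close>
  have "X (Suc m) = X m" if "X (Suc k) = X k" "k \<le> m" for k m
    using that(2,1) by (induction rule: dec_induct) (simp_all add: assms(1))
  then have "X (Suc k) \<noteq> X k" if "k \<le> card B" for k using neq that by blast
  then have strict: "fset (X k) \<subset> fset (X (Suc k))" if "k \<le> card B" for k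
    using assms(2)[of k] that by (metis fset_inject less_eq_fset.rep_eq psubsetI)
  have "k \<le> Suc (card B) \<Longrightarrow> k \<le> card (fset (X k))" for k
  proof (induction k)
    case (Suc k)
    then have "card (fset (X k)) < card (fset (X (Suc k)))" by (intro psubset_card_mono strict) auto
    then show ?case using Suc by simp
  qed simp
  from this[of "Suc (card B)"] have "Suc (card B) \<le> card (fset (X (Suc (card B))))" by simp
  also have "\<dots> \<le> card B" by (intro card_mono assms)
  finally show False by simp
qed

definition reach :: "sig \<Rightarrow> state \<Rightarrow> formula \<Rightarrow> nat \<Rightarrow> formula fset" where
  "reach S p G = rec_nat {|G|} (\<lambda>k X. X |\<union>| fbind X (steps S p))"

lemma reach_simps [simp]: "reach S p G 0 = {|G|}"
  "reach S p G (Suc k) = reach S p G k |\<union>| fbind (reach S p G k) (steps S p)"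
  by (auto simp: reach_def)

lemma reach_sound: "H |\<in>| reach S (\<Gamma>, V, ys) G k \<Longrightarrow> rews S \<Gamma> V ys G H"
  by (induction k arbitrary: H) (auto simp: steps_correct[symmetric] intro: rtranclp.rtrancl_into_rtrancl)

lemma reach_complete:
  assumes "reach S (\<Gamma>, V, ys) G (Suc k) = reach S (\<Gamma>, V, ys) G k" "rews S \<Gamma> V ys G H"
  shows "H |\<in>| reach S (\<Gamma>, V, ys) G k"
  using assms(2)
proof induction
  case base
  show ?case by (induction k) auto
next
  case (step H K)
  then have "K |\<in>| reach S (\<Gamma>, V, ys) G (Suc k)" by (auto simp: steps_correct)
  then show ?case using assms(1) by (simp only:)
qed

definition valid :: "sig \<Rightarrow> state \<Rightarrow> formula \<Rightarrow> bool" where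
  "valid S p G \<longleftrightarrow> fBall (fst (snd p)) (\<lambda>C. typed_clause S (fst p) True C) \<and> fBall G (\<lambda>C. typed_goal S (fst p) C)"

lemma reach_stable:
  assumes "valid S (\<Gamma>, V, ys) G"
  shows "\<exists>k. reach S (\<Gamma>, V, ys) G (Suc k) = reach S (\<Gamma>, V, ys) G k"
proof -
  have "finite {H. rews S \<Gamma> V ys G H}"
    using assms by (intro finite_reachable) (auto simp: valid_def typed_clauses_def)
  then have "reach S (\<Gamma>, V, ys) G (Suc (card {H. rews S \<Gamma> V ys G H})) =
    reach S (\<Gamma>, V, ys) G (card {H. rews S \<Gamma> V ys G H})"
    by (rule chain_stable[rotated -1]) (rule reach_simps, use reach_sound in auto)
  then show ?thesis ..
qed

definition dec_state :: "nat \<Rightarrow> state" where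
  "dec_state n = (dec_ctxt (nth_default 0 (list_decode n) 0), dec_formula (nth_default 0 (list_decode n) 1),
     list_decode (nth_default 0 (list_decode n) 2))"

definition stable :: "sig \<Rightarrow> nat \<Rightarrow> nat \<Rightarrow> bool" where
  "stable S n k \<longleftrightarrow> (let p = dec_state n; G = dec_formula (nth_default 0 (list_decode n) 3)
     in valid S p G \<longrightarrow> reach S p G (Suc k) = reach S p G k)"

definition decide :: "sig \<Rightarrow> nat \<Rightarrow> bool" where
  "decide S n \<longleftrightarrow> dec_formula (nth_default 0 (list_decode n) 4) |\<in>|
     reach S (dec_state n) (dec_formula (nth_default 0 (list_decode n) 3)) (LEAST k. stable S n k)"

lemma code_input_enc: "code_input (\<Gamma>, V, ys, G, U) = enc [enc \<Gamma>, enc V, enc ys, enc G, enc U]"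
  by simp

lemma decide_correct:
  assumes "valid S (\<Gamma>, V, ys) G"
  shows "decide S (code_input (\<Gamma>, V, ys, G, U)) \<longleftrightarrow> rews S \<Gamma> V ys G U"
proof -
  let ?n = "code_input (\<Gamma>, V, ys, G, U)"
  have dec: "dec_state ?n = (\<Gamma>, V, ys)" "dec_formula (nth_default 0 (list_decode ?n) 3) = G"
    "dec_formula (nth_default 0 (list_decode ?n) 4) = U"
    by (simp_all add: dec_state_def nth_default_def)
  have "stable S ?n (LEAST k. stable S ?n k)"
    by (rule LeastI_ex) (use reach_stable[OF assms] in \<open>simp only: stable_def dec Let_def, blast\<close>)
  then have "reach S (\<Gamma>, V, ys) G (Suc (LEAST k. stable S ?n k)) = reach S (\<Gamma>, V, ys) G (LEAST k. stable S ?n k)"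
    using assms unfolding stable_def[of S ?n] dec Let_def by blast
  from reach_complete[OF this] reach_sound show ?thesis
    unfolding decide_def dec by blast
qed

lemma cmp_reach [cmp_intros]:
  assumes "finite (dom S)" "cmp p" "cmp G" "cmp k"
  shows "cmp (\<lambda>x. reach S (p x) (G x) (k x))"
  unfolding reach_def by (intro cmp_intros assms cmp_comp[OF assms(2)])

lemma cmp_decide:
  assumes S: "finite (dom S)"
  shows "cmp (decide S)"
proof -
  have st: "cmp (\<lambda>x. dec_state (f x))" if "cmp f" for f :: "'x::enc \<Rightarrow> nat"
    unfolding dec_state_def by (intro cmp_intros that)
  have "cmp (\<lambda>p. stable S (fst p) (snd p))"
    unfolding stable_def Let_def valid_def by (intro cmp_intros S st)
  moreover have "\<exists>k. stable S n k" for n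
    using reach_stable[of S "fst (dec_state n)" "fst (snd (dec_state n))" "snd (snd (dec_state n))"]
    unfolding stable_def by (auto simp: Let_def)
  ultimately have "cmp (\<lambda>n. LEAST k. stable S n k)" by (rule cmp_Least)
  then show ?thesis unfolding decide_def by (intro cmp_intros S st)
qed

lemma valid_input:
  assumes "automaton_formula S Pr \<Gamma> V" "goal S Pr \<Gamma> G"
  shows "valid S (\<Gamma>, V, ys) G"
  using automaton_formula_typed[OF assms(1)] assms(2) goal_fm_typed
  by (fastforce simp: valid_def typed_clauses_def goal_def)


section \<open>Finiteness of the automaton clauses\<close>

lemma automaton_cases:
  assumes "automaton S Pr \<Delta> U" "C |\<in>| U"
  obtains (var) ts W P x where "C = clause ts W P (Var x)" "(x, fun_ty ts) \<in> \<Delta>" "P \<in> Pr" "automaton S Pr (env ts) W"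
      "ts = [] \<longrightarrow> W = {||}"
  | (sym) ts W P c where "\<Delta> = {}" "C = clause ts W P (Sym c)" "S c = Some (fun_ty ts)" "P \<in> Pr" "automaton S Pr (env ts) W"
      "ts = [] \<longrightarrow> W = {||}"
  using assms
proof (induction arbitrary: thesis)
  case (aut_const P c)
  from aut_const.prems(2)[of "[]" "{||}" P c] aut_const show ?case by (simp add: automaton.aut_true)
next
  case (aut_var P x)
  from aut_var.prems(1)[of "[]" "{||}" P x] aut_var show ?case by (simp add: automaton.aut_true)
next
  case (aut_fun P ts U f)
  from aut_fun.prems(2)[of ts U P f] aut_fun show ?case by simp
next
  case (aut_app P ts U x)
  from aut_app.prems(1)[of ts U P x] aut_app show ?case by simp
next
  case (aut_and \<Delta>1 U \<Delta>2 V)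
  show ?case
  proof (cases "C |\<in>| U")
    case True
    show ?thesis by (rule aut_and.IH(1)[OF _ _ True]) (use aut_and.prems(1,2) aut_and.hyps in blast)+
  next
    case False
    then have "C |\<in>| V" using aut_and.prems(3) by simp
    show ?thesis by (rule aut_and.IH(2)[OF _ _ \<open>C |\<in>| V\<close>]) (use aut_and.prems(1,2) aut_and.hyps in blast)+
  qed
qed simp

lemma finite_fun_ty: "finite {ts. fun_ty ts = a}"
proof (cases "\<exists>ts. fun_ty ts = a")
  case True
  then obtain ts where "fun_ty ts = a" by blast
  then have "{ts. fun_ty ts = a} \<subseteq> {ts}" using fun_ty_inj by auto
  then show ?thesis by (rule finite_subset) simp
qed simp

text \<open>A nonempty prefix leaves only clauses about its variables. The prefix of such a clause
  is determined by the type of its variable, and its function type is of smaller depth than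
  \<open>fun_ty ts\<close>, so there are finitely many bodies by induction.\<close>

lemma finite_automata:
  assumes Pr: "finite Pr" and ts: "ts \<noteq> []"
  shows "finite {U. automaton S Pr (env ts) U}"
  using ts
proof (induction "depth (fun_ty ts)" arbitrary: ts rule: less_induct)
  case less
  \<comment> \<open>With an empty prefix the clause is an atom and its body is \<open>true\<close>;
    the induction hypothesis is about nonempty prefixes only.\<close>
  define W where "W us = {U. automaton S Pr (env us) U \<and> (us = [] \<longrightarrow> U = {||})}" for us
  let ?X = "\<Union>P \<in> Pr. \<Union>x \<in> {..<length ts}. \<Union>us \<in> {us. fun_ty us = ts ! x}. (\<lambda>U. clause us U P (Var x)) ` W us"
  have "finite (W us)" if "x < length ts" "fun_ty us = ts ! x" for x us
  proof (cases "us = []")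
    case False
    have "depth (fun_ty us) < depth (fun_ty ts)" using that by (simp add: depth_fun_ty)
    then show ?thesis using less.hyps[of us] False by (simp add: W_def)
  qed (simp add: W_def)
  then have "finite ?X" using Pr by (intro finite_UN_I finite_imageI) (auto simp: finite_fun_ty)
  moreover have "fset U \<subseteq> ?X" if "automaton S Pr (env ts) U" for U
  proof
    fix C assume "C \<in> fset U"
    then have "C |\<in>| U" by simp
    with that show "C \<in> ?X"
    proof (cases rule: automaton_cases)
      case (var us V P x)
      then have "V \<in> W us" "x < length ts" "fun_ty us = ts ! x" by (auto simp: W_def mem_env)
      then show ?thesis using var(1,3) by blast
    qed (use less.prems in simp)
  qed
  ultimately show ?case using finite_subset[OF _ finite_subformulas, of "{U. automaton S Pr (env ts) U}" ?X] by blast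
qed

lemma finite_automaton_clauses:
  assumes S: "finite (dom S)" and Pr: "finite Pr"
  shows "finite {C. automaton S Pr {} {|C|}}"
proof -
  define W where "W us = {U. automaton S Pr (env us) U \<and> (us = [] \<longrightarrow> U = {||})}" for us
  let ?X = "\<Union>P \<in> Pr. \<Union>c \<in> dom S. \<Union>us \<in> {us. fun_ty us = the (S c)}. (\<lambda>U. clause us U P (Sym c)) ` W us"
  have "finite (W us)" for us
    using finite_automata[OF Pr, of us S] by (cases "us = []") (simp_all add: W_def)
  then have "finite ?X" using S Pr by (intro finite_UN_I finite_imageI) (auto simp: finite_fun_ty)
  moreover have "{C. automaton S Pr {} {|C|}} \<subseteq> ?X"
  proof
    fix C assume "C \<in> {C. automaton S Pr {} {|C|}}"
    then have "automaton S Pr {} {|C|}" "C |\<in>| {|C|}" by simp_all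
    then show "C \<in> ?X"
    proof (cases rule: automaton_cases)
      case (sym us V P c)
      then have "V \<in> W us" "c \<in> dom S" "fun_ty us = the (S c)" by (auto simp: W_def)
      then show ?thesis using sym(2,4) by blast
    qed simp
  qed
  ultimately show ?thesis by (rule rev_finite_subset)
qed

section \<open>Stages of the canonical solved form\<close>

type_synonym clause_data = "ty list \<times> formula \<times> nat \<times> nat"

text \<open>The table of all candidates for new clauses, with the components that a stage has to
  inspect kept apart. It depends on the signatures alone, so it enters the computation as a constant
  and its own construction need not be effective.\<close>

definition canonical_data :: "sig \<Rightarrow> nat set \<Rightarrow> clause_data fset" where
  "canonical_data S Pr = Abs_fset {(ts, U, P, c).
     automaton S Pr (env ts) U \<and> automaton S Pr {} {|clause ts U P (Sym c)|}}"

lemma canonical_data_iff: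
  assumes "finite (dom S)" "finite Pr"
  shows "(ts, U, P, c) |\<in>| canonical_data S Pr \<longleftrightarrow>
    automaton S Pr (env ts) U \<and> automaton S Pr {} {|clause ts U P (Sym c)|}"
proof -
  let ?A = "{(ts, U, P, c). automaton S Pr (env ts) U \<and> automaton S Pr {} {|clause ts U P (Sym c)|}}"
  let ?f = "\<lambda>(ts, U, P, c). clause ts U P (Sym c)"
  have "inj_on ?f ?A" by (rule inj_onI) (auto dest!: clause_inj)
  moreover have "?f ` ?A \<subseteq> {C. automaton S Pr {} {|C|}}" by auto
  from this finite_automaton_clauses[OF assms] have "finite (?f ` ?A)" by (rule finite_subset)
  ultimately have "finite ?A" by (rule finite_imageD[rotated])
  then show ?thesis by (simp add: canonical_data_def Abs_fset_inverse)
qed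

text \<open>The whole previous stage takes the place of an arbitrary finite set \<open>V\<close> of
  derived clauses. The rewriting target ranges over the finite table of candidates, so no search
  over formulas is required.\<close>

definition canonical_step :: "sig \<Rightarrow> nat set \<Rightarrow> formula \<Rightarrow> formula \<Rightarrow> formula" where
  "canonical_step S Pr D X = (\<lambda>(ts, U, P, c). clause ts U P (Sym c)) |`|
     ffilter (\<lambda>(ts, U, P, c). fBex (fbind D dest_clause) (\<lambda>(us, G, Q, h). us = ts \<and> Q = P \<and> h = Sym c \<and>
       decide S (code_input (ts, X, [0..<length ts], G, U)))) (canonical_data S Pr)"

definition canonical_iter :: "sig \<Rightarrow> nat set \<Rightarrow> formula \<Rightarrow> nat \<Rightarrow> formula" where
  "canonical_iter S Pr D = rec_nat {||} (\<lambda>k X. X |\<union>| canonical_step S Pr D X)"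

lemma canonical_iter_simps [simp]: "canonical_iter S Pr D 0 = {||}"
  "canonical_iter S Pr D (Suc k) = canonical_iter S Pr D k |\<union>| canonical_step S Pr D (canonical_iter S Pr D k)"
  by (auto simp: canonical_iter_def)

lemma canonical_automaton: "C \<in> canonical S Pr D \<Longrightarrow> automaton S Pr {} {|C|}"
  by (induction rule: canonical.induct) simp

lemma automaton_fset: "(\<And>C. C |\<in>| V \<Longrightarrow> automaton S Pr {} {|C|}) \<Longrightarrow> automaton S Pr {} V"
proof (induction V)
  case (insert C V)
  then show ?case using aut_and[of S Pr "{}" "{|C|}" "{}" V] by simp
qed (rule aut_true)

text \<open>This permits replacing the finite set of clauses used in a derivation of
  \<open>canonical\<close> by the entire final stage.\<close>

lemma rews_mono: "rews S \<Gamma> V ys G H \<Longrightarrow> V |\<subseteq>| V' \<Longrightarrow> rews S \<Gamma> V' ys G H"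
  by (induction rule: rtranclp_induct) (auto intro: rew_mono rtranclp.rtrancl_into_rtrancl)

lemma canonical_step_iff:
  assumes S: "finite (dom S)" and Pr: "finite Pr" and D: "definite S Pr D"
    and X: "automaton S Pr {} X"
  shows "C |\<in>| canonical_step S Pr D X \<longleftrightarrow> (\<exists>ts U P c G. C = clause ts U P (Sym c) \<and>
    automaton S Pr (env ts) U \<and> automaton S Pr {} {|clause ts U P (Sym c)|} \<and>
    clause ts G P (Sym c) |\<in>| D \<and> rews S ts X [0..<length ts] G U)"
proof -
  have dec: "decide S (code_input (ts, X, [0..<length ts], G, U)) \<longleftrightarrow> rews S ts X [0..<length ts] G U"
    if cl: "clause ts G P (Sym c) |\<in>| D" for ts G P c U
  proof -
    \<comment> \<open>A clause determines its components, so the body read off here is the goal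
      formula guaranteed by \<open>definite\<close>, and the input of \<open>decide\<close> is
      valid.\<close>
    obtain ts' G' P' c' where "clause ts G P (Sym c) = clause ts' G' P' (Sym c')" "basic_goal S Pr ts' G'"
      using D cl unfolding definite_def by blast
    then have "basic_goal S Pr ts G" using clause_inj by (metis is_head_simps(2))
    then have "goal S Pr ts G" by (auto simp: basic_goal_def goal_def intro: goal_fm.intros)
    moreover have "automaton_formula S Pr ts X"
      unfolding automaton_formula_def using X by blast
    ultimately show ?thesis by (intro decide_correct valid_input)
  qed
  have ex: "fBex (fbind D dest_clause) (\<lambda>(us, G, Q, h). us = ts \<and> Q = P \<and> h = Sym c \<and> R G) \<longleftrightarrow>
    (\<exists>E G. E |\<in>| D \<and> (ts, G, P, Sym c) |\<in>| dest_clause E \<and> R G)" for ts P c R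
    by (auto simp: Bex_def)
  have "C |\<in>| canonical_step S Pr D X \<longleftrightarrow> (\<exists>ts U P c. C = clause ts U P (Sym c) \<and>
    (ts, U, P, c) |\<in>| canonical_data S Pr \<and>
    (\<exists>E G. E |\<in>| D \<and> (ts, G, P, Sym c) |\<in>| dest_clause E \<and> decide S (code_input (ts, X, [0..<length ts], G, U))))"
    unfolding canonical_step_def ex by (auto simp: image_iff Bex_def simp del: code_input.simps) blast+
  also have "\<dots> \<longleftrightarrow> (\<exists>ts U P c G. C = clause ts U P (Sym c) \<and>
    automaton S Pr (env ts) U \<and> automaton S Pr {} {|clause ts U P (Sym c)|} \<and>
    clause ts G P (Sym c) |\<in>| D \<and> rews S ts X [0..<length ts] G U)"
    unfolding canonical_data_iff[OF S Pr] dest_clause_iff using dec by (metis is_head_simps(2))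
  finally show ?thesis .
qed

lemma canonical_iter_sound:
  assumes S: "finite (dom S)" and Pr: "finite Pr" and D: "definite S Pr D"
  shows "C |\<in>| canonical_iter S Pr D k \<Longrightarrow> C \<in> canonical S Pr D"
proof (induction k arbitrary: C)
  case (Suc k)
  let ?X = "canonical_iter S Pr D k"
  have X: "automaton S Pr {} ?X" by (rule automaton_fset) (rule canonical_automaton[OF Suc.IH])
  from Suc.prems consider "C |\<in>| ?X" | "C |\<in>| canonical_step S Pr D ?X" by auto
  then show ?case
  proof cases
    case 2
    then obtain ts U P c G where *: "C = clause ts U P (Sym c)" "automaton S Pr (env ts) U"
      "automaton S Pr {} {|clause ts U P (Sym c)|}" "clause ts G P (Sym c) |\<in>| D"
      "rews S ts ?X [0..<length ts] G U" unfolding canonical_step_iff[OF S Pr D X] by blast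
    show ?thesis unfolding *(1) by (rule canonical.intros[OF *(4) _ *(5,2,3)]) (use Suc.IH in blast)
  qed (rule Suc.IH)
qed simp

text \<open>All stages consist of automaton clauses, so their number bounds the iteration for every
  \<open>D\<close>. The stage reached is closed under the rule of \<open>canonical\<close> and
  contains only derivable clauses.\<close>

lemma canonical_iter_eq:
  assumes S: "finite (dom S)" and Pr: "finite Pr" and D: "definite S Pr D"
  shows "fset (canonical_iter S Pr D (card {C. automaton S Pr {} {|C|}})) = canonical S Pr D"
proof
  let ?N = "card {C. automaton S Pr {} {|C|}}"
  let ?X = "canonical_iter S Pr D ?N"
  have X: "automaton S Pr {} {|C|}" if "C |\<in>| canonical_iter S Pr D k" for C k
    using canonical_iter_sound[OF assms that] by (rule canonical_automaton)
  have X': "automaton S Pr {} ?X" by (rule automaton_fset) (rule X)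
  have "canonical_iter S Pr D (Suc ?N) = ?X"
    by (rule chain_stable[where X = "canonical_iter S Pr D" and g = "\<lambda>X. X |\<union>| canonical_step S Pr D X"])
      (use X finite_automaton_clauses[OF S Pr] in auto)
  then have sub: "canonical_step S Pr D ?X |\<subseteq>| ?X" by auto
  show "canonical S Pr D \<subseteq> fset ?X"
  proof
    fix C assume "C \<in> canonical S Pr D"
    then show "C \<in> fset ?X"
    proof induction
      case (1 ts G P c V U)
      from 1 have "V |\<subseteq>| ?X" by auto
      moreover from 1 have "rews S ts V [0..<length ts] G U" by simp
      ultimately have "rews S ts ?X [0..<length ts] G U" by (rule rews_mono[rotated])
      with 1 have "clause ts U P (Sym c) |\<in>| canonical_step S Pr D ?X"
        unfolding canonical_step_iff[OF S Pr D X'] by blast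
      then show ?case using sub by auto
    qed
  qed
qed (use canonical_iter_sound[OF assms] in blast)

text \<open>The number \<open>k\<close> of stages and the table of candidates are constants; only
  \<open>D\<close> is an input.\<close>

lemma cmp_canonical_iter:
  assumes S: "finite (dom S)"
  shows "cmp (\<lambda>D. canonical_iter S Pr D k)"
  unfolding canonical_iter_def canonical_step_def code_input_enc
  by (intro cmp_intros cmp_comp[OF cmp_decide[OF S]])

theorem theorem4p8:
  fixes S :: sig and Pr :: "nat set"
  assumes "finite (dom S)" and "finite Pr"
  shows "decidable_on
      {(\<Gamma>, V, ys, G, U). automaton_formula S Pr \<Gamma> V \<and> set ys \<subseteq> {..<length \<Gamma>} \<and>
         goal S Pr \<Gamma> G \<and> automaton_formula S Pr \<Gamma> U}
      code_input (\<lambda>(\<Gamma>, V, ys, G, U). rews S \<Gamma> V ys G U)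
    \<and> (\<forall>D. definite S Pr D \<longrightarrow> finite (canonical S Pr D))
    \<and> computable_on {D. definite S Pr D} code_formula code_clauses (canonical S Pr)"
proof (intro conjI allI impI)
  obtain f where f: "computable f" "\<And>n. f n = of_bool (decide S n)"
    using cmp_decide[OF assms(1)] by (rule cmpE) (auto simp: enc_bool)
  show "decidable_on
      {(\<Gamma>, V, ys, G, U). automaton_formula S Pr \<Gamma> V \<and> set ys \<subseteq> {..<length \<Gamma>} \<and>
         goal S Pr \<Gamma> G \<and> automaton_formula S Pr \<Gamma> U}
      code_input (\<lambda>(\<Gamma>, V, ys, G, U). rews S \<Gamma> V ys G U)"
    unfolding decidable_on_def computable_on_def using f decide_correct valid_input
    by (intro exI[of _ f]) (auto simp del: code_input.simps)
next
  fix D assume "definite S Pr D"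
  then show "finite (canonical S Pr D)" using canonical_iter_eq[OF assms] by (metis finite_fset)
next
  let ?N = "card {C. automaton S Pr {} {|C|}}"
  obtain f where f: "computable f" "\<And>D. f (enc D) = enc (canonical_iter S Pr D ?N)"
    using cmp_canonical_iter[OF assms(1)] by (rule cmpE) blast
  have "f (code_formula D) = code_clauses (canonical S Pr D)" if "definite S Pr D" for D
    using f(2)[of D] code_clauses_eq[of "canonical_iter S Pr D ?N"] canonical_iter_eq[OF assms that] by simp
  then show "computable_on {D. definite S Pr D} code_formula code_clauses (canonical S Pr)"
    unfolding computable_on_def using f(1) by blast
qed

end
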